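(* Let $n\geq 1$ and let $(\mathcal{C},\mathcal{X})$ and $(\mathcal{C}',\mathcal{X}')$ be $n$-exact categories. Set $\mathbb{E}=\mathbb{E}_{\mathcal{X}}$ and $\mathbb{E}'=\mathbb{E}_{\mathcal{X}'}$. Assume that $\mathbb{E}(X^{n+1},X^0)$ is a set for all $X^0,X^{n+1}\in\mathcal{C}$ and that $\mathbb{E}'(Z^{n+1},Z^0)$ is a set for all $Z^0,Z^{n+1}\in\mathcal{C}'$. Consider the associated $n$-exangulated categories $(\mathcal{C},\mathbb{E},\mathfrak{s})$ and $(\mathcal{C}',\mathbb{E}',\mathfrak{s}')$. Suppose $\mathscr{F}\colon\mathcal{C}\to\mathcal{C}'$ is an additive covariant functor. Then $\mathscr{F}$ is an $n$-exact functor if and only if $\mathscr{F}$ is an $n$-exangulated functor.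
   Context: Fix an integer $n\geq 1$ and an additive category $\mathcal{C}$. Let $\mathsf{C}^m_{\mathcal{C}}$ denote the category of cochain complexes in $\mathcal{C}$ concentrated in degrees $0,\dots,m+1$. **$n$-kernels, $n$-exact sequences.** An $n$-kernel of $d_X^n\colon X^n\to X^{n+1}$ is a sequence $(d_X^0,\dots,d_X^{n-1})$ of composable morphisms $X^0\xrightarrow{d_X^0}X^1\to\cdots\xrightarrow{d_X^{n-1}}X^n$ such that $0\to\mathcal{C}(Z,X^0)\to\mathcal{C}(Z,X^1)\to\cdots\to\mathcal{C}(Z,X^n)\to\mathcal{C}(Z,X^{n+1})$ is exact for all $Z\in\mathcal{C}$. An $n$-cokernel is defined dually. An $n$-exact sequence is a complex $X^\bullet\in\mathsf{C}^n_{\mathcal{C}}$ such that $(d_X^0,\dots,d_X^{n-1})$ is an $n$-kernel of $d_X^n$ and $(d_X^1,\dots,d_X^n)$ is an $n$-cokernel of $d_X^0$. A morphism of $n$-exact sequences is a morphism of complexes. **Mapping cone, $n$-pullback, $n$-pushout.** For a morphism $f^\bullet\colon X^\bullet\to Y^\bullet$ in $\mathsf{C}^{n-1}_{\mathcal{C}}$ the mapping cone is the complex $X^0\xrightarrow{d_C^{-1}}X^1\oplus Y^0\xrightarrow{d_C^0}X^2\oplus Y^1\to\cdots\to X^n\oplus Y^{n-1}\xrightarrow{d_C^{n-1}}Y^n$ with $d_C^{-1}=\begin{pmatrix}-d_X^0\\ f^0\end{pmatrix}$, $d_C^{n-1}=(f^n\ \ d_Y^{n-1})$ and $d_C^i=\begin{pmatrix}-d_X^{i+1}&0\\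 f^{i+1}&d_Y^i\end{pmatrix}$ for $0\leq i\leq n-2$. Given $X^\bullet\in\mathsf{C}^{n-1}_{\mathcal{C}}$ and $g^n\colon Z^n\to X^n$, an $n$-pullback of $(d_X^0,\dots,d_X^{n-1})$ along $g^n$ is a morphism of complexes $g^\bullet\colon Z^\bullet\to X^\bullet$ in $\mathsf{C}^{n-1}_{\mathcal{C}}$ with $n$-th component $g^n$ such that, in its mapping cone, $(d_C^{-1},\dots,d_C^{n-2})$ is an $n$-kernel of $d_C^{n-1}$. Dually, an $n$-pushout of $(d_X^0,\dots,d_X^{n-1})$ along $f^0\colon X^0\to Y^0$ is a morphism of complexes $f^\bullet\colon X^\bullet\to Y^\bullet$ in $\mathsf{C}^{n-1}_{\mathcal{C}}$ with $0$-th component $f^0$ such that, in its mapping cone, $(d_C^0,\dots,d_C^{n-1})$ is an $n$-cokernel of $d_C^{-1}$. **$n$-exact categories.** A morphism $f^\bullet$ of $n$-exact sequences is a weak isomorphism if for some $i\in\{0,\dots,n+1\}$ both $f^i$ and $f^{i+1}$ are isomorphisms, where $f^{n+2}:=f^0$; its source and target are then called weakly isomorphic. Let $\mathcal{X}$ be a class of $n$-exact sequences closed under weak isomorphisms; its members are called $\mathcal{X}$-admissible $n$-exact sequences, and for $X^\bullet\in\mathcal{X}$, $d_X^0$ is an $\mathcal{X}$-admissible monomorphism and $d_X^n$ is an $\mathcal{X}$-admissible epimorphism. $(\mathcal{C},\mathcal{X})$ is an $n$-exact category if: ($n$-E0) $0\to0\to\cdots\to0$ is in $\mathcal{X}$;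 ($n$-E1) admissible monomorphisms are closed under composition; ($n$-E1$^{\mathrm{op}}$) admissible epimorphisms are closed under composition; ($n$-E2) for $X^\bullet\in\mathcal{X}$ and $f^0\colon X^0\to Y^0$ there is an $n$-pushout of $(d_X^0,\dots,d_X^{n-1})$ along $f^0$, with target $Y^0\xrightarrow{d_Y^0}\cdots\to Y^n$, such that $d_Y^0$ is an admissible monomorphism; ($n$-E2$^{\mathrm{op}}$) the dual of ($n$-E2). **$n$-exact functor.** For an additive functor $\mathscr{F}$, $\mathscr{F}_{\mathsf{C}}$ denotes the functor on complexes applying $\mathscr{F}$ degreewise. An additive covariant functor $\mathscr{F}\colon\mathcal{C}\to\mathcal{C}'$ between $n$-exact categories $(\mathcal{C},\mathcal{X})$, $(\mathcal{C}',\mathcal{X}')$ is $n$-exact if $\mathscr{F}_{\mathsf{C}}(\mathcal{X})\subseteq\mathcal{X}'$. **Homotopy classes.** For objects $A,C$, let $\mathsf{C}^n_{(A,C)}$ be the category of complexes $X^\bullet\in\mathsf{C}^n_{\mathcal{C}}$ with $X^0=A$, $X^{n+1}=C$, with morphisms the chain maps $f^\bullet$ with $f^0=1_A$, $f^{n+1}=1_C$. Two such morphisms are identified if they are homotopic in the usual sense; $X^\bullet,Y^\bullet$ are homotopy equivalent if they become isomorphic in the quotient category, and $[X^\bullet]$ is the homotopy equivalence class in $\mathsf{C}^n_{(A,C)}$. **The $n$-exangulated category of an $n$-exact category.** $\mathbb{E}_{\mathcal{X}}(X^{n+1},X^0)$ is the class of all homotopy equivalence classes $[X^\bullet]$ in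 $\mathsf{C}^n_{(X^0,X^{n+1})}$ of $n$-exact sequences $X^\bullet\in\mathcal{X}$ (assumed to be a set). For $[X^\bullet]\in\mathbb{E}_{\mathcal{X}}(X^{n+1},X^0)$ and $f\colon X^0\to Y^0$, forming an $n$-pushout of $(d_X^0,\dots,d_X^{n-1})$ along $f$ one obtains a morphism $(f,f^1,\dots,f^n,1_{X^{n+1}})\colon X^\bullet\to Y^\bullet$ of $\mathcal{X}$-admissible $n$-exact sequences, and $\mathbb{E}_{\mathcal{X}}(X^{n+1},f)([X^\bullet]):=[Y^\bullet]$. For $g\colon Y^{n+1}\to X^{n+1}$, $\mathbb{E}_{\mathcal{X}}(g,X^0)$ is defined dually via $n$-pullbacks of $(d_X^1,\dots,d_X^n)$ along $g$. The sum in $\mathbb{E}_{\mathcal{X}}(C,A)$ is the Baer sum $[X^\bullet]+[Y^\bullet]=\mathbb{E}_{\mathcal{X}}(\Delta_C,\nabla_A)([X^\bullet\oplus Y^\bullet])$, where $\Delta_C\colon C\to C\oplus C$ is the diagonal and $\nabla_A\colon A\oplus A\to A$ the codiagonal. It is known that $\mathbb{E}_{\mathcal{X}}\colon\mathcal{C}^{\mathrm{op}}\times\mathcal{C}\to\mathsf{Ab}$ is a well-defined biadditive functor and that, with $\mathfrak{s}(\delta)=[X^\bullet]$ for $\delta=[X^\bullet]$, $(\mathcal{C},\mathbb{E}_{\mathcal{X}},\mathfrak{s})$ is an $n$-exangulated category in the sense of Herschend–Liu–Nakaoka. **$n$-exangulated functor.** (Only the underlying data of the $n$-exangulated categories enter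 this definition.) An additive covariant functor $\mathscr{F}\colon\mathcal{C}\to\mathcal{C}'$ between $n$-exangulated categories $(\mathcal{C},\mathbb{E},\mathfrak{s})$ and $(\mathcal{C}',\mathbb{E}',\mathfrak{s}')$ is $n$-exangulated if there is a natural transformation $\Gamma\colon\mathbb{E}(-,-)\Rightarrow\mathbb{E}'(\mathscr{F}-,\mathscr{F}-)$ of functors $\mathcal{C}^{\mathrm{op}}\times\mathcal{C}\to\mathsf{Ab}$ such that $\mathfrak{s}(\delta)=[X^\bullet]$ implies $\mathfrak{s}'(\Gamma_{(X^{n+1},X^0)}(\delta))=[\mathscr{F}_{\mathsf{C}}X^\bullet]$. *)

theory Defs
  imports "HOL-Algebra.Coset"
begin

section \<open>Additive categories and functors\<close>

text \<open>Composition is written in the usual order: \<open>g \<cdot> f\<close> is ``first \<open>f\<close>, then \<open>g\<close>''.\<close>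

record ('o, 'm) precat =
  Obj :: "'o set"
  Arr :: "'m set"
  Dom :: "'m \<Rightarrow> 'o"
  Cod :: "'m \<Rightarrow> 'o"
  Idn :: "'o \<Rightarrow> 'm"
  Comp :: "'m \<Rightarrow> 'm \<Rightarrow> 'm" (infixr "\<cdot>\<index>" 75)
  Plus :: "'m \<Rightarrow> 'm \<Rightarrow> 'm" (infixl "\<boxplus>\<index>" 65)
  Zero :: "'o \<Rightarrow> 'o \<Rightarrow> 'm"

definition Hom :: "('o, 'm) precat \<Rightarrow> 'o \<Rightarrow> 'o \<Rightarrow> 'm set" where
  "Hom C A B = {f \<in> Arr C. Dom C f = A \<and> Cod C f = B}"

text \<open>The morphism groups are written as HOL-Algebra groups, hence multiplicatively.\<close>

definition HomGrp :: "('o, 'm) precat \<Rightarrow> 'o \<Rightarrow> 'o \<Rightarrow> 'm monoid" where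
  "HomGrp C A B = \<lparr>carrier = Hom C A B, monoid.mult = Plus C, one = Zero C A B\<rparr>"

definition neg :: "('o, 'm) precat \<Rightarrow> 'm \<Rightarrow> 'm" where
  "neg C f = inv\<^bsub>HomGrp C (Dom C f) (Cod C f)\<^esub> f"

definition is_iso :: "('o, 'm) precat \<Rightarrow> 'm \<Rightarrow> bool" where
  "is_iso C f \<longleftrightarrow> f \<in> Arr C \<and>
     (\<exists>g \<in> Hom C (Cod C f) (Dom C f). g \<cdot>\<^bsub>C\<^esub> f = Idn C (Dom C f) \<and> f \<cdot>\<^bsub>C\<^esub> g = Idn C (Cod C f))"

definition is_zero_object :: "('o, 'm) precat \<Rightarrow> 'o \<Rightarrow> bool" where
  "is_zero_object C Z \<longleftrightarrow> Z \<in> Obj C \<and>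
     (\<forall>A \<in> Obj C. (\<exists>!f. f \<in> Hom C Z A) \<and> (\<exists>!f. f \<in> Hom C A Z))"

record ('o, 'm) biprod_data =
  bobj :: 'o
  in1 :: 'm
  in2 :: 'm
  pr1 :: 'm
  pr2 :: 'm

definition is_biproduct :: "('o, 'm) precat \<Rightarrow> 'o \<Rightarrow> 'o \<Rightarrow> ('o, 'm) biprod_data \<Rightarrow> bool" where
  "is_biproduct C A B P \<longleftrightarrow> bobj P \<in> Obj C \<and>
     in1 P \<in> Hom C A (bobj P) \<and> in2 P \<in> Hom C B (bobj P) \<and>
     pr1 P \<in> Hom C (bobj P) A \<and> pr2 P \<in> Hom C (bobj P) B \<and>
     pr1 P \<cdot>\<^bsub>C\<^esub> in1 P = Idn C A \<and> pr2 P \<cdot>\<^bsub>C\<^esub> in2 P = Idn C B \<and>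
     pr1 P \<cdot>\<^bsub>C\<^esub> in2 P = Zero C B A \<and> pr2 P \<cdot>\<^bsub>C\<^esub> in1 P = Zero C A B \<and>
     (in1 P \<cdot>\<^bsub>C\<^esub> pr1 P) \<boxplus>\<^bsub>C\<^esub> (in2 P \<cdot>\<^bsub>C\<^esub> pr2 P) = Idn C (bobj P)"

locale additive_category =
  fixes C :: "('o, 'm) precat" (structure)
  assumes Dom_Obj: "f \<in> Arr C \<Longrightarrow> Dom C f \<in> Obj C"
    and Cod_Obj: "f \<in> Arr C \<Longrightarrow> Cod C f \<in> Obj C"
    and Idn_Hom: "A \<in> Obj C \<Longrightarrow> Idn C A \<in> Hom C A A"
    and Comp_Hom: "f \<in> Hom C A B \<Longrightarrow> g \<in> Hom C B D \<Longrightarrow> g \<cdot> f \<in> Hom C A D"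
    and Comp_assoc: "f \<in> Hom C A B \<Longrightarrow> g \<in> Hom C B D \<Longrightarrow> h \<in> Hom C D E \<Longrightarrow>
      (h \<cdot> g) \<cdot> f = h \<cdot> (g \<cdot> f)"
    and Idn_left: "f \<in> Hom C A B \<Longrightarrow> Idn C B \<cdot> f = f"
    and Idn_right: "f \<in> Hom C A B \<Longrightarrow> f \<cdot> Idn C A = f"
    and HomGrp_comm_group: "A \<in> Obj C \<Longrightarrow> B \<in> Obj C \<Longrightarrow> comm_group (HomGrp C A B)"
    and Comp_Plus_left: "f \<in> Hom C A B \<Longrightarrow> g \<in> Hom C B D \<Longrightarrow> g' \<in> Hom C B D \<Longrightarrow>
      (g \<boxplus> g') \<cdot> f = (g \<cdot> f) \<boxplus> (g' \<cdot> f)"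
    and Comp_Plus_right: "f \<in> Hom C A B \<Longrightarrow> f' \<in> Hom C A B \<Longrightarrow> g \<in> Hom C B D \<Longrightarrow>
      g \<cdot> (f \<boxplus> f') = (g \<cdot> f) \<boxplus> (g \<cdot> f')"
    and ex_zero_object: "\<exists>Z. is_zero_object C Z"
    and ex_biproduct: "A \<in> Obj C \<Longrightarrow> B \<in> Obj C \<Longrightarrow> \<exists>P. is_biproduct C A B P"

text \<open>A fixed choice of biproducts \<open>A \<oplus> B\<close>, and the matrix notation for morphisms into and
  out of them. The objects involved are read off from the entries.\<close>

definition biprod :: "('o, 'm) precat \<Rightarrow> 'o \<Rightarrow> 'o \<Rightarrow> ('o, 'm) biprod_data" where
  "biprod C A B = (SOME P. is_biproduct C A B P)"

definition col :: "('o, 'm) precat \<Rightarrow> 'm \<Rightarrow> 'm \<Rightarrow> 'm" where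
  "col C f g = (in1 (biprod C (Cod C f) (Cod C g)) \<cdot>\<^bsub>C\<^esub> f) \<boxplus>\<^bsub>C\<^esub>
               (in2 (biprod C (Cod C f) (Cod C g)) \<cdot>\<^bsub>C\<^esub> g)"

definition row :: "('o, 'm) precat \<Rightarrow> 'm \<Rightarrow> 'm \<Rightarrow> 'm" where
  "row C f g = (f \<cdot>\<^bsub>C\<^esub> pr1 (biprod C (Dom C f) (Dom C g))) \<boxplus>\<^bsub>C\<^esub>
               (g \<cdot>\<^bsub>C\<^esub> pr2 (biprod C (Dom C f) (Dom C g)))"

definition mat22 :: "('o, 'm) precat \<Rightarrow> 'm \<Rightarrow> 'm \<Rightarrow> 'm \<Rightarrow> 'm \<Rightarrow> 'm" where
  "mat22 C a b c d = col C (row C a b) (row C c d)"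

definition diagonal :: "('o, 'm) precat \<Rightarrow> 'o \<Rightarrow> 'm" where
  "diagonal C A = col C (Idn C A) (Idn C A)"

definition codiagonal :: "('o, 'm) precat \<Rightarrow> 'o \<Rightarrow> 'm" where
  "codiagonal C A = row C (Idn C A) (Idn C A)"

record ('o, 'm, 'p, 'q) func_data =
  FOb :: "'o \<Rightarrow> 'p"
  FArr :: "'m \<Rightarrow> 'q"

definition additive_functor ::
  "('o, 'm) precat \<Rightarrow> ('p, 'q) precat \<Rightarrow> ('o, 'm, 'p, 'q) func_data \<Rightarrow> bool" where
  "additive_functor C C' F \<longleftrightarrow>
     (\<forall>A \<in> Obj C. FOb F A \<in> Obj C') \<and>
     (\<forall>A \<in> Obj C. \<forall>B \<in> Obj C.
        FArr F \<in> hom (HomGrp C A B) (HomGrp C' (FOb F A) (FOb F B))) \<and>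
     (\<forall>A \<in> Obj C. FArr F (Idn C A) = Idn C' (FOb F A)) \<and>
     (\<forall>f \<in> Arr C. \<forall>g \<in> Arr C. Cod C f = Dom C g \<longrightarrow>
        FArr F (g \<cdot>\<^bsub>C\<^esub> f) = FArr F g \<cdot>\<^bsub>C'\<^esub> FArr F f)"


section \<open>Complexes\<close>

text \<open>A complex in degrees \<open>0,\<dots>,N\<close> consists of the objects \<open>Ob X i\<close> for \<open>i \<le> N\<close> and the
  differentials \<open>Diff X i : Ob X i \<rightarrow> Ob X (i + 1)\<close> for \<open>i < N\<close>; values at other indices are
  never inspected, and likewise for the components of chain maps. Thus the category written
  $\mathsf{C}^m$ in the literature on $n$-exact categories is the case \<open>N = m + 1\<close>, and a complex
  can be truncated to degrees \<open>0,\<dots>,M\<close> with \<open>M \<le> N\<close> simply by regarding it as a complex with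
  \<open>M\<close> in place of \<open>N\<close>.\<close>

record ('o, 'm) cochain =
  Ob :: "nat \<Rightarrow> 'o"
  Diff :: "nat \<Rightarrow> 'm"

definition composable :: "('o, 'm) precat \<Rightarrow> nat \<Rightarrow> ('o, 'm) cochain \<Rightarrow> bool" where
  "composable C N X \<longleftrightarrow> (\<forall>i \<le> N. Ob X i \<in> Obj C) \<and>
     (\<forall>i < N. Diff X i \<in> Hom C (Ob X i) (Ob X (Suc i)))"

definition is_complex :: "('o, 'm) precat \<Rightarrow> nat \<Rightarrow> ('o, 'm) cochain \<Rightarrow> bool" where
  "is_complex C N X \<longleftrightarrow> composable C N X \<and>
     (\<forall>i. Suc i < N \<longrightarrow> Diff X (Suc i) \<cdot>\<^bsub>C\<^esub> Diff X i = Zero C (Ob X i) (Ob X (Suc (Suc i))))"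

definition chain_map ::
  "('o, 'm) precat \<Rightarrow> nat \<Rightarrow> ('o, 'm) cochain \<Rightarrow> ('o, 'm) cochain \<Rightarrow> (nat \<Rightarrow> 'm) \<Rightarrow> bool" where
  "chain_map C N X Y f \<longleftrightarrow> (\<forall>i \<le> N. f i \<in> Hom C (Ob X i) (Ob Y i)) \<and>
     (\<forall>i < N. f (Suc i) \<cdot>\<^bsub>C\<^esub> Diff X i = Diff Y i \<cdot>\<^bsub>C\<^esub> f i)"

text \<open>The degrees \<open>1,2,\<dots>\<close> of a complex, renumbered to start at \<open>0\<close>.\<close>

definition cshift :: "('o, 'm) cochain \<Rightarrow> ('o, 'm) cochain" where
  "cshift X = \<lparr>Ob = (\<lambda>i. Ob X (Suc i)), Diff = (\<lambda>i. Diff X (Suc i))\<rparr>"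

definition zero_complex :: "('o, 'm) precat \<Rightarrow> 'o \<Rightarrow> ('o, 'm) cochain" where
  "zero_complex C Z = \<lparr>Ob = (\<lambda>_. Z), Diff = (\<lambda>_. Zero C Z Z)\<rparr>"

definition complex_sum ::
  "('o, 'm) precat \<Rightarrow> ('o, 'm) cochain \<Rightarrow> ('o, 'm) cochain \<Rightarrow> ('o, 'm) cochain" where
  "complex_sum C X Y =
     \<lparr>Ob = (\<lambda>i. bobj (biprod C (Ob X i) (Ob Y i))),
      Diff = (\<lambda>i. mat22 C (Diff X i)                        (Zero C (Ob Y i) (Ob X (Suc i)))
                         (Zero C (Ob X i) (Ob Y (Suc i)))   (Diff Y i))\<rparr>"

definition map_complex :: "('o, 'm, 'p, 'q) func_data \<Rightarrow> ('o, 'm) cochain \<Rightarrow> ('p, 'q) cochain" where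
  "map_complex F X = \<lparr>Ob = (\<lambda>i. FOb F (Ob X i)), Diff = (\<lambda>i. FArr F (Diff X i))\<rparr>"


section \<open>\<open>n\<close>-exact sequences\<close>

text \<open>\<open>n_kernel C n X\<close> says that \<open>(Diff X 0, \<dots>, Diff X (n - 1))\<close> is an \<open>n\<close>-kernel of
  \<open>Diff X n\<close>, that is, $0\to C(Z,X^0)\to\cdots\to C(Z,X^{n+1})$ is exact at
  $C(Z,X^0),\dots,C(Z,X^n)$ for all \<open>Z\<close>; dually for \<open>n_cokernel\<close>.\<close>

definition n_kernel :: "('o, 'm) precat \<Rightarrow> nat \<Rightarrow> ('o, 'm) cochain \<Rightarrow> bool" where
  "n_kernel C n X \<longleftrightarrow> composable C (n + 1) X \<and>
     (\<forall>Z \<in> Obj C.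
        kernel (HomGrp C Z (Ob X 0)) (HomGrp C Z (Ob X 1)) (\<lambda>u. Diff X 0 \<cdot>\<^bsub>C\<^esub> u)
          = {Zero C Z (Ob X 0)} \<and>
        (\<forall>i \<in> {1..n}.
           kernel (HomGrp C Z (Ob X i)) (HomGrp C Z (Ob X (i + 1))) (\<lambda>u. Diff X i \<cdot>\<^bsub>C\<^esub> u)
             = (\<lambda>v. Diff X (i - 1) \<cdot>\<^bsub>C\<^esub> v) ` Hom C Z (Ob X (i - 1))))"

definition n_cokernel :: "('o, 'm) precat \<Rightarrow> nat \<Rightarrow> ('o, 'm) cochain \<Rightarrow> bool" where
  "n_cokernel C n X \<longleftrightarrow> composable C (n + 1) X \<and>
     (\<forall>Z \<in> Obj C.
        kernel (HomGrp C (Ob X (n + 1)) Z) (HomGrp C (Ob X n) Z) (\<lambda>u. u \<cdot>\<^bsub>C\<^esub> Diff X n)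
          = {Zero C (Ob X (n + 1)) Z} \<and>
        (\<forall>i \<in> {1..n}.
           kernel (HomGrp C (Ob X i) Z) (HomGrp C (Ob X (i - 1)) Z) (\<lambda>u. u \<cdot>\<^bsub>C\<^esub> Diff X (i - 1))
             = (\<lambda>v. v \<cdot>\<^bsub>C\<^esub> Diff X i) ` Hom C (Ob X (i + 1)) Z))"

definition n_exact_sequence :: "('o, 'm) precat \<Rightarrow> nat \<Rightarrow> ('o, 'm) cochain \<Rightarrow> bool" where
  "n_exact_sequence C n X \<longleftrightarrow> is_complex C (n + 1) X \<and> n_kernel C n X \<and> n_cokernel C n X"

definition weak_iso ::
  "('o, 'm) precat \<Rightarrow> nat \<Rightarrow> ('o, 'm) cochain \<Rightarrow> ('o, 'm) cochain \<Rightarrow> (nat \<Rightarrow> 'm) \<Rightarrow> bool" where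
  "weak_iso C n X Y f \<longleftrightarrow> n_exact_sequence C n X \<and> n_exact_sequence C n Y \<and>
     chain_map C (n + 1) X Y f \<and>
     (\<exists>i \<le> n + 1. is_iso C (f i) \<and> is_iso C (if i = n + 1 then f 0 else f (i + 1)))"

definition weakly_isomorphic ::
  "('o, 'm) precat \<Rightarrow> nat \<Rightarrow> ('o, 'm) cochain \<Rightarrow> ('o, 'm) cochain \<Rightarrow> bool" where
  "weakly_isomorphic C n X Y \<longleftrightarrow> (\<exists>f. weak_iso C n X Y f \<or> weak_iso C n Y X f)"


section \<open>Mapping cones, \<open>n\<close>-pullbacks and \<open>n\<close>-pushouts\<close>

text \<open>The mapping cone of a chain map between complexes in degrees \<open>0,\<dots>,n\<close>. It usually lives in
  degrees \<open>-1,\<dots>,n\<close>; here degrees are raised by one, so \<open>Diff (mapping_cone C n X Y f) k\<close> is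
  $d_C^{k-1}$ for \<open>0 \<le> k \<le> n\<close>.\<close>

definition mapping_cone ::
  "('o, 'm) precat \<Rightarrow> nat \<Rightarrow> ('o, 'm) cochain \<Rightarrow> ('o, 'm) cochain \<Rightarrow> (nat \<Rightarrow> 'm) \<Rightarrow> ('o, 'm) cochain"
where
  "mapping_cone C n X Y f =
     \<lparr>Ob = (\<lambda>k. if k = 0 then Ob X 0
                else if k \<le> n then bobj (biprod C (Ob X k) (Ob Y (k - 1)))
                else Ob Y n),
      Diff = (\<lambda>k. if k = 0 then col C (neg C (Diff X 0)) (f 0)
                  else if k < n then
                    mat22 C (neg C (Diff X k)) (Zero C (Ob Y (k - 1)) (Ob X (k + 1)))
                            (f k)              (Diff Y (k - 1))
                  else row C (f n) (Diff Y (n - 1)))\<rparr>"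

text \<open>\<open>g : Z \<rightarrow> X\<close> is an \<open>n\<close>-pullback of \<open>X\<close> along \<open>gn\<close>, resp. \<open>f : X \<rightarrow> Y\<close> is an \<open>n\<close>-pushout of
  \<open>X\<close> along \<open>f0\<close>.\<close>

definition n_pullback ::
  "('o, 'm) precat \<Rightarrow> nat \<Rightarrow> ('o, 'm) cochain \<Rightarrow> 'm \<Rightarrow> ('o, 'm) cochain \<Rightarrow> (nat \<Rightarrow> 'm) \<Rightarrow> bool" where
  "n_pullback C n X gn Z g \<longleftrightarrow> is_complex C n X \<and> is_complex C n Z \<and>
     chain_map C n Z X g \<and> g n = gn \<and> n_kernel C n (mapping_cone C n Z X g)"

definition n_pushout ::
  "('o, 'm) precat \<Rightarrow> nat \<Rightarrow> ('o, 'm) cochain \<Rightarrow> 'm \<Rightarrow> ('o, 'm) cochain \<Rightarrow> (nat \<Rightarrow> 'm) \<Rightarrow> bool" where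
  "n_pushout C n X f0 Y f \<longleftrightarrow> is_complex C n X \<and> is_complex C n Y \<and>
     chain_map C n X Y f \<and> f 0 = f0 \<and> n_cokernel C n (mapping_cone C n X Y f)"


section \<open>\<open>n\<close>-exact categories and functors\<close>

definition adm_mono :: "('o, 'm) cochain set \<Rightarrow> 'm \<Rightarrow> bool" where
  "adm_mono \<X> f \<longleftrightarrow> (\<exists>X \<in> \<X>. f = Diff X 0)"

definition adm_epi :: "nat \<Rightarrow> ('o, 'm) cochain set \<Rightarrow> 'm \<Rightarrow> bool" where
  "adm_epi n \<X> f \<longleftrightarrow> (\<exists>X \<in> \<X>. f = Diff X n)"

text \<open>In \<open>E2_op\<close> the complex \<open>Z\<close> is $Y^1\to\cdots\to Y^{n+1}$ renumbered to degrees \<open>0,\<dots>,n\<close>,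
  so that \<open>Diff Z (n - 1)\<close> is $d_Y^n$.\<close>

locale n_exact_category = additive_category C
  for C :: "('o, 'm) precat" (structure) +
  fixes n :: nat and \<X> :: "('o, 'm) cochain set"
  assumes \<X>_n_exact: "X \<in> \<X> \<Longrightarrow> n_exact_sequence C n X"
    and weak_iso_closed: "X \<in> \<X> \<Longrightarrow> weakly_isomorphic C n X Y \<Longrightarrow> Y \<in> \<X>"
    and E0: "is_zero_object C Z \<Longrightarrow> zero_complex C Z \<in> \<X>"
    and E1: "adm_mono \<X> f \<Longrightarrow> adm_mono \<X> g \<Longrightarrow> Cod C f = Dom C g \<Longrightarrow> adm_mono \<X> (g \<cdot> f)"
    and E1_op: "adm_epi n \<X> f \<Longrightarrow> adm_epi n \<X> g \<Longrightarrow> Cod C f = Dom C g \<Longrightarrow> adm_epi n \<X> (g \<cdot> f)"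
    and E2: "X \<in> \<X> \<Longrightarrow> B \<in> Obj C \<Longrightarrow> f0 \<in> Hom C (Ob X 0) B \<Longrightarrow>
      \<exists>Y f. n_pushout C n X f0 Y f \<and> adm_mono \<X> (Diff Y 0)"
    and E2_op: "X \<in> \<X> \<Longrightarrow> B \<in> Obj C \<Longrightarrow> g0 \<in> Hom C B (Ob X (n + 1)) \<Longrightarrow>
      \<exists>Z g. n_pullback C n (cshift X) g0 Z g \<and> adm_epi n \<X> (Diff Z (n - 1))"

definition n_exact_functor ::
  "('o, 'm) precat \<Rightarrow> ('o, 'm) cochain set \<Rightarrow> ('p, 'q) precat \<Rightarrow> ('p, 'q) cochain set \<Rightarrow>
   ('o, 'm, 'p, 'q) func_data \<Rightarrow> bool" where
  "n_exact_functor C \<X> C' \<X>' F \<longleftrightarrow> additive_functor C C' F \<and> map_complex F ` \<X> \<subseteq> \<X>'"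


section \<open>Homotopy classes with fixed end terms\<close>

definition complexes_between ::
  "('o, 'm) precat \<Rightarrow> nat \<Rightarrow> 'o \<Rightarrow> 'o \<Rightarrow> ('o, 'm) cochain set" where
  "complexes_between C n A B = {X. is_complex C (n + 1) X \<and> Ob X 0 = A \<and> Ob X (n + 1) = B}"

definition fixed_end_map ::
  "('o, 'm) precat \<Rightarrow> nat \<Rightarrow> ('o, 'm) cochain \<Rightarrow> ('o, 'm) cochain \<Rightarrow> (nat \<Rightarrow> 'm) \<Rightarrow> bool" where
  "fixed_end_map C n X Y f \<longleftrightarrow> chain_map C (n + 1) X Y f \<and>
     f 0 = Idn C (Ob X 0) \<and> f (n + 1) = Idn C (Ob X (n + 1))"

text \<open>The usual notion of homotopy for complexes in degrees \<open>0,\<dots>,N\<close> (with \<open>N > 0\<close>); in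
  particular $h^1$ and $h^N$ are subject to the conditions in degrees \<open>0\<close> and \<open>N\<close>.\<close>

definition homotopic ::
  "('o, 'm) precat \<Rightarrow> nat \<Rightarrow> ('o, 'm) cochain \<Rightarrow> ('o, 'm) cochain \<Rightarrow> (nat \<Rightarrow> 'm) \<Rightarrow> (nat \<Rightarrow> 'm) \<Rightarrow> bool"
where
  "homotopic C N X Y f g \<longleftrightarrow>
     (\<exists>h. (\<forall>i \<in> {1..N}. h i \<in> Hom C (Ob X i) (Ob Y (i - 1))) \<and>
          f 0 = g 0 \<boxplus>\<^bsub>C\<^esub> (h 1 \<cdot>\<^bsub>C\<^esub> Diff X 0) \<and>
          (\<forall>i \<in> {1..<N}. f i = g i \<boxplus>\<^bsub>C\<^esub>
              ((Diff Y (i - 1) \<cdot>\<^bsub>C\<^esub> h i) \<boxplus>\<^bsub>C\<^esub> (h (i + 1) \<cdot>\<^bsub>C\<^esub> Diff X i))) \<and>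
          f N = g N \<boxplus>\<^bsub>C\<^esub> (Diff Y (N - 1) \<cdot>\<^bsub>C\<^esub> h N))"

definition homotopy_equivalent ::
  "('o, 'm) precat \<Rightarrow> nat \<Rightarrow> ('o, 'm) cochain \<Rightarrow> ('o, 'm) cochain \<Rightarrow> bool" where
  "homotopy_equivalent C n X Y \<longleftrightarrow>
     (\<exists>f g. fixed_end_map C n X Y f \<and> fixed_end_map C n Y X g \<and>
        homotopic C (n + 1) X X (\<lambda>i. g i \<cdot>\<^bsub>C\<^esub> f i) (\<lambda>i. Idn C (Ob X i)) \<and>
        homotopic C (n + 1) Y Y (\<lambda>i. f i \<cdot>\<^bsub>C\<^esub> g i) (\<lambda>i. Idn C (Ob Y i)))"

definition hclass :: "('o, 'm) precat \<Rightarrow> nat \<Rightarrow> ('o, 'm) cochain \<Rightarrow> ('o, 'm) cochain set" where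
  "hclass C n X =
     {Y \<in> complexes_between C n (Ob X 0) (Ob X (n + 1)). homotopy_equivalent C n X Y}"


section \<open>\<open>n\<close>-exangulated functors\<close>

text \<open>The underlying data of an \<open>n\<close>-exangulated category: \<open>Ext D B A\<close> is the abelian group
  $\mathbb{E}(B,A)$ (in multiplicative notation), \<open>ExtMap D g f\<close> is $\mathbb{E}(g,f)$, and
  \<open>Realization D \<delta>\<close> is the homotopy class $\mathfrak{s}(\delta)$. As extension elements are not
  tagged with their end terms, the latter two also take the objects as arguments:
  \<open>ExtMap D B A g f : Ext D B A \<rightarrow> Ext D (Dom g) (Cod f)\<close> and
  \<open>Realization D B A \<delta>\<close> for \<open>\<delta> \<in> Ext D B A\<close>.\<close>

record ('o, 'm, 'e) exang_data =
  Base :: "('o, 'm) precat"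
  Ext :: "'o \<Rightarrow> 'o \<Rightarrow> 'e monoid"
  ExtMap :: "'o \<Rightarrow> 'o \<Rightarrow> 'm \<Rightarrow> 'm \<Rightarrow> 'e \<Rightarrow> 'e"
  Realization :: "'o \<Rightarrow> 'o \<Rightarrow> 'e \<Rightarrow> ('o, 'm) cochain set"

definition ext_nat_trans ::
  "('o, 'm, 'e) exang_data \<Rightarrow> ('p, 'q, 'f) exang_data \<Rightarrow> ('o, 'm, 'p, 'q) func_data \<Rightarrow>
   ('o \<Rightarrow> 'o \<Rightarrow> 'e \<Rightarrow> 'f) \<Rightarrow> bool" where
  "ext_nat_trans D D' F \<Gamma> \<longleftrightarrow>
     (\<forall>B \<in> Obj (Base D). \<forall>A \<in> Obj (Base D).
        \<Gamma> B A \<in> hom (Ext D B A) (Ext D' (FOb F B) (FOb F A))) \<and>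
     (\<forall>g \<in> Arr (Base D). \<forall>f \<in> Arr (Base D).
        \<forall>\<delta> \<in> carrier (Ext D (Cod (Base D) g) (Dom (Base D) f)).
          \<Gamma> (Dom (Base D) g) (Cod (Base D) f)
            (ExtMap D (Cod (Base D) g) (Dom (Base D) f) g f \<delta>) =
          ExtMap D' (FOb F (Cod (Base D) g)) (FOb F (Dom (Base D) f)) (FArr F g) (FArr F f)
            (\<Gamma> (Cod (Base D) g) (Dom (Base D) f) \<delta>))"

definition n_exangulated_functor ::
  "nat \<Rightarrow> ('o, 'm, 'e) exang_data \<Rightarrow> ('p, 'q, 'f) exang_data \<Rightarrow> ('o, 'm, 'p, 'q) func_data \<Rightarrow> bool"
where
  "n_exangulated_functor n D D' F \<longleftrightarrow> additive_functor (Base D) (Base D') F \<and>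
     (\<exists>\<Gamma>. ext_nat_trans D D' F \<Gamma> \<and>
        (\<forall>A \<in> Obj (Base D). \<forall>B \<in> Obj (Base D). \<forall>\<delta> \<in> carrier (Ext D B A).
           \<forall>X \<in> complexes_between (Base D) n A B.
             Realization D B A \<delta> = hclass (Base D) n X \<longrightarrow>
             Realization D' (FOb F B) (FOb F A) (\<Gamma> B A \<delta>) = hclass (Base D') n (map_complex F X)))"


section \<open>The \<open>n\<close>-exangulated category of an \<open>n\<close>-exact category\<close>

definition ext_classes ::
  "('o, 'm) precat \<Rightarrow> nat \<Rightarrow> ('o, 'm) cochain set \<Rightarrow> 'o \<Rightarrow> 'o \<Rightarrow> ('o, 'm) cochain set set" where
  "ext_classes C n \<X> B A = {hclass C n X | X. X \<in> \<X> \<and> Ob X 0 = A \<and> Ob X (n + 1) = B}"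

text \<open>The definite descriptions express that the result is independent of the chosen
  representatives and of the chosen \<open>n\<close>-pushout or \<open>n\<close>-pullback.\<close>

definition ext_push ::
  "('o, 'm) precat \<Rightarrow> nat \<Rightarrow> ('o, 'm) cochain set \<Rightarrow> 'm \<Rightarrow> ('o, 'm) cochain set \<Rightarrow>
   ('o, 'm) cochain set" where
  "ext_push C n \<X> f \<delta> = (THE \<epsilon>. \<exists>X \<in> \<X>. \<exists>Y \<in> \<X>. \<exists>\<phi>.
     \<delta> = hclass C n X \<and> \<epsilon> = hclass C n Y \<and>
     chain_map C (n + 1) X Y \<phi> \<and> n_pushout C n X f Y \<phi> \<and> \<phi> (n + 1) = Idn C (Ob X (n + 1)))"

definition ext_pull ::
  "('o, 'm) precat \<Rightarrow> nat \<Rightarrow> ('o, 'm) cochain set \<Rightarrow> 'm \<Rightarrow> ('o, 'm) cochain set \<Rightarrow>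
   ('o, 'm) cochain set" where
  "ext_pull C n \<X> g \<delta> = (THE \<epsilon>. \<exists>X \<in> \<X>. \<exists>Y \<in> \<X>. \<exists>\<phi>.
     \<delta> = hclass C n X \<and> \<epsilon> = hclass C n Y \<and>
     chain_map C (n + 1) Y X \<phi> \<and> \<phi> 0 = Idn C (Ob X 0) \<and>
     n_pullback C n (cshift X) g (cshift Y) (\<lambda>i. \<phi> (Suc i)))"

definition ext_map ::
  "('o, 'm) precat \<Rightarrow> nat \<Rightarrow> ('o, 'm) cochain set \<Rightarrow> 'm \<Rightarrow> 'm \<Rightarrow> ('o, 'm) cochain set \<Rightarrow>
   ('o, 'm) cochain set" where
  "ext_map C n \<X> g f \<delta> = ext_pull C n \<X> g (ext_push C n \<X> f \<delta>)"

definition baer_sum ::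
  "('o, 'm) precat \<Rightarrow> nat \<Rightarrow> ('o, 'm) cochain set \<Rightarrow> 'o \<Rightarrow> 'o \<Rightarrow>
   ('o, 'm) cochain set \<Rightarrow> ('o, 'm) cochain set \<Rightarrow> ('o, 'm) cochain set" where
  "baer_sum C n \<X> B A \<delta> \<epsilon> = (THE \<zeta>. \<exists>X \<in> \<X>. \<exists>Y \<in> \<X>.
     \<delta> = hclass C n X \<and> \<epsilon> = hclass C n Y \<and>
     \<zeta> = ext_map C n \<X> (diagonal C B) (codiagonal C A) (hclass C n (complex_sum C X Y)))"

text \<open>The neutral element is the one determined by the Baer sum.\<close>

definition ext_group ::
  "('o, 'm) precat \<Rightarrow> nat \<Rightarrow> ('o, 'm) cochain set \<Rightarrow> 'o \<Rightarrow> 'o \<Rightarrow> ('o, 'm) cochain set monoid" where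
  "ext_group C n \<X> B A =
     \<lparr>carrier = ext_classes C n \<X> B A,
      monoid.mult = baer_sum C n \<X> B A,
      one = (THE e. e \<in> ext_classes C n \<X> B A \<and>
               (\<forall>\<delta> \<in> ext_classes C n \<X> B A.
                  baer_sum C n \<X> B A e \<delta> = \<delta> \<and> baer_sum C n \<X> B A \<delta> e = \<delta>))\<rparr>"

definition exang_of_exact ::
  "('o, 'm) precat \<Rightarrow> nat \<Rightarrow> ('o, 'm) cochain set \<Rightarrow> ('o, 'm, ('o, 'm) cochain set) exang_data" where
  "exang_of_exact C n \<X> =
     \<lparr>Base = C,
      Ext = ext_group C n \<X>,
      ExtMap = (\<lambda>_ _. ext_map C n \<X>),
      Realization = (\<lambda>_ _ \<delta>. \<delta>)\<rparr>"

end

theory Submission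
  imports Defs
begin

text \<open>For an admissible sequence \<open>X\<close>, the homotopy class of \<open>X\<close> consists precisely of the
  admissible sequences \<open>Y\<close> that receive a chain map \<open>X \<rightarrow> Y\<close> which is the identity at both ends.
  By the universal properties of pushouts and pullbacks, \<open>ext_map g f\<close> then sends the class of \<open>S\<close>
  to the class of \<open>Q\<close> as soon as there are chain maps \<open>S \<rightarrow> P\<close> and \<open>Q \<rightarrow> P\<close> of
  admissible sequences with end components \<open>(f, 1)\<close> and \<open>(1, g)\<close>; these need not come from cones.
  Such data are preserved by every additive functor that preserves admissible sequences, which makes
  \<open>[X] \<mapsto> [F X]\<close> a well-defined natural transformation compatible with Baer sums. Conversely, a
  realization-compatible \<open>\<Gamma>\<close> places \<open>F X\<close> in the homotopy class of an admissible sequence, so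
  \<open>F X\<close> is \<open>n\<close>-exact and weakly isomorphic to it.\<close>

section \<open>Calculus of morphisms in an additive category\<close>

text \<open>The obstacle is the gap between how the extension maps are defined and what a functor
  can transport. \<open>ext_push\<close> and \<open>ext_pull\<close> refer to mapping cones, which
  are built from biproducts chosen by \<open>SOME\<close>; an additive functor need not respect
  these choices. Moreover the axioms yield a pushout only in degrees 0 to n, with an admissible
  first differential. So each pushout is completed by the last term of the given sequence, and the
  completion is recognised as admissible through closure under weak isomorphisms. Its class is then
  determined by a universal property among chain maps, and chain maps are what F can be applied to.
  The dual statements come from the opposite category, whose chosen biproducts are a separate
  choice; this is why the completion is carried out for an abstract cone. The same discrepancy in
  Baer sums, between the sum of the images and the image of the sum, is bridged by a canonical chain
  map that enters the evaluation of \<open>ext_map\<close>.\<close>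

lemma Hom_iff [simp]: "f \<in> Hom C A B \<longleftrightarrow> f \<in> Arr C \<and> Dom C f = A \<and> Cod C f = B"
  by (auto simp: Hom_def)

text \<open>Rewrite rules whose side conditions are stated through \<open>Arr\<close>, \<open>Dom\<close> and \<open>Cod\<close>, so that the
  simplifier can discharge them without guessing the objects in \<open>Hom\<close>.\<close>

named_theorems arr

context additive_category
begin

lemma Dom_Obj' [arr]: "f \<in> Arr C \<Longrightarrow> Dom C f \<in> Obj C"
  and Cod_Obj' [arr]: "f \<in> Arr C \<Longrightarrow> Cod C f \<in> Obj C"
  by (simp_all add: Dom_Obj Cod_Obj)

lemma Idn_arr [arr]:
  assumes "A \<in> Obj C"
  shows "Idn C A \<in> Arr C" "Dom C (Idn C A) = A" "Cod C (Idn C A) = A"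
  using Idn_Hom[OF assms] by auto

lemma comp_arr [arr]:
  assumes "f \<in> Arr C" "g \<in> Arr C" "Cod C f = Dom C g"
  shows "g \<cdot> f \<in> Arr C" "Dom C (g \<cdot> f) = Dom C f" "Cod C (g \<cdot> f) = Cod C g"
  using Comp_Hom[of f "Dom C f" "Cod C f" g "Cod C g"] assms by auto

lemma comp_assoc [arr]:
  assumes "f \<in> Arr C" "g \<in> Arr C" "h \<in> Arr C" "Cod C f = Dom C g" "Cod C g = Dom C h"
  shows "(h \<cdot> g) \<cdot> f = h \<cdot> (g \<cdot> f)"
  using Comp_assoc[of f "Dom C f" "Cod C f" g "Cod C g" h "Cod C h"] assms by auto

lemma comp_Idn [arr]:
  assumes "f \<in> Arr C"
  shows "Cod C f = B \<Longrightarrow> Idn C B \<cdot> f = f" "Dom C f = A \<Longrightarrow> f \<cdot> Idn C A = f"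
  using Idn_left[of f "Dom C f" "Cod C f"] Idn_right[of f "Dom C f" "Cod C f"] assms by auto

lemma plus_arr [arr]:
  assumes "f \<in> Arr C" "g \<in> Arr C" "Dom C f = Dom C g" "Cod C f = Cod C g"
  shows "f \<boxplus> g \<in> Arr C" "Dom C (f \<boxplus> g) = Dom C g" "Cod C (f \<boxplus> g) = Cod C g"
proof -
  interpret comm_group "HomGrp C (Dom C g) (Cod C g)"
    using assms by (intro HomGrp_comm_group Dom_Obj Cod_Obj)
  show "f \<boxplus> g \<in> Arr C" "Dom C (f \<boxplus> g) = Dom C g" "Cod C (f \<boxplus> g) = Cod C g"
    using m_closed[of f g] assms by (auto simp: HomGrp_def)
qed

lemma zero_arr [arr]:
  assumes "A \<in> Obj C" "B \<in> Obj C"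
  shows "Zero C A B \<in> Arr C" "Dom C (Zero C A B) = A" "Cod C (Zero C A B) = B"
proof -
  interpret comm_group "HomGrp C A B"
    using assms by (intro HomGrp_comm_group)
  show "Zero C A B \<in> Arr C" "Dom C (Zero C A B) = A" "Cod C (Zero C A B) = B"
    using one_closed by (auto simp: HomGrp_def)
qed

lemma neg_arr [arr]:
  assumes "f \<in> Arr C"
  shows "neg C f \<in> Arr C" "Dom C (neg C f) = Dom C f" "Cod C (neg C f) = Cod C f"
proof -
  interpret comm_group "HomGrp C (Dom C f) (Cod C f)"
    using assms by (intro HomGrp_comm_group Dom_Obj Cod_Obj)
  show "neg C f \<in> Arr C" "Dom C (neg C f) = Dom C f" "Cod C (neg C f) = Cod C f"
    using inv_closed[of f] assms by (simp_all add: neg_def HomGrp_def)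
qed

lemma plus_ac:
  assumes "f \<in> Arr C" "g \<in> Arr C" "Dom C f = Dom C g" "Cod C f = Cod C g"
  shows plus_comm: "f \<boxplus> g = g \<boxplus> f"
    and plus_assoc [arr]: "h \<in> Arr C \<Longrightarrow> Dom C h = Dom C g \<Longrightarrow> Cod C h = Cod C g \<Longrightarrow>
      (f \<boxplus> g) \<boxplus> h = f \<boxplus> (g \<boxplus> h)"
    and plus_left_comm: "h \<in> Arr C \<Longrightarrow> Dom C h = Dom C g \<Longrightarrow> Cod C h = Cod C g \<Longrightarrow>
      f \<boxplus> (g \<boxplus> h) = g \<boxplus> (f \<boxplus> h)"
proof -
  interpret comm_group "HomGrp C (Dom C g) (Cod C g)"
    using assms by (intro HomGrp_comm_group Dom_Obj Cod_Obj)
  show "f \<boxplus> g = g \<boxplus> f"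
    using m_comm[of f g] assms by (auto simp: HomGrp_def)
  show "(f \<boxplus> g) \<boxplus> h = f \<boxplus> (g \<boxplus> h)" "f \<boxplus> (g \<boxplus> h) = g \<boxplus> (f \<boxplus> h)"
    if "h \<in> Arr C" "Dom C h = Dom C g" "Cod C h = Cod C g"
    using m_assoc[of f g h] m_lcomm[of f g h] assms that by (auto simp: HomGrp_def)
qed

lemma plus_zero [arr]:
  assumes "f \<in> Arr C" "Dom C f = A" "Cod C f = B"
  shows "Zero C A B \<boxplus> f = f" "f \<boxplus> Zero C A B = f"
proof -
  interpret comm_group "HomGrp C A B"
    using assms by (intro HomGrp_comm_group) (auto simp: Dom_Obj Cod_Obj)
  show "Zero C A B \<boxplus> f = f" "f \<boxplus> Zero C A B = f"
    using l_one[of f] r_one[of f] assms by (auto simp: HomGrp_def)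
qed

lemma plus_neg [arr]:
  assumes "f \<in> Arr C"
  shows "f \<boxplus> neg C f = Zero C (Dom C f) (Cod C f)" "neg C f \<boxplus> f = Zero C (Dom C f) (Cod C f)"
proof -
  interpret comm_group "HomGrp C (Dom C f) (Cod C f)"
    using assms by (intro HomGrp_comm_group Dom_Obj Cod_Obj)
  show "f \<boxplus> neg C f = Zero C (Dom C f) (Cod C f)" "neg C f \<boxplus> f = Zero C (Dom C f) (Cod C f)"
    using r_inv[of f] l_inv[of f] assms by (simp_all add: neg_def HomGrp_def)
qed

lemma plus_neg' [arr]:
  assumes "f \<in> Arr C" "g \<in> Arr C" "Dom C f = Dom C g" "Cod C f = Cod C g"
  shows "f \<boxplus> (neg C f \<boxplus> g) = g" "neg C f \<boxplus> (f \<boxplus> g) = g"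
  using assms by (simp_all add: arr flip: plus_assoc)

lemma plus_cancel:
  assumes "f \<in> Arr C" "g \<in> Arr C" "h \<in> Arr C"
    "Dom C f = Dom C g" "Cod C f = Cod C g" "Dom C h = Dom C g" "Cod C h = Cod C g"
  shows "f \<boxplus> g = f \<boxplus> h \<longleftrightarrow> g = h"
  using assms by (metis plus_neg'(2))

lemma neg_unique:
  assumes "f \<in> Arr C" "g \<in> Arr C" "Dom C f = Dom C g" "Cod C f = Cod C g"
    "f \<boxplus> g = Zero C (Dom C g) (Cod C g)"
  shows "g = neg C f"
proof -
  have "f \<boxplus> g = f \<boxplus> neg C f" using assms by (simp add: arr)
  thus ?thesis using assms by (subst (asm) plus_cancel) (simp_all add: arr)
qed

lemma minus_eq_zero_iff:
  assumes "f \<in> Arr C" "g \<in> Arr C" "Dom C f = Dom C g" "Cod C f = Cod C g"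
    "Dom C g = A" "Cod C g = B"
  shows "f \<boxplus> neg C g = Zero C A B \<longleftrightarrow> f = g"
proof
  assume "f \<boxplus> neg C g = Zero C A B"
  hence "neg C g \<boxplus> f = neg C g \<boxplus> g" using assms plus_comm[of f "neg C g"] by (simp add: arr)
  thus "f = g" using assms by (subst (asm) plus_cancel) (simp_all add: arr)
qed (use assms in \<open>simp add: arr\<close>)

lemma neg_neg [arr]: "f \<in> Arr C \<Longrightarrow> neg C (neg C f) = f"
  by (rule neg_unique[symmetric]) (simp_all add: arr)

lemma neg_zero [arr]: "A \<in> Obj C \<Longrightarrow> B \<in> Obj C \<Longrightarrow> neg C (Zero C A B) = Zero C A B"
  by (rule neg_unique[symmetric]) (simp_all add: arr)

lemma neg_plus [arr]:
  assumes "f \<in> Arr C" "g \<in> Arr C" "Dom C f = Dom C g" "Cod C f = Cod C g"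
  shows "neg C (f \<boxplus> g) = neg C f \<boxplus> neg C g"
proof (rule neg_unique[symmetric])
  have "f \<boxplus> (g \<boxplus> (neg C f \<boxplus> neg C g)) = f \<boxplus> (neg C f \<boxplus> (g \<boxplus> neg C g))"
    using assms plus_left_comm[of g "neg C f" "neg C g"] by (simp add: arr)
  thus "f \<boxplus> g \<boxplus> (neg C f \<boxplus> neg C g) = Zero C (Dom C (neg C f \<boxplus> neg C g)) (Cod C (neg C f \<boxplus> neg C g))"
    using assms by (simp add: arr)
qed (use assms in \<open>simp_all add: arr\<close>)

lemma comp_plus [arr]:
  "\<lbrakk>f \<in> Arr C; g \<in> Arr C; g' \<in> Arr C; Cod C f = Dom C g; Dom C g = Dom C g'; Cod C g = Cod C g'\<rbrakk> \<Longrightarrow>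
    (g \<boxplus> g') \<cdot> f = (g \<cdot> f) \<boxplus> (g' \<cdot> f)"
  "\<lbrakk>f \<in> Arr C; f' \<in> Arr C; g \<in> Arr C; Cod C f = Dom C g; Dom C f = Dom C f'; Cod C f = Cod C f'\<rbrakk> \<Longrightarrow>
    g \<cdot> (f \<boxplus> f') = (g \<cdot> f) \<boxplus> (g \<cdot> f')"
  using Comp_Plus_left[of f "Dom C f" "Cod C f" g "Cod C g" g']
    Comp_Plus_right[of f "Dom C f" "Cod C f" f' g "Cod C g"] by auto

text \<open>By cancellation. Composites with a zero morphism, and later images of zero under F, are
  seen to vanish because they are additively idempotent.\<close>

lemma idem_zero:
  assumes "f \<in> Arr C" "f \<boxplus> f = f" shows "f = Zero C (Dom C f) (Cod C f)"
proof -
  have "f \<boxplus> f = f \<boxplus> Zero C (Dom C f) (Cod C f)" using assms by (simp add: arr)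
  thus ?thesis using assms by (subst (asm) plus_cancel) (simp_all add: arr)
qed

lemma comp_zero [arr]:
  "\<lbrakk>f \<in> Arr C; Cod C f = A; B \<in> Obj C\<rbrakk> \<Longrightarrow> Zero C A B \<cdot> f = Zero C (Dom C f) B"
  "\<lbrakk>f \<in> Arr C; Dom C f = B; A \<in> Obj C\<rbrakk> \<Longrightarrow> f \<cdot> Zero C A B = Zero C A (Cod C f)"
proof -
  assume *: "f \<in> Arr C" "Cod C f = A" "B \<in> Obj C"
  hence A: "A \<in> Obj C" using Cod_Obj by blast
  have "(Zero C A B \<boxplus> Zero C A B) \<cdot> f = Zero C A B \<cdot> f \<boxplus> Zero C A B \<cdot> f"
    by (rule comp_plus) (use * A in \<open>simp_all add: arr\<close>)
  thus "Zero C A B \<cdot> f = Zero C (Dom C f) B"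
    using idem_zero[of "Zero C A B \<cdot> f"] * A by (simp add: arr)
next
  assume *: "f \<in> Arr C" "Dom C f = B" "A \<in> Obj C"
  hence B: "B \<in> Obj C" using Dom_Obj by blast
  have "f \<cdot> (Zero C A B \<boxplus> Zero C A B) = f \<cdot> Zero C A B \<boxplus> f \<cdot> Zero C A B"
    by (rule comp_plus) (use * B in \<open>simp_all add: arr\<close>)
  thus "f \<cdot> Zero C A B = Zero C A (Cod C f)"
    using idem_zero[of "f \<cdot> Zero C A B"] * B by (simp add: arr)
qed

lemma comp_neg [arr]:
  assumes "f \<in> Arr C" "g \<in> Arr C" "Cod C f = Dom C g"
  shows "neg C g \<cdot> f = neg C (g \<cdot> f)" "g \<cdot> neg C f = neg C (g \<cdot> f)"
proof -
  have "g \<cdot> f \<boxplus> neg C g \<cdot> f = (g \<boxplus> neg C g) \<cdot> f"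
    by (rule comp_plus(1)[symmetric]) (use assms in \<open>simp_all add: arr\<close>)
  thus "neg C g \<cdot> f = neg C (g \<cdot> f)"
    by (intro neg_unique) (use assms in \<open>simp_all add: arr\<close>)
  have "g \<cdot> f \<boxplus> g \<cdot> neg C f = g \<cdot> (f \<boxplus> neg C f)"
    by (rule comp_plus(2)[symmetric]) (use assms in \<open>simp_all add: arr\<close>)
  thus "g \<cdot> neg C f = neg C (g \<cdot> f)"
    by (intro neg_unique) (use assms in \<open>simp_all add: arr\<close>)
qed

text \<open>The rules \<open>arr\<close> associate composites to the right, so a known value of
  \<open>g \<cdot> f\<close> no longer matches inside \<open>g \<cdot> (f \<cdot> k)\<close>; this
  rule makes it applicable there.\<close>

lemma reassoc:
  assumes "g \<cdot> f = h" "f \<in> Arr C" "g \<in> Arr C" "Cod C f = Dom C g" "k \<in> Arr C" "Cod C k = Dom C f"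
  shows "g \<cdot> (f \<cdot> k) = h \<cdot> k"
  using assms comp_assoc by metis

lemma is_isoI:
  assumes "f \<in> Arr C" "g \<in> Arr C" "Dom C g = Cod C f" "Cod C g = Dom C f"
    "g \<cdot> f = Idn C (Dom C f)" "f \<cdot> g = Idn C (Cod C f)"
  shows "is_iso C f"
  using assms unfolding is_iso_def by auto

lemma is_iso_Idn: "A \<in> Obj C \<Longrightarrow> is_iso C (Idn C A)"
  by (rule is_isoI[of _ "Idn C A"]) (simp_all add: arr)

lemma zero_object_arr:
  assumes "is_zero_object C Z" "f \<in> Arr C" "Dom C f = Z \<or> Cod C f = Z"
  shows "f = Zero C (Dom C f) (Cod C f)"
proof -
  have "Zero C (Dom C f) (Cod C f) \<in> Hom C (Dom C f) (Cod C f)" "f \<in> Hom C (Dom C f) (Cod C f)"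
    "Dom C f \<in> Obj C" "Cod C f \<in> Obj C"
    using assms by (simp_all add: arr)
  thus ?thesis using assms unfolding is_zero_object_def by metis
qed

section \<open>Biproducts, rows and columns\<close>

lemma biproduct_arr:
  assumes "is_biproduct C A B P" "A \<in> Obj C" "B \<in> Obj C"
  shows "bobj P \<in> Obj C"
    "in1 P \<in> Arr C" "Dom C (in1 P) = A" "Cod C (in1 P) = bobj P"
    "in2 P \<in> Arr C" "Dom C (in2 P) = B" "Cod C (in2 P) = bobj P"
    "pr1 P \<in> Arr C" "Dom C (pr1 P) = bobj P" "Cod C (pr1 P) = A"
    "pr2 P \<in> Arr C" "Dom C (pr2 P) = bobj P" "Cod C (pr2 P) = B"
    "pr1 P \<cdot> in1 P = Idn C A" "pr2 P \<cdot> in2 P = Idn C B"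
    "pr1 P \<cdot> in2 P = Zero C B A" "pr2 P \<cdot> in1 P = Zero C A B"
    "in1 P \<cdot> pr1 P \<boxplus> in2 P \<cdot> pr2 P = Idn C (bobj P)"
  using assms by (auto simp: is_biproduct_def)

lemma is_biproduct_biprod: "A \<in> Obj C \<Longrightarrow> B \<in> Obj C \<Longrightarrow> is_biproduct C A B (biprod C A B)"
  unfolding biprod_def using ex_biproduct someI_ex by metis

lemmas biprod_arr [arr] = biproduct_arr[OF is_biproduct_biprod]

lemma biprod_comp [arr]:
  assumes "A \<in> Obj C" "B \<in> Obj C" "f \<in> Arr C"
  shows "Cod C f = A \<Longrightarrow> pr1 (biprod C A B) \<cdot> (in1 (biprod C A B) \<cdot> f) = f"
    "Cod C f = B \<Longrightarrow> pr2 (biprod C A B) \<cdot> (in2 (biprod C A B) \<cdot> f) = f"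
    "Cod C f = B \<Longrightarrow> pr1 (biprod C A B) \<cdot> (in2 (biprod C A B) \<cdot> f) = Zero C (Dom C f) A"
    "Cod C f = A \<Longrightarrow> pr2 (biprod C A B) \<cdot> (in1 (biprod C A B) \<cdot> f) = Zero C (Dom C f) B"
  using assms by (simp_all add: arr flip: comp_assoc)

lemma row_arr [arr]:
  assumes "f \<in> Arr C" "g \<in> Arr C" "Cod C f = Cod C g"
  shows "row C f g \<in> Arr C" "Dom C (row C f g) = bobj (biprod C (Dom C f) (Dom C g))"
    "Cod C (row C f g) = Cod C g"
  using assms by (simp_all add: row_def arr)

lemma col_arr [arr]:
  assumes "f \<in> Arr C" "g \<in> Arr C" "Dom C f = Dom C g"
  shows "col C f g \<in> Arr C" "Cod C (col C f g) = bobj (biprod C (Cod C f) (Cod C g))"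
    "Dom C (col C f g) = Dom C g"
  using assms by (simp_all add: col_def arr)

end

section \<open>Complexes and the opposite category\<close>

lemma composableD:
  assumes "composable C N X"
  shows "i \<le> N \<Longrightarrow> Ob X i \<in> Obj C" "i < N \<Longrightarrow> Diff X i \<in> Arr C"
    "i < N \<Longrightarrow> Dom C (Diff X i) = Ob X i" "i < N \<Longrightarrow> Cod C (Diff X i) = Ob X (Suc i)"
  using assms by (simp_all add: composable_def)

lemma is_complexD:
  assumes "is_complex C N X"
  shows "i \<le> N \<Longrightarrow> Ob X i \<in> Obj C" "i < N \<Longrightarrow> Diff X i \<in> Arr C"
    "i < N \<Longrightarrow> Dom C (Diff X i) = Ob X i" "i < N \<Longrightarrow> Cod C (Diff X i) = Ob X (Suc i)"
    "Suc i < N \<Longrightarrow> Comp C (Diff X (Suc i)) (Diff X i) = Zero C (Ob X i) (Ob X (Suc (Suc i)))"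
  using assms by (auto simp: is_complex_def composable_def)

lemma is_complexI:
  assumes "\<And>i. i \<le> N \<Longrightarrow> Ob X i \<in> Obj C" "\<And>i. i < N \<Longrightarrow> Diff X i \<in> Arr C"
    "\<And>i. i < N \<Longrightarrow> Dom C (Diff X i) = Ob X i" "\<And>i. i < N \<Longrightarrow> Cod C (Diff X i) = Ob X (Suc i)"
    "\<And>i. Suc i < N \<Longrightarrow> Comp C (Diff X (Suc i)) (Diff X i) = Zero C (Ob X i) (Ob X (Suc (Suc i)))"
  shows "is_complex C N X"
  using assms by (auto simp: is_complex_def composable_def)

lemma is_complex_le: "is_complex C N X \<Longrightarrow> M \<le> N \<Longrightarrow> is_complex C M X"
  by (auto simp: is_complex_def composable_def)

lemma chain_mapD:
  assumes "chain_map C N X Y f"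
  shows "i \<le> N \<Longrightarrow> f i \<in> Arr C" "i \<le> N \<Longrightarrow> Dom C (f i) = Ob X i" "i \<le> N \<Longrightarrow> Cod C (f i) = Ob Y i"
    "i < N \<Longrightarrow> Comp C (f (Suc i)) (Diff X i) = Comp C (Diff Y i) (f i)"
  using assms by (auto simp: chain_map_def)

lemma chain_mapI:
  assumes "\<And>i. i \<le> N \<Longrightarrow> f i \<in> Arr C" "\<And>i. i \<le> N \<Longrightarrow> Dom C (f i) = Ob X i"
    "\<And>i. i \<le> N \<Longrightarrow> Cod C (f i) = Ob Y i"
    "\<And>i. i < N \<Longrightarrow> Comp C (f (Suc i)) (Diff X i) = Comp C (Diff Y i) (f i)"
  shows "chain_map C N X Y f"
  using assms by (auto simp: chain_map_def)

lemma chain_map_le: "chain_map C N X Y f \<Longrightarrow> M \<le> N \<Longrightarrow> chain_map C M X Y f"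
  by (auto simp: chain_map_def)

text \<open>Absorbs signs: null homotopies come from a recursion with target
  \<open>cneg C Y\<close>, and the cone of a pullback square is negated before it is read in the
  opposite category.\<close>

definition cneg :: "('o, 'm) precat \<Rightarrow> ('o, 'm) cochain \<Rightarrow> ('o, 'm) cochain" where
  "cneg C X = \<lparr>Ob = Ob X, Diff = (\<lambda>i. neg C (Diff X i))\<rparr>"

lemma cneg_sel [simp]: "Ob (cneg C X) = Ob X" "Diff (cneg C X) i = neg C (Diff X i)"
  by (simp_all add: cneg_def)

lemma cshift_sel [simp]: "Ob (cshift X) i = Ob X (Suc i)" "Diff (cshift X) i = Diff X (Suc i)"
  by (simp_all add: cshift_def)

context additive_category
begin

lemma chain_map_Idn:
  "is_complex C N X \<Longrightarrow> chain_map C N X X (\<lambda>i. Idn C (Ob X i))"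
  by (rule chain_mapI) (simp_all add: is_complexD arr)

lemma chain_map_comp:
  assumes "chain_map C N X Y f" "chain_map C N Y Z g" "is_complex C N X" "is_complex C N Y"
    "is_complex C N Z"
  shows "chain_map C N X Z (\<lambda>i. g i \<cdot> f i)"
proof (rule chain_mapI)
  fix i assume i: "i < N"
  note [simp] = chain_mapD[OF assms(1)] chain_mapD[OF assms(2)] is_complexD[OF assms(3)]
    is_complexD[OF assms(4)] is_complexD[OF assms(5)]
  have "(g (Suc i) \<cdot> f (Suc i)) \<cdot> Diff X i = g (Suc i) \<cdot> (Diff Y i \<cdot> f i)"
    using i by (simp add: arr)
  also have "\<dots> = (Diff Z i \<cdot> g i) \<cdot> f i"
    using i by (subst reassoc[OF chain_mapD(4)[OF assms(2)]]) (simp_all add: arr)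
  also have "\<dots> = Diff Z i \<cdot> (g i \<cdot> f i)" using i by (simp add: arr)
  finally show "(g (Suc i) \<cdot> f (Suc i)) \<cdot> Diff X i = Diff Z i \<cdot> (g i \<cdot> f i)" .
qed (simp_all add: chain_mapD[OF assms(1)] chain_mapD[OF assms(2)] arr)

lemma kernel_HomGrp:
  "kernel (HomGrp C Z A) (HomGrp C Z B) h = {u \<in> Arr C. Dom C u = Z \<and> Cod C u = A \<and> h u = Zero C Z B}"
  "kernel (HomGrp C A Z) (HomGrp C B Z) h = {u \<in> Arr C. Dom C u = A \<and> Cod C u = Z \<and> h u = Zero C B Z}"
  by (auto simp: kernel_def HomGrp_def)

text \<open>Reduces exactness of Hom sequences to factorizations of single morphisms. That
  consecutive differentials compose to zero is itself a consequence of exactness, so the right-hand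
  side may ask for a complex.\<close>

lemma n_kernel_iff:
  "n_kernel C n X \<longleftrightarrow> is_complex C (n + 1) X \<and>
     (\<forall>u \<in> Arr C. Cod C u = Ob X 0 \<longrightarrow> Diff X 0 \<cdot> u = Zero C (Dom C u) (Ob X 1) \<longrightarrow>
        u = Zero C (Dom C u) (Ob X 0)) \<and>
     (\<forall>i<n. \<forall>u \<in> Arr C. Cod C u = Ob X (Suc i) \<longrightarrow>
        Diff X (Suc i) \<cdot> u = Zero C (Dom C u) (Ob X (Suc (Suc i))) \<longrightarrow>
        (\<exists>v \<in> Arr C. Dom C v = Dom C u \<and> Cod C v = Ob X i \<and> Diff X i \<cdot> v = u))"
    (is "?L \<longleftrightarrow> ?c \<and> ?m \<and> ?e")
proof (intro iffI conjI)
  assume L: ?L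
  hence comp: "composable C (n + 1) X" by (simp add: n_kernel_def)
  have ex: "{u \<in> Arr C. Dom C u = Z \<and> Cod C u = Ob X i \<and> Diff X i \<cdot> u = Zero C Z (Ob X (i + 1))} =
      (\<lambda>v. Diff X (i - 1) \<cdot> v) ` Hom C Z (Ob X (i - 1))"
    if "Z \<in> Obj C" "i \<in> {1..n}" for Z i
    using L that unfolding n_kernel_def kernel_HomGrp by blast
  have mo: "{u \<in> Arr C. Dom C u = Z \<and> Cod C u = Ob X 0 \<and> Diff X 0 \<cdot> u = Zero C Z (Ob X 1)} =
      {Zero C Z (Ob X 0)}" if "Z \<in> Obj C" for Z
    using L that unfolding n_kernel_def kernel_HomGrp by blast
  show ?c
    unfolding is_complex_def
  proof (intro conjI allI impI comp)
    fix i assume i: "Suc i < n + 1"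
    \<comment> \<open>The differential is its own composite with an identity, so it lies in the
      image, hence in the kernel of the next differential.\<close>
    have "Diff X i \<cdot> Idn C (Ob X i) \<in> (\<lambda>v. Diff X i \<cdot> v) ` Hom C (Ob X i) (Ob X i)"
      by (rule imageI) (use i composableD[OF comp] in \<open>simp add: arr\<close>)
    hence "Diff X i \<in> {u \<in> Arr C. Dom C u = Ob X i \<and> Cod C u = Ob X (Suc i) \<and>
        Diff X (Suc i) \<cdot> u = Zero C (Ob X i) (Ob X (Suc i + 1))}"
      using ex[of "Ob X i" "Suc i"] i composableD[OF comp] by (simp add: arr)
    thus "Diff X (Suc i) \<cdot> Diff X i = Zero C (Ob X i) (Ob X (Suc (Suc i)))" by simp
  qed
  show ?m
  proof (intro ballI impI)
    fix u assume "u \<in> Arr C" "Cod C u = Ob X 0" "Diff X 0 \<cdot> u = Zero C (Dom C u) (Ob X 1)"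
    thus "u = Zero C (Dom C u) (Ob X 0)" using mo[of "Dom C u"] by (auto simp: arr)
  qed
  show ?e
  proof (intro ballI impI allI)
    fix i u assume i: "i < n" and "u \<in> Arr C" "Cod C u = Ob X (Suc i)"
      "Diff X (Suc i) \<cdot> u = Zero C (Dom C u) (Ob X (Suc (Suc i)))"
    hence "u \<in> (\<lambda>v. Diff X i \<cdot> v) ` Hom C (Dom C u) (Ob X i)"
      using ex[of "Dom C u" "Suc i"] by (auto simp: arr)
    thus "\<exists>v \<in> Arr C. Dom C v = Dom C u \<and> Cod C v = Ob X i \<and> Diff X i \<cdot> v = u" by auto
  qed
next
  assume R: "?c \<and> ?m \<and> ?e"
  hence c: ?c and m: ?m and e: ?e by blast+
  note [simp] = is_complexD[OF c]
  show ?L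
    unfolding n_kernel_def kernel_HomGrp
  proof (intro conjI ballI)
    show "composable C (n + 1) X" using c by (simp add: is_complex_def)
  next
    fix Z assume Z: "Z \<in> Obj C"
    show "{u \<in> Arr C. Dom C u = Z \<and> Cod C u = Ob X 0 \<and> Diff X 0 \<cdot> u = Zero C Z (Ob X 1)} =
      {Zero C Z (Ob X 0)}"
    proof (intro equalityI subsetI; clarsimp)
      show "Zero C Z (Ob X 0) \<in> Arr C \<and> Dom C (Zero C Z (Ob X 0)) = Z \<and>
        Cod C (Zero C Z (Ob X 0)) = Ob X 0 \<and> Diff X 0 \<cdot> Zero C Z (Ob X 0) = Zero C Z (Ob X (Suc 0))"
        using Z by (simp add: arr)
    qed (use m in auto)
  next
    fix Z i assume Z: "Z \<in> Obj C" and "i \<in> {1..n}"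
    then obtain j where j: "i = Suc j" "j < n" by (cases i) auto
    show "{u \<in> Arr C. Dom C u = Z \<and> Cod C u = Ob X i \<and> Diff X i \<cdot> u = Zero C Z (Ob X (i + 1))} =
      (\<lambda>v. Diff X (i - 1) \<cdot> v) ` Hom C Z (Ob X (i - 1))"
    proof (intro equalityI subsetI)
      fix u assume "u \<in> {u \<in> Arr C. Dom C u = Z \<and> Cod C u = Ob X i \<and> Diff X i \<cdot> u = Zero C Z (Ob X (i + 1))}"
      with e j obtain v where "v \<in> Arr C" "Dom C v = Dom C u" "Cod C v = Ob X j" "Diff X j \<cdot> v = u"
        "Dom C u = Z" by auto
      thus "u \<in> (\<lambda>v. Diff X (i - 1) \<cdot> v) ` Hom C Z (Ob X (i - 1))" using j by auto
    next
      fix u assume "u \<in> (\<lambda>v. Diff X (i - 1) \<cdot> v) ` Hom C Z (Ob X (i - 1))"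
      then obtain v where v: "u = Diff X j \<cdot> v" "v \<in> Arr C" "Dom C v = Z" "Cod C v = Ob X j"
        using j by auto
      have "Diff X (Suc j) \<cdot> (Diff X j \<cdot> v) = Zero C (Ob X j) (Ob X (Suc (Suc j))) \<cdot> v"
        by (rule reassoc) (use j v in simp_all)
      thus "u \<in> {u \<in> Arr C. Dom C u = Z \<and> Cod C u = Ob X i \<and> Diff X i \<cdot> u = Zero C Z (Ob X (i + 1))}"
        using v j by (simp add: arr)
    qed
  qed
qed

end

text \<open>\<open>biprod (op_cat C)\<close> is a choice of its own and not the dual of
  \<open>biprod C\<close>. Dualised statements are therefore phrased without chosen
  biproducts.\<close>

definition op_cat :: "('o, 'm) precat \<Rightarrow> ('o, 'm) precat" where
  "op_cat C = \<lparr>Obj = Obj C, Arr = Arr C, Dom = Cod C, Cod = Dom C, Idn = Idn C,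
     Comp = (\<lambda>g f. Comp C f g), Plus = Plus C, Zero = (\<lambda>A B. Zero C B A)\<rparr>"

lemma op_cat_sel [simp]:
  "Obj (op_cat C) = Obj C" "Arr (op_cat C) = Arr C" "Dom (op_cat C) = Cod C"
  "Cod (op_cat C) = Dom C" "Idn (op_cat C) = Idn C" "Comp (op_cat C) g = (\<lambda>f. Comp C f g)"
  "Plus (op_cat C) = Plus C" "Zero (op_cat C) A B = Zero C B A"
  by (simp_all add: op_cat_def)

lemma Hom_op [simp]: "Hom (op_cat C) A B = Hom C B A"
  by (auto simp: Hom_def)

lemma HomGrp_op [simp]: "HomGrp (op_cat C) A B = HomGrp C B A"
  by (simp add: HomGrp_def)

lemma neg_op [simp]: "neg (op_cat C) f = neg C f"
  by (simp add: neg_def)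

lemma is_iso_op [simp]: "is_iso (op_cat C) f = is_iso C f"
  by (simp add: is_iso_def conj_commute)

lemma op_op [simp]: "op_cat (op_cat C) = C"
  by (simp add: op_cat_def)

lemma (in additive_category) additive_category_op: "additive_category (op_cat C)"
proof (rule additive_category.intro)
  show "\<exists>P. is_biproduct (op_cat C) A B P" if AB: "A \<in> Obj (op_cat C)" "B \<in> Obj (op_cat C)" for A B
  proof -
    let ?P = "biprod C A B"
    have "is_biproduct (op_cat C) A B \<lparr>bobj = bobj ?P, in1 = pr1 ?P, in2 = pr2 ?P, pr1 = in1 ?P, pr2 = in2 ?P\<rparr>"
      using AB by (simp add: is_biproduct_def arr)
    thus ?thesis by blast
  qed
  show "\<exists>Z. is_zero_object (op_cat C) Z"
    using ex_zero_object unfolding is_zero_object_def by (simp add: conj_commute)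
  show "comm_group (HomGrp (op_cat C) A B)" if "A \<in> Obj (op_cat C)" "B \<in> Obj (op_cat C)" for A B
    using that HomGrp_comm_group by simp
qed (simp_all add: arr)

text \<open>Only the degrees \<open>0,\<dots>,N\<close> of \<open>X\<close> are meaningful in \<open>crev N X\<close>; below degree \<open>0\<close> truncated
  subtraction yields junk.\<close>

definition crev :: "nat \<Rightarrow> ('o, 'm) cochain \<Rightarrow> ('o, 'm) cochain" where
  "crev N X = \<lparr>Ob = (\<lambda>i. Ob X (N - i)), Diff = (\<lambda>i. Diff X (N - Suc i))\<rparr>"

lemma crev_sel [simp]: "Ob (crev N X) i = Ob X (N - i)" "Diff (crev N X) i = Diff X (N - Suc i)"
  by (simp_all add: crev_def)

lemma is_complex_crev:
  assumes "is_complex C N X"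
  shows "is_complex (op_cat C) N (crev N X)"
proof (rule is_complexI)
  fix i assume i: "Suc i < N"
  \<comment> \<open>Counting from the top turns each truncated subtraction below into
    \<open>j\<close> or a successor of it.\<close>
  define j where "j = N - Suc (Suc i)"
  have j: "N - i = Suc (Suc j)" "N - Suc i = Suc j" "N - Suc (Suc i) = j" "Suc j < N"
    using i by (auto simp: j_def)
  show "Comp (op_cat C) (Diff (crev N X) (Suc i)) (Diff (crev N X) i) =
    Zero (op_cat C) (Ob (crev N X) i) (Ob (crev N X) (Suc (Suc i)))"
    unfolding crev_sel op_cat_sel j by (rule is_complexD(5)[OF assms j(4)])
next
  fix i assume i: "i < N"
  define j where "j = N - Suc i"
  have j: "N - i = Suc j" "N - Suc i = j" "j < N"
    using i by (auto simp: j_def)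
  show "Diff (crev N X) i \<in> Arr (op_cat C)" "Dom (op_cat C) (Diff (crev N X) i) = Ob (crev N X) i"
    "Cod (op_cat C) (Diff (crev N X) i) = Ob (crev N X) (Suc i)"
    unfolding crev_sel op_cat_sel j by (rule is_complexD[OF assms] j(3))+
qed (simp add: is_complexD[OF assms])

lemma chain_map_crev:
  assumes "chain_map C N X Y f"
  shows "chain_map (op_cat C) N (crev N Y) (crev N X) (\<lambda>i. f (N - i))"
proof (rule chain_mapI)
  fix i assume i: "i < N"
  define j where "j = N - Suc i"
  have j: "N - i = Suc j" "N - Suc i = j" "j < N"
    using i by (auto simp: j_def)
  show "Comp (op_cat C) (f (N - Suc i)) (Diff (crev N Y) i) = Comp (op_cat C) (Diff (crev N X) i) (f (N - i))"
    unfolding crev_sel op_cat_sel j by (rule chain_mapD(4)[OF assms j(3), symmetric])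
qed (simp_all add: chain_mapD[OF assms])

section \<open>Duality between n-kernels and n-cokernels\<close>

context additive_category
begin

text \<open>Under the reindexing that sends i to n + 1 - i, a permutation of \<open>{1..n}\<close>,
  the conditions on both sides become literally the same.\<close>

lemma n_cokernel_iff_op: "n_cokernel C n X \<longleftrightarrow> n_kernel (op_cat C) n (crev (n + 1) X)"
proof -
  have 1: "composable (op_cat C) (n + 1) (crev (n + 1) X) \<longleftrightarrow> composable C (n + 1) X"
  proof -
    have *: "(\<forall>i\<le>N. P (N - i)) \<longleftrightarrow> (\<forall>i\<le>N. P i)" for P and N :: nat
    proof (intro iffI allI impI)
      fix i assume P: "\<forall>i\<le>N. P (N - i)" and "i \<le> N"
      with P[rule_format, of "N - i"] show "P i" by simp
    qed simp
    have "Suc n - i = Suc (n - i)" if "i \<le> n" for i using that by simp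
    thus ?thesis
      using *[of "n + 1" "\<lambda>i. Ob X i \<in> Obj C"]
        *[of n "\<lambda>i. Diff X i \<in> Arr C \<and> Dom C (Diff X i) = Ob X i \<and> Cod C (Diff X i) = Ob X (Suc i)"]
      unfolding composable_def by (auto simp: less_Suc_eq_le)
  qed
  have 2: "(\<forall>i\<in>{1..n}. P (n + 1 - i)) \<longleftrightarrow> (\<forall>i\<in>{1..n}. P i)" for P
  proof -
    have *: "n + 1 - i \<in> {1..n}" "n + 1 - (n + 1 - i) = i" if "i \<in> {1..n}" for i
      using that by auto
    show ?thesis using * by metis
  qed
  have 3: "(kernel (HomGrp C (Ob X i) Z) (HomGrp C (Ob X (i - 1)) Z) (\<lambda>u. u \<cdot> Diff X (i - 1))
             = (\<lambda>v. v \<cdot> Diff X i) ` Hom C (Ob X (i + 1)) Z) \<longleftrightarrow>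
    (kernel (HomGrp (op_cat C) Z (Ob (crev (n + 1) X) j)) (HomGrp (op_cat C) Z (Ob (crev (n + 1) X) (j + 1)))
      (\<lambda>u. Diff (crev (n + 1) X) j \<cdot>\<^bsub>op_cat C\<^esub> u)
     = (\<lambda>v. Diff (crev (n + 1) X) (j - 1) \<cdot>\<^bsub>op_cat C\<^esub> v) ` Hom (op_cat C) Z (Ob (crev (n + 1) X) (j - 1)))"
    if "i \<in> {1..n}" "j = n + 1 - i" for i j Z
  proof -
    have "n + 1 - j = i" "n + 1 - (j + 1) = i - 1" "n + 1 - Suc j = i - 1" "n + 1 - (j - 1) = i + 1"
      "n + 1 - Suc (j - 1) = i" using that by auto
    moreover have "Hom (op_cat C) Z A = Hom C A Z" for A by (auto simp: Hom_def)
    ultimately show ?thesis by simp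
  qed
  have "(\<forall>i\<in>{1..n}. kernel (HomGrp C (Ob X i) Z) (HomGrp C (Ob X (i - 1)) Z) (\<lambda>u. u \<cdot> Diff X (i - 1))
             = (\<lambda>v. v \<cdot> Diff X i) ` Hom C (Ob X (i + 1)) Z) \<longleftrightarrow>
    (\<forall>j\<in>{1..n}. kernel (HomGrp (op_cat C) Z (Ob (crev (n + 1) X) j)) (HomGrp (op_cat C) Z (Ob (crev (n + 1) X) (j + 1)))
      (\<lambda>u. Diff (crev (n + 1) X) j \<cdot>\<^bsub>op_cat C\<^esub> u)
     = (\<lambda>v. Diff (crev (n + 1) X) (j - 1) \<cdot>\<^bsub>op_cat C\<^esub> v) ` Hom (op_cat C) Z (Ob (crev (n + 1) X) (j - 1)))" for Z
    by (subst 2[symmetric]) (intro ball_cong refl 3; auto)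
  thus ?thesis
    unfolding n_cokernel_def n_kernel_def 1 by simp
qed

text \<open>Reversing twice alters the values outside the meaningful degrees, so it does not return
  \<open>X\<close>; the predicate does not look at those values.\<close>

lemma n_kernel_crev_crev: "n_kernel C n (crev (n + 1) (crev (n + 1) X)) \<longleftrightarrow> n_kernel C n X"
proof -
  have *: "n_kernel C n Y" if "n_kernel C n X" "\<And>i. i \<le> n + 1 \<Longrightarrow> Ob X i = Ob Y i"
    "\<And>i. i < n + 1 \<Longrightarrow> Diff X i = Diff Y i" for X Y
    using that unfolding n_kernel_def composable_def by auto
  show ?thesis
    by (intro iffI; erule *) auto
qed

end

lemma (in additive_category) n_kernel_iff_op: "n_kernel C n X \<longleftrightarrow> n_cokernel (op_cat C) n (crev (n + 1) X)"
  using additive_category.n_cokernel_iff_op[OF additive_category_op] n_kernel_crev_crev by (metis op_op)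

section \<open>Comparison of complexes and homotopies\<close>

context additive_category
begin

text \<open>Transported from \<open>n_kernel_iff\<close> in the opposite category, where degree i
  corresponds to n - Suc i.\<close>

lemma n_cokernel_iff:
  "n_cokernel C n X \<longleftrightarrow> is_complex C (n + 1) X \<and>
     (\<forall>u \<in> Arr C. Dom C u = Ob X (n + 1) \<longrightarrow> u \<cdot> Diff X n = Zero C (Ob X n) (Cod C u) \<longrightarrow>
        u = Zero C (Ob X (n + 1)) (Cod C u)) \<and>
     (\<forall>i<n. \<forall>u \<in> Arr C. Dom C u = Ob X (Suc i) \<longrightarrow>
        u \<cdot> Diff X i = Zero C (Ob X i) (Cod C u) \<longrightarrow>
        (\<exists>v \<in> Arr C. Dom C v = Ob X (Suc (Suc i)) \<and> Cod C v = Cod C u \<and> v \<cdot> Diff X (Suc i) = u))"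
    (is "_ \<longleftrightarrow> _ \<and> _ \<and> (\<forall>i<n. ?E i)")
proof -
  have 1: "is_complex (op_cat C) (n + 1) (crev (n + 1) X) \<longleftrightarrow> is_complex C (n + 1) X"
  proof
    assume "is_complex (op_cat C) (n + 1) (crev (n + 1) X)"
    hence "is_complex C (n + 1) (crev (n + 1) (crev (n + 1) X))"
      using is_complex_crev by fastforce
    thus "is_complex C (n + 1) X"
      by (auto simp: is_complex_def composable_def)
  qed (rule is_complex_crev)
  have 2: "(\<forall>i<n. P (n - Suc i)) \<longleftrightarrow> (\<forall>i<n. P i)" for P
  proof -
    have *: "n - Suc i < n" "n - Suc (n - Suc i) = i" if "i < n" for i
      using that by auto
    show ?thesis using * by metis
  qed
  have 3: "n + 1 - Suc i = Suc (n - Suc i)" "n + 1 - i = Suc (Suc (n - Suc i))" "n - i = Suc (n - Suc i)"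
    "n + 1 - Suc (Suc i) = n - Suc i" "n + 1 - 1 = n" if "i < n" for i
    using that by auto
  have "(\<forall>i<n. ?E i) \<longleftrightarrow> (\<forall>i<n. \<forall>u \<in> Arr C. Dom C u = Ob (crev (n + 1) X) (Suc i) \<longrightarrow>
        u \<cdot> Diff (crev (n + 1) X) (Suc i) = Zero C (Ob (crev (n + 1) X) (Suc (Suc i))) (Cod C u) \<longrightarrow>
        (\<exists>v \<in> Arr C. Cod C v = Cod C u \<and> Dom C v = Ob (crev (n + 1) X) i \<and> v \<cdot> Diff (crev (n + 1) X) i = u))"
    unfolding 2[of ?E, symmetric] crev_sel
    by (intro all_cong1 imp_cong refl) (simp only: 3 conj_commute conj_left_commute)
  thus ?thesis
    unfolding n_cokernel_iff_op additive_category.n_kernel_iff[OF additive_category_op] 1 by simp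
qed

lemma n_kernelD:
  assumes "n_kernel C n X"
  shows "is_complex C (n + 1) X"
    and "\<lbrakk>u \<in> Arr C; Cod C u = Ob X 0; Diff X 0 \<cdot> u = Zero C (Dom C u) (Ob X 1)\<rbrakk> \<Longrightarrow>
      u = Zero C (Dom C u) (Ob X 0)"
    and "\<lbrakk>i < n; u \<in> Arr C; Cod C u = Ob X (Suc i); Diff X (Suc i) \<cdot> u = Zero C (Dom C u) (Ob X (Suc (Suc i)))\<rbrakk> \<Longrightarrow>
      \<exists>v \<in> Arr C. Dom C v = Dom C u \<and> Cod C v = Ob X i \<and> Diff X i \<cdot> v = u"
  using assms unfolding n_kernel_iff by blast+

lemma n_kernelI:
  assumes "is_complex C (n + 1) X"
    and "\<And>u. \<lbrakk>u \<in> Arr C; Cod C u = Ob X 0; Diff X 0 \<cdot> u = Zero C (Dom C u) (Ob X 1)\<rbrakk> \<Longrightarrow>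
      u = Zero C (Dom C u) (Ob X 0)"
    and "\<And>i u. \<lbrakk>i < n; u \<in> Arr C; Cod C u = Ob X (Suc i); Diff X (Suc i) \<cdot> u = Zero C (Dom C u) (Ob X (Suc (Suc i)))\<rbrakk> \<Longrightarrow>
      \<exists>v \<in> Arr C. Dom C v = Dom C u \<and> Cod C v = Ob X i \<and> Diff X i \<cdot> v = u"
  shows "n_kernel C n X"
  using assms unfolding n_kernel_iff by blast

lemma n_cokernelD:
  assumes "n_cokernel C n X"
  shows "is_complex C (n + 1) X"
    and "\<lbrakk>u \<in> Arr C; Dom C u = Ob X (n + 1); u \<cdot> Diff X n = Zero C (Ob X n) (Cod C u)\<rbrakk> \<Longrightarrow>
      u = Zero C (Ob X (n + 1)) (Cod C u)"
    and "\<lbrakk>i < n; u \<in> Arr C; Dom C u = Ob X (Suc i); u \<cdot> Diff X i = Zero C (Ob X i) (Cod C u)\<rbrakk> \<Longrightarrow>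
      \<exists>v \<in> Arr C. Dom C v = Ob X (Suc (Suc i)) \<and> Cod C v = Cod C u \<and> v \<cdot> Diff X (Suc i) = u"
  using assms unfolding n_cokernel_iff by blast+

lemma n_cokernelI:
  assumes "is_complex C (n + 1) X"
    and "\<And>u. \<lbrakk>u \<in> Arr C; Dom C u = Ob X (n + 1); u \<cdot> Diff X n = Zero C (Ob X n) (Cod C u)\<rbrakk> \<Longrightarrow>
      u = Zero C (Ob X (n + 1)) (Cod C u)"
    and "\<And>i u. \<lbrakk>i < n; u \<in> Arr C; Dom C u = Ob X (Suc i); u \<cdot> Diff X i = Zero C (Ob X i) (Cod C u)\<rbrakk> \<Longrightarrow>
      \<exists>v \<in> Arr C. Dom C v = Ob X (Suc (Suc i)) \<and> Cod C v = Cod C u \<and> v \<cdot> Diff X (Suc i) = u"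
  shows "n_cokernel C n X"
  using assms unfolding n_cokernel_iff by blast

text \<open>Exactness at the last term, applied to the difference of \<open>u\<close> and
  \<open>v\<close>.\<close>

lemma n_cokernel_epi:
  assumes "n_cokernel C n X" "u \<in> Arr C" "v \<in> Arr C" "Dom C u = Ob X (n + 1)" "Dom C v = Ob X (n + 1)"
    "Cod C u = Cod C v" "u \<cdot> Diff X n = v \<cdot> Diff X n"
  shows "u = v"
proof -
  note [simp] = is_complexD[OF n_cokernelD(1)[OF assms(1)]]
  have "u \<boxplus> neg C v = Zero C (Ob X (n + 1)) (Cod C (u \<boxplus> neg C v))"
    by (rule n_cokernelD(2)[OF assms(1)]) (use assms in \<open>simp_all add: arr\<close>)
  thus ?thesis using assms by (simp add: arr minus_eq_zero_iff)
qed

lemma plus_swap: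
  assumes "f \<boxplus> neg C g = e" "f \<in> Arr C" "g \<in> Arr C" "Dom C f = Dom C g" "Cod C f = Cod C g"
  shows "f = g \<boxplus> e"
  using assms plus_left_comm[of g f "neg C g"] by (auto simp: arr)

lemma is_complex_cneg: "is_complex C N X \<Longrightarrow> is_complex C N (cneg C X)"
  by (rule is_complexI) (simp_all add: is_complexD arr)

lemma is_complex_cshift: "is_complex C (Suc N) X \<Longrightarrow> is_complex C N (cshift X)"
  by (rule is_complexI) (simp_all add: is_complexD)

text \<open>The common recursion behind the comparison theorem, the construction of null homotopies and
  the universal property of pushouts: with \<open>a\<close> an anti-commuting family, one solves
  \<open>b (k + 1) d = a (k + 1) + d b k\<close> for \<open>b\<close> of degree \<open>-1\<close>.\<close>

lemma n_cokernel_recursion: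
  assumes K: "n_cokernel C n K" and T: "is_complex C n T"
    and a: "\<And>k. k < n \<Longrightarrow> a (Suc k) \<in> Arr C" "\<And>k. k < n \<Longrightarrow> Dom C (a (Suc k)) = Ob K (Suc k)"
      "\<And>k. k < n \<Longrightarrow> Cod C (a (Suc k)) = Ob T (Suc k)"
    and aa: "\<And>k. Suc k < n \<Longrightarrow> a (Suc (Suc k)) \<cdot> Diff K (Suc k) \<boxplus> Diff T (Suc k) \<cdot> a (Suc k) =
      Zero C (Ob K (Suc k)) (Ob T (Suc (Suc k)))"
    and b0: "b0 \<in> Arr C" "Dom C b0 = Ob K 1" "Cod C b0 = Ob T 0"
    and base: "0 < n \<Longrightarrow> (a 1 \<boxplus> Diff T 0 \<cdot> b0) \<cdot> Diff K 0 = Zero C (Ob K 0) (Ob T 1)"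
  obtains b where "b 0 = b0" "\<And>k. k \<le> n \<Longrightarrow> b k \<in> Arr C" "\<And>k. k \<le> n \<Longrightarrow> Dom C (b k) = Ob K (Suc k)"
    "\<And>k. k \<le> n \<Longrightarrow> Cod C (b k) = Ob T k"
    "\<And>k. k < n \<Longrightarrow> b (Suc k) \<cdot> Diff K (Suc k) = a (Suc k) \<boxplus> Diff T k \<cdot> b k"
proof -
  note [simp] = is_complexD[OF n_cokernelD(1)[OF K]] is_complexD[OF T] a b0
  have "\<exists>b. b 0 = b0 \<and> (\<forall>k\<le>m. b k \<in> Arr C \<and> Dom C (b k) = Ob K (Suc k) \<and> Cod C (b k) = Ob T k) \<and>
    (\<forall>k<m. b (Suc k) \<cdot> Diff K (Suc k) = a (Suc k) \<boxplus> Diff T k \<cdot> b k)" if "m \<le> n" for m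
    using that
  proof (induction m)
    case 0
    thus ?case by (intro exI[of _ "\<lambda>_. b0"]) simp
  next
    case (Suc m)
    then obtain b where b: "b 0 = b0" "\<And>k. k \<le> m \<Longrightarrow> b k \<in> Arr C"
      "\<And>k. k \<le> m \<Longrightarrow> Dom C (b k) = Ob K (Suc k)" "\<And>k. k \<le> m \<Longrightarrow> Cod C (b k) = Ob T k"
      "\<And>k. k < m \<Longrightarrow> b (Suc k) \<cdot> Diff K (Suc k) = a (Suc k) \<boxplus> Diff T k \<cdot> b k"
      by auto
    have m: "m < n" using Suc.prems by simp
    let ?g = "a (Suc m) \<boxplus> Diff T m \<cdot> b m"
    have g: "?g \<in> Arr C" "Dom C ?g = Ob K (Suc m)" "Cod C ?g = Ob T (Suc m)"
      using m b by (simp_all add: arr)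
    \<comment> \<open>This vanishing lets the right-hand side factor through the next differential
      of \<open>K\<close>. For positive \<open>m\<close> the previous equation is substituted; the
      square of the differential of \<open>T\<close> drops out and \<open>aa\<close>
      remains.\<close>
    have "?g \<cdot> Diff K m = Zero C (Ob K m) (Ob T (Suc m))"
    proof (cases m)
      case 0
      thus ?thesis using base m b by simp
    next
      case (Suc j)
      have *: "Diff T (Suc j) \<cdot> (Diff T j \<cdot> b j) = Zero C (Ob K (Suc j)) (Ob T (Suc (Suc j)))"
        using Suc m b by (subst reassoc[OF is_complexD(5)[OF T]]) (simp_all add: arr)
      have "?g \<cdot> Diff K m = a (Suc (Suc j)) \<cdot> Diff K (Suc j) \<boxplus> Diff T (Suc j) \<cdot> (b (Suc j) \<cdot> Diff K (Suc j))"
        using Suc m b(2-4) by (simp add: arr)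
      also have "\<dots> = a (Suc (Suc j)) \<cdot> Diff K (Suc j) \<boxplus> Diff T (Suc j) \<cdot> a (Suc j)"
        using Suc m b(2-4) * by (subst b(5)) (simp_all add: arr)
      finally show ?thesis using aa Suc m by simp
    qed
    then obtain v where v: "v \<in> Arr C" "Dom C v = Ob K (Suc (Suc m))" "Cod C v = Cod C ?g"
      "v \<cdot> Diff K (Suc m) = ?g"
      using n_cokernelD(3)[OF K m g(1,2)] g(3) by auto
    show ?case
      using v g b m
      by (intro exI[of _ "b(Suc m := v)"]) (auto simp: le_Suc_eq less_Suc_eq)
  qed
  from this[of n] show ?thesis using that by auto
qed

text \<open>The factorization of \<open>f 0\<close> starts the recursion with \<open>a = f\<close>
  and target \<open>cneg C Y\<close>, whose sign turns the recursion into the homotopy equation.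
  Indices are by target: \<open>h k\<close> goes from degree k + 1 to degree k. In the last degree
  the equation is checked after \<open>Diff X n\<close>, which is right cancellable.\<close>

lemma null_homotopy:
  assumes X: "n_cokernel C n X" and Y: "is_complex C (n + 1) Y" and f: "chain_map C (n + 1) X Y f"
    and h1: "h1 \<in> Arr C" "Dom C h1 = Ob X 1" "Cod C h1 = Ob Y 0" "f 0 = h1 \<cdot> Diff X 0"
  obtains h where "h 0 = h1" "\<And>k. k \<le> n \<Longrightarrow> h k \<in> Arr C" "\<And>k. k \<le> n \<Longrightarrow> Dom C (h k) = Ob X (Suc k)"
    "\<And>k. k \<le> n \<Longrightarrow> Cod C (h k) = Ob Y k"
    "\<And>k. k < n \<Longrightarrow> f (Suc k) = Diff Y k \<cdot> h k \<boxplus> h (Suc k) \<cdot> Diff X (Suc k)"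
    "f (Suc n) = Diff Y n \<cdot> h n"
proof -
  note [simp] = is_complexD[OF n_cokernelD(1)[OF X]] is_complexD[OF Y] chain_mapD[OF f]
  have T: "is_complex C n (cneg C Y)" by (intro is_complex_cneg is_complex_le[OF Y]) simp
  obtain h where h0: "h 0 = h1" and h: "\<And>k. k \<le> n \<Longrightarrow> h k \<in> Arr C" "\<And>k. k \<le> n \<Longrightarrow> Dom C (h k) = Ob X (Suc k)"
    "\<And>k. k \<le> n \<Longrightarrow> Cod C (h k) = Ob Y k"
    and hd: "\<And>k. k < n \<Longrightarrow> h (Suc k) \<cdot> Diff X (Suc k) = f (Suc k) \<boxplus> Diff (cneg C Y) k \<cdot> h k"
  proof (rule n_cokernel_recursion[OF X T, of f h1])
    assume n: "0 < n"
    have "(f 1 \<boxplus> neg C (Diff Y 0 \<cdot> h1)) \<cdot> Diff X 0 = f (Suc 0) \<cdot> Diff X 0 \<boxplus> neg C (Diff Y 0 \<cdot> f 0)"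
      using n h1 by (simp add: arr)
    also have "\<dots> = Zero C (Ob X 0) (Ob Y 1)" using n h1 by (simp add: arr)
    finally show "(f 1 \<boxplus> Diff (cneg C Y) 0 \<cdot> h1) \<cdot> Diff X 0 = Zero C (Ob X 0) (Ob (cneg C Y) 1)"
      using n h1 by (simp add: arr)
  qed (use h1 in \<open>simp_all add: arr\<close>)
  have hd': "f (Suc k) = Diff Y k \<cdot> h k \<boxplus> h (Suc k) \<cdot> Diff X (Suc k)" if k: "k < n" for k
    by (rule plus_swap) (use hd[OF k] k h in \<open>simp_all add: arr\<close>)
  have *: "Diff Y n \<cdot> (h n \<cdot> Diff X n) = Diff Y n \<cdot> f n"
  proof (cases n)
    case 0
    thus ?thesis using h0 h1 by simp
  next
    case (Suc k)
    have "Diff Y (Suc k) \<cdot> (Diff Y k \<cdot> h k) = Zero C (Ob X (Suc k)) (Ob Y (Suc (Suc k)))"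
      using Suc h by (subst reassoc[OF is_complexD(5)[OF Y]]) (simp_all add: arr)
    thus ?thesis using Suc hd h by (simp add: arr)
  qed
  have "f (Suc n) = Diff Y n \<cdot> h n"
    by (rule n_cokernel_epi[OF X]) (use h * in \<open>simp_all add: arr\<close>)
  thus ?thesis using that h0 h hd' by blast
qed

text \<open>The recursion with \<open>a = 0\<close> and target \<open>cshift Y\<close>, so that
  \<open>b k\<close> is the component in degree k + 1. Both lowest components must be prescribed,
  because the factorization property of an n-cokernel starts with morphisms out of degree 1.\<close>

lemma comparison:
  assumes X: "n_cokernel C n X" and Y: "is_complex C (n + 1) Y"
    and f0: "f0 \<in> Arr C" "Dom C f0 = Ob X 0" "Cod C f0 = Ob Y 0"
    and f1: "f1 \<in> Arr C" "Dom C f1 = Ob X 1" "Cod C f1 = Ob Y 1" "f1 \<cdot> Diff X 0 = Diff Y 0 \<cdot> f0"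
  obtains f where "chain_map C (n + 1) X Y f" "f 0 = f0" "f 1 = f1"
proof -
  note [simp] = is_complexD[OF n_cokernelD(1)[OF X]] is_complexD[OF Y] f0 f1
  have T: "is_complex C n (cshift Y)" by (intro is_complex_cshift) (use Y in simp)
  obtain b where b: "b 0 = f1" "\<And>k. k \<le> n \<Longrightarrow> b k \<in> Arr C" "\<And>k. k \<le> n \<Longrightarrow> Dom C (b k) = Ob X (Suc k)"
    "\<And>k. k \<le> n \<Longrightarrow> Cod C (b k) = Ob (cshift Y) k"
    and bd: "\<And>k. k < n \<Longrightarrow> b (Suc k) \<cdot> Diff X (Suc k) = Zero C (Ob X (Suc k)) (Ob Y (Suc (Suc k))) \<boxplus> Diff (cshift Y) k \<cdot> b k"
  proof (rule n_cokernel_recursion[OF X T, of "\<lambda>k. Zero C (Ob X k) (Ob Y (Suc k))" f1])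
    have "Diff Y (Suc 0) \<cdot> (Diff Y 0 \<cdot> f0) = Zero C (Ob X 0) (Ob Y (Suc (Suc 0)))" if "0 < n"
      using that by (subst reassoc[OF is_complexD(5)[OF Y]]) (simp_all add: arr)
    thus "(Zero C (Ob X 1) (Ob Y (Suc 1)) \<boxplus> Diff (cshift Y) 0 \<cdot> f1) \<cdot> Diff X 0 =
        Zero C (Ob X 0) (Ob (cshift Y) 1)" if "0 < n"
      using that by (simp add: arr)
  qed (use f1 in \<open>simp_all add: arr\<close>)
  have "chain_map C (n + 1) X Y (\<lambda>i. case i of 0 \<Rightarrow> f0 | Suc j \<Rightarrow> b j)"
  proof (rule chain_mapI)
    fix i assume "i < n + 1"
    thus "(case Suc i of 0 \<Rightarrow> f0 | Suc j \<Rightarrow> b j) \<cdot> Diff X i = Diff Y i \<cdot> (case i of 0 \<Rightarrow> f0 | Suc j \<Rightarrow> b j)"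
      using b bd by (cases i) (simp_all add: arr)
  qed (use b in \<open>simp_all split: nat.split\<close>)
  thus ?thesis using b by (intro that[of "\<lambda>i. case i of 0 \<Rightarrow> f0 | Suc j \<Rightarrow> b j"]) simp_all
qed

text \<open>The difference of \<open>f\<close> and \<open>g\<close> is zero in degree 0, so its null
  homotopy may start with the zero morphism. The equation in the last degree is exported separately,
  since it later serves to correct a last component.\<close>

lemma homotopic_if_eq_0:
  assumes X: "n_cokernel C n X" and Y: "is_complex C (n + 1) Y"
    and f: "chain_map C (n + 1) X Y f" and g: "chain_map C (n + 1) X Y g" and eq: "f 0 = g 0"
  obtains h where "\<And>k. k \<le> n \<Longrightarrow> h k \<in> Arr C" "\<And>k. k \<le> n \<Longrightarrow> Dom C (h k) = Ob X (Suc k)"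
    "\<And>k. k \<le> n \<Longrightarrow> Cod C (h k) = Ob Y k"
    "f (Suc n) = g (Suc n) \<boxplus> Diff Y n \<cdot> h n" "homotopic C (n + 1) X Y f g"
proof -
  note [simp] = is_complexD[OF n_cokernelD(1)[OF X]] is_complexD[OF Y] chain_mapD[OF f] chain_mapD[OF g]
  have fg: "chain_map C (n + 1) X Y (\<lambda>i. f i \<boxplus> neg C (g i))"
    by (rule chain_mapI) (simp_all add: arr)
  let ?Z = "Zero C (Ob X 1) (Ob Y 0)"
  have Z: "?Z \<in> Arr C" "Dom C ?Z = Ob X 1" "Cod C ?Z = Ob Y 0" "f 0 \<boxplus> neg C (g 0) = ?Z \<cdot> Diff X 0"
    using eq by (simp_all add: arr)
  from null_homotopy[OF X Y fg Z] obtain h where h0: "h 0 = ?Z" and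
    h: "\<And>k. k \<le> n \<Longrightarrow> h k \<in> Arr C" "\<And>k. k \<le> n \<Longrightarrow> Dom C (h k) = Ob X (Suc k)"
    "\<And>k. k \<le> n \<Longrightarrow> Cod C (h k) = Ob Y k" and
    hk: "\<And>k. k < n \<Longrightarrow> f (Suc k) \<boxplus> neg C (g (Suc k)) = Diff Y k \<cdot> h k \<boxplus> h (Suc k) \<cdot> Diff X (Suc k)"
    and hn: "f (Suc n) \<boxplus> neg C (g (Suc n)) = Diff Y n \<cdot> h n" by blast
  have n: "f (Suc n) = g (Suc n) \<boxplus> Diff Y n \<cdot> h n"
    by (rule plus_swap[OF hn]) simp_all
  have k: "f (Suc k) = g (Suc k) \<boxplus> (Diff Y k \<cdot> h k \<boxplus> h (Suc k) \<cdot> Diff X (Suc k))" if "k < n" for k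
    by (rule plus_swap[OF hk[OF that]]) (use that in simp_all)
  have "homotopic C (n + 1) X Y f g"
    unfolding homotopic_def
  \<comment> \<open>\<open>homotopic\<close> indexes the homotopy by source degree, one higher than
    here.\<close>
  proof (intro exI[of _ "\<lambda>i. h (i - 1)"] conjI ballI)
    fix i assume i: "i \<in> {1..n + 1}"
    thus "h (i - 1) \<in> Hom C (Ob X i) (Ob Y (i - 1))" using h by (cases i) simp_all
  next
    show "f 0 = g 0 \<boxplus> h (1 - 1) \<cdot> Diff X 0" using h0 eq by (simp add: arr)
    show "f i = g i \<boxplus> (Diff Y (i - 1) \<cdot> h (i - 1) \<boxplus> h (i + 1 - 1) \<cdot> Diff X i)" if "i \<in> {1..<n + 1}" for i
      using that k by (cases i) simp_all
    show "f (n + 1) = g (n + 1) \<boxplus> Diff Y (n + 1 - 1) \<cdot> h (n + 1 - 1)" using n by simp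
  qed
  thus ?thesis using that h n by blast
qed

lemma homotopic_refl:
  assumes X: "is_complex C (n + 1) X" and Y: "is_complex C (n + 1) Y" and f: "chain_map C (n + 1) X Y f"
  shows "homotopic C (n + 1) X Y f f"
  unfolding homotopic_def
proof (intro exI[of _ "\<lambda>i. Zero C (Ob X i) (Ob Y (i - 1))"] conjI ballI)
  note [simp] = is_complexD[OF X] is_complexD[OF Y] chain_mapD[OF f]
  show "f i = f i \<boxplus> (Diff Y (i - 1) \<cdot> Zero C (Ob X i) (Ob Y (i - 1)) \<boxplus>
      Zero C (Ob X (i + 1)) (Ob Y (i + 1 - 1)) \<cdot> Diff X i)" if "i \<in> {1..<n + 1}" for i
    using that by (cases i) (simp_all add: arr)
qed (auto simp: is_complexD[OF X] is_complexD[OF Y] chain_mapD[OF f] arr)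

lemma homotopy_equivalent_refl:
  assumes X: "is_complex C (n + 1) X"
  shows "homotopy_equivalent C n X X"
proof -
  note [simp] = is_complexD[OF X]
  have "homotopic C (n + 1) X X (\<lambda>i. Idn C (Ob X i) \<cdot> Idn C (Ob X i)) (\<lambda>i. Idn C (Ob X i)) \<longleftrightarrow>
    homotopic C (n + 1) X X (\<lambda>i. Idn C (Ob X i)) (\<lambda>i. Idn C (Ob X i))"
    unfolding homotopic_def by (simp add: arr)
  thus ?thesis
    unfolding homotopy_equivalent_def fixed_end_map_def
    using chain_map_Idn[OF X] homotopic_refl[OF X X] by blast
qed

text \<open>If \<open>Diff Y\<close> kills \<open>u\<close>, then \<open>f\<close> carries
  \<open>u\<close> to a morphism that lifts through \<open>Diff X\<close>; the image under
  \<open>g\<close> of the lift is a lift of \<open>u\<close> up to the boundary of the homotopy, and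
  subtracting the homotopy term repairs it.\<close>

lemma n_kernel_retract:
  assumes X: "n_kernel C n X" and Y: "is_complex C (n + 1) Y"
    and f: "chain_map C (n + 1) Y X f" and g: "chain_map C (n + 1) X Y g"
    and h: "homotopic C (n + 1) Y Y (\<lambda>i. g i \<cdot> f i) (\<lambda>i. Idn C (Ob Y i))"
  shows "n_kernel C n Y"
proof (rule n_kernelI[OF Y])
  note [simp] = is_complexD[OF n_kernelD(1)[OF X]] is_complexD[OF Y] chain_mapD(1-3)[OF f] chain_mapD(1-3)[OF g]
  from h obtain h where h': "\<forall>i\<in>{1..n + 1}. h i \<in> Hom C (Ob Y i) (Ob Y (i - 1))"
    and hi': "\<forall>i\<in>{1..<n + 1}. g i \<cdot> f i =
      Idn C (Ob Y i) \<boxplus> (Diff Y (i - 1) \<cdot> h i \<boxplus> h (i + 1) \<cdot> Diff Y i)"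
    and h0: "g 0 \<cdot> f 0 = Idn C (Ob Y 0) \<boxplus> h 1 \<cdot> Diff Y 0"
    unfolding homotopic_def by blast
  have h: "h (Suc i) \<in> Arr C" "Dom C (h (Suc i)) = Ob Y (Suc i)" "Cod C (h (Suc i)) = Ob Y i"
    if "i \<le> n" for i
    using h' that by auto
  have hi: "g (Suc i) \<cdot> f (Suc i) =
      Idn C (Ob Y (Suc i)) \<boxplus> (Diff Y i \<cdot> h (Suc i) \<boxplus> h (Suc (Suc i)) \<cdot> Diff Y (Suc i))" if "i < n" for i
    using hi' that by auto
  have du: "Diff X i \<cdot> (f i \<cdot> u) = Zero C (Dom C u) (Ob X (Suc i))"
    if "i \<le> n" "u \<in> Arr C" "Cod C u = Ob Y i" "Diff Y i \<cdot> u = Zero C (Dom C u) (Ob Y (Suc i))" for i u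
  proof -
    have "Diff X i \<cdot> (f i \<cdot> u) = (f (Suc i) \<cdot> Diff Y i) \<cdot> u"
      using that chain_mapD(4)[OF f, of i] by (simp flip: comp_assoc)
    thus ?thesis using that by (simp add: arr)
  qed
  {
    fix u assume u: "u \<in> Arr C" "Cod C u = Ob Y 0" "Diff Y 0 \<cdot> u = Zero C (Dom C u) (Ob Y 1)"
    have "f 0 \<cdot> u = Zero C (Dom C (f 0 \<cdot> u)) (Ob X 0)"
      by (rule n_kernelD(2)[OF X]) (use u du[of 0 u] in \<open>simp_all add: arr\<close>)
    moreover have "g 0 \<cdot> (f 0 \<cdot> u) = u"
      using u h by (subst reassoc[OF h0]) (simp_all add: arr)
    ultimately show "u = Zero C (Dom C u) (Ob Y 0)"
      using u by (simp add: arr)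
  next
    fix i u assume i: "i < n" and u: "u \<in> Arr C" "Cod C u = Ob Y (Suc i)"
      "Diff Y (Suc i) \<cdot> u = Zero C (Dom C u) (Ob Y (Suc (Suc i)))"
    have "\<exists>v \<in> Arr C. Dom C v = Dom C (f (Suc i) \<cdot> u) \<and> Cod C v = Ob X i \<and> Diff X i \<cdot> v = f (Suc i) \<cdot> u"
      by (rule n_kernelD(3)[OF X]) (use i u du[of "Suc i" u] in \<open>simp_all add: arr\<close>)
    then obtain v where v: "v \<in> Arr C" "Dom C v = Dom C u" "Cod C v = Ob X i" "Diff X i \<cdot> v = f (Suc i) \<cdot> u"
      using i u by (auto simp: arr)
    have "Diff Y i \<cdot> (g i \<cdot> v) = g (Suc i) \<cdot> (Diff X i \<cdot> v)"
      using chain_mapD(4)[OF g, of i] i v(1-3) by (simp flip: comp_assoc)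
    also have "\<dots> = u \<boxplus> Diff Y i \<cdot> (h (Suc i) \<cdot> u)"
      using i u h v(4) by (subst v(4), subst reassoc[OF hi[OF i]]) (simp_all add: arr)
    finally have "Diff Y i \<cdot> (g i \<cdot> v) \<boxplus> neg C (Diff Y i \<cdot> (h (Suc i) \<cdot> u)) = u"
      using i u h v by (simp add: arr)
    hence "Diff Y i \<cdot> (g i \<cdot> v \<boxplus> neg C (h (Suc i) \<cdot> u)) = u"
      using i u h v by (simp add: arr)
    thus "\<exists>v \<in> Arr C. Dom C v = Dom C u \<and> Cod C v = Ob Y i \<and> Diff Y i \<cdot> v = u"
      using i u h v by (intro bexI[of _ "g i \<cdot> v \<boxplus> neg C (h (Suc i) \<cdot> u)"]) (simp_all add: arr)
  }
qed

text \<open>The dual argument: \<open>u\<close> composed with \<open>g\<close> extends along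
  \<open>Diff X\<close> to some \<open>v\<close>, and \<open>v\<close> composed with
  \<open>f\<close>, minus \<open>u\<close> composed with the homotopy, extends
  \<open>u\<close>.\<close>

lemma n_cokernel_retract:
  assumes X: "n_cokernel C n X" and Y: "is_complex C (n + 1) Y"
    and f: "chain_map C (n + 1) Y X f" and g: "chain_map C (n + 1) X Y g"
    and h: "homotopic C (n + 1) Y Y (\<lambda>i. g i \<cdot> f i) (\<lambda>i. Idn C (Ob Y i))"
  shows "n_cokernel C n Y"
proof (rule n_cokernelI[OF Y])
  note [simp] = is_complexD[OF n_cokernelD(1)[OF X]] is_complexD[OF Y] chain_mapD(1-3)[OF f] chain_mapD(1-3)[OF g]
  from h obtain h where h': "\<forall>i\<in>{1..n + 1}. h i \<in> Hom C (Ob Y i) (Ob Y (i - 1))"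
    and hi': "\<forall>i\<in>{1..<n + 1}. g i \<cdot> f i =
      Idn C (Ob Y i) \<boxplus> (Diff Y (i - 1) \<cdot> h i \<boxplus> h (i + 1) \<cdot> Diff Y i)"
    and h0: "g (n + 1) \<cdot> f (n + 1) = Idn C (Ob Y (n + 1)) \<boxplus> Diff Y (n + 1 - 1) \<cdot> h (n + 1)"
    unfolding homotopic_def by blast
  have h: "h (Suc i) \<in> Arr C" "Dom C (h (Suc i)) = Ob Y (Suc i)" "Cod C (h (Suc i)) = Ob Y i"
    if "i \<le> n" for i
    using h' that by auto
  have hi: "g (Suc i) \<cdot> f (Suc i) =
      Idn C (Ob Y (Suc i)) \<boxplus> (Diff Y i \<cdot> h (Suc i) \<boxplus> h (Suc (Suc i)) \<cdot> Diff Y (Suc i))" if "i < n" for i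
    using hi' that by auto
  have du: "(u \<cdot> g (Suc i)) \<cdot> Diff X i = Zero C (Ob X i) (Cod C u)"
    if "i \<le> n" "u \<in> Arr C" "Dom C u = Ob Y (Suc i)" "u \<cdot> Diff Y i = Zero C (Ob Y i) (Cod C u)" for i u
  proof -
    have "(u \<cdot> g (Suc i)) \<cdot> Diff X i = u \<cdot> (Diff Y i \<cdot> g i)"
      using that chain_mapD(4)[OF g, of i] by (simp add: arr)
    also have "\<dots> = Zero C (Ob X i) (Cod C u)"
      using that by (subst reassoc[OF that(4)]) (simp_all add: arr)
    finally show ?thesis .
  qed
  {
    fix u assume u: "u \<in> Arr C" "Dom C u = Ob Y (n + 1)" "u \<cdot> Diff Y n = Zero C (Ob Y n) (Cod C u)"
    have 1: "u \<cdot> g (Suc n) = Zero C (Ob X (n + 1)) (Cod C (u \<cdot> g (Suc n)))"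
      by (rule n_cokernelD(2)[OF X]) (use u du[of n u] in \<open>simp_all add: arr\<close>)
    have "u \<cdot> (g (Suc n) \<cdot> f (Suc n)) = Zero C (Ob Y (n + 1)) (Cod C u)"
      using u 1 by (subst reassoc[OF 1]) (simp_all add: arr)
    moreover have "u \<cdot> (g (Suc n) \<cdot> f (Suc n)) = u"
      using u h h0 by (simp add: arr reassoc[OF u(3)])
    ultimately show "u = Zero C (Ob Y (n + 1)) (Cod C u)" by simp
  next
    fix i u assume i: "i < n" and u: "u \<in> Arr C" "Dom C u = Ob Y (Suc i)"
      "u \<cdot> Diff Y i = Zero C (Ob Y i) (Cod C u)"
    have "\<exists>v \<in> Arr C. Dom C v = Ob X (Suc (Suc i)) \<and> Cod C v = Cod C (u \<cdot> g (Suc i)) \<and> v \<cdot> Diff X (Suc i) = u \<cdot> g (Suc i)"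
      by (rule n_cokernelD(3)[OF X i]) (use i u du[of i u] in \<open>simp_all add: arr\<close>)
    then obtain v where v: "v \<in> Arr C" "Dom C v = Ob X (Suc (Suc i))" "Cod C v = Cod C u"
      "v \<cdot> Diff X (Suc i) = u \<cdot> g (Suc i)"
      using i u by (auto simp: arr)
    have "(v \<cdot> f (Suc (Suc i))) \<cdot> Diff Y (Suc i) = v \<cdot> (Diff X (Suc i) \<cdot> f (Suc i))"
      using chain_mapD(4)[OF f, of "Suc i"] i v by (simp add: arr)
    also have "\<dots> = u \<cdot> (g (Suc i) \<cdot> f (Suc i))"
      using i u v(1-3) by (subst reassoc[OF v(4)]) (simp_all add: arr)
    also have "\<dots> = u \<boxplus> u \<cdot> (h (Suc (Suc i)) \<cdot> Diff Y (Suc i))"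
      using i u h by (subst hi[OF i]) (simp add: arr reassoc[OF u(3)])
    finally have *: "(v \<cdot> f (Suc (Suc i))) \<cdot> Diff Y (Suc i) = u \<boxplus> u \<cdot> (h (Suc (Suc i)) \<cdot> Diff Y (Suc i))" .
    have "(v \<cdot> f (Suc (Suc i)) \<boxplus> neg C (u \<cdot> h (Suc (Suc i)))) \<cdot> Diff Y (Suc i) =
      (v \<cdot> f (Suc (Suc i))) \<cdot> Diff Y (Suc i) \<boxplus> neg C (u \<cdot> (h (Suc (Suc i)) \<cdot> Diff Y (Suc i)))"
      using i u h v(1-3) by (simp add: arr)
    also have "\<dots> = u" using i u h by (subst *) (simp add: arr)
    finally show "\<exists>v \<in> Arr C. Dom C v = Ob Y (Suc (Suc i)) \<and> Cod C v = Cod C u \<and> v \<cdot> Diff Y (Suc i) = u"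
      using i u h v(1-3) by (intro bexI[of _ "v \<cdot> f (Suc (Suc i)) \<boxplus> neg C (u \<cdot> h (Suc (Suc i)))"]) (simp_all add: arr)
  }
qed

end

section \<open>Extending a pushout to an \<open>n\<close>-exact sequence\<close>

text \<open>The complex \<open>K\<close> plays the role of the mapping cone of \<open>\<phi> : X \<rightarrow> Y\<close>, with \<open>q\<close> and \<open>p\<close> the
  projections to the shifted \<open>X\<close> and to \<open>Y\<close>, and \<open>e\<close>, \<open>j\<close> sections of them. Keeping it abstract
  leaves the signs free, so that the cone of a pullback square, which differs from the cone of the
  pushout square in the opposite category by signs and by the choice of biproducts, is covered too.\<close>

locale pushout_cone = additive_category C
  for C :: "('o, 'm) precat" (structure) +
  fixes n :: nat and X Y K :: "('o, 'm) cochain" and \<phi> q p e :: "nat \<Rightarrow> 'm" and j :: 'm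
  assumes n_pos: "0 < n"
    and X: "n_cokernel C n X" and Y: "is_complex C n Y" and K: "n_cokernel C n K"
    and \<phi>: "chain_map C n X Y \<phi>"
    and q: "\<And>k. k \<le> n \<Longrightarrow> q k \<in> Arr C" "\<And>k. k \<le> n \<Longrightarrow> Dom C (q k) = Ob K k"
      "\<And>k. k \<le> n \<Longrightarrow> Cod C (q k) = Ob X k"
    and p: "\<And>k. k \<le> n \<Longrightarrow> p k \<in> Arr C" "\<And>k. k \<le> n \<Longrightarrow> Dom C (p k) = Ob K (Suc k)"
      "\<And>k. k \<le> n \<Longrightarrow> Cod C (p k) = Ob Y k"
    and e: "\<And>k. k \<le> n \<Longrightarrow> e k \<in> Arr C" "\<And>k. k \<le> n \<Longrightarrow> Dom C (e k) = Ob Y k"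
      "\<And>k. k \<le> n \<Longrightarrow> Cod C (e k) = Ob K (Suc k)"
    and j: "j \<in> Arr C" "Dom C j = Ob X n" "Cod C j = Ob K n"
    and q_dK: "\<And>k. k < n \<Longrightarrow> q (Suc k) \<cdot> Diff K k = neg C (Diff X k \<cdot> q k)"
    and p_dK0: "p 0 \<cdot> Diff K 0 = \<phi> 0 \<cdot> q 0"
    and p_dK: "\<And>k. k < n \<Longrightarrow> p (Suc k) \<cdot> Diff K (Suc k) = \<phi> (Suc k) \<cdot> q (Suc k) \<boxplus> Diff Y k \<cdot> p k"
    and dK_e: "\<And>k. k < n \<Longrightarrow> Diff K (Suc k) \<cdot> e k = e (Suc k) \<cdot> Diff Y k"
    and q_e: "\<And>k. k < n \<Longrightarrow> q (Suc k) \<cdot> e k = Zero C (Ob Y k) (Ob X (Suc k))"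
    and p_e: "\<And>k. k \<le> n \<Longrightarrow> p k \<cdot> e k = Idn C (Ob Y k)"
    and e_p: "e n \<cdot> p n = Idn C (Ob K (Suc n))"
    and q_j: "q n \<cdot> j = Idn C (Ob X n)"
    and dK_j: "Diff K n \<cdot> j = e n \<cdot> \<phi> n"
begin

lemmas pc_simps = is_complexD[OF n_cokernelD(1)[OF X]] is_complexD[OF Y]
  is_complexD[OF n_cokernelD(1)[OF K]] chain_mapD[OF \<phi>] q p e j p_e e_p

text \<open>The morphism from \<open>K n\<close> obtained by projecting to \<open>X n\<close> and
  applying \<open>Diff X n\<close> kills the preceding differential of \<open>K\<close>, so it
  factors through \<open>Diff K n\<close>. The restriction of the factor along \<open>e n\<close> is
  \<open>d\<close>; its two equations result from \<open>dK_j\<close> and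
  \<open>dK_e\<close>.\<close>

lemma extension:
  obtains d where "d \<in> Arr C" "Dom C d = Ob Y n" "Cod C d = Ob X (Suc n)" "d \<cdot> \<phi> n = Diff X n"
    "d \<cdot> Diff Y (n - 1) = Zero C (Ob Y (n - 1)) (Ob X (Suc n))"
proof -
  note [simp] = pc_simps
  obtain m where m: "n = Suc m" using n_pos by (cases n) auto
  have "(Diff X n \<cdot> q n) \<cdot> Diff K m = Zero C (Ob K m) (Cod C (Diff X n \<cdot> q n))"
    using m q_dK[of m] by (simp add: arr reassoc[OF is_complexD(5)[OF n_cokernelD(1)[OF X]]])
  with n_cokernelD(3)[OF K, of m "Diff X n \<cdot> q n"] m
  obtain v where v: "v \<in> Arr C" "Dom C v = Ob K (Suc n)" "Cod C v = Ob X (Suc n)"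
    "v \<cdot> Diff K n = Diff X n \<cdot> q n"
    by (auto simp: arr)
  show ?thesis
  proof (rule that[of "v \<cdot> e n"])
    have "(v \<cdot> e n) \<cdot> \<phi> n = v \<cdot> (Diff K n \<cdot> j)" using v dK_j by (simp add: arr)
    also have "\<dots> = Diff X n" using v q_j by (simp add: arr reassoc[OF v(4)])
    finally show "(v \<cdot> e n) \<cdot> \<phi> n = Diff X n" .
    have "(v \<cdot> e n) \<cdot> Diff Y m = v \<cdot> (Diff K n \<cdot> e m)" using v dK_e[of m] m by (simp add: arr)
    also have "\<dots> = Zero C (Ob Y m) (Ob X (Suc n))" using m v(1-3) q_e[of m] by (simp add: arr reassoc[OF v(4)[unfolded m]])
    finally show "(v \<cdot> e n) \<cdot> Diff Y (n - 1) = Zero C (Ob Y (n - 1)) (Ob X (Suc n))" using m by simp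
  qed (use v in \<open>simp_all add: arr\<close>)
qed

text \<open>The completed pushout: the missing last term is that of \<open>X\<close>, so that the
  chain map from \<open>X\<close> can be the identity there.\<close>

definition ext_Y :: "'m \<Rightarrow> ('o, 'm) cochain" where
  "ext_Y d = \<lparr>Ob = (Ob Y)(Suc n := Ob X (Suc n)), Diff = (Diff Y)(n := d)\<rparr>"

lemma ext_Y_sel:
  "Ob (ext_Y d) (Suc n) = Ob X (Suc n)" "i \<le> n \<Longrightarrow> Ob (ext_Y d) i = Ob Y i"
  "Diff (ext_Y d) n = d" "i < n \<Longrightarrow> Diff (ext_Y d) i = Diff Y i"
  by (simp_all add: ext_Y_def)

context
  fixes d
  assumes d: "d \<in> Arr C" "Dom C d = Ob Y n" "Cod C d = Ob X (Suc n)" "d \<cdot> \<phi> n = Diff X n"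
      "d \<cdot> Diff Y (n - 1) = Zero C (Ob Y (n - 1)) (Ob X (Suc n))"
begin

text \<open>By \<open>p_dK\<close> the composite splits into a part through \<open>\<phi> n\<close>,
  where \<open>d\<close> gives \<open>Diff X n\<close>, and a part through the last differential of
  \<open>Y\<close>, which \<open>d\<close> kills. This is what allows equations on
  \<open>Y n\<close> to be tested after \<open>Diff K n\<close>.\<close>

lemma d_p_dK: "d \<cdot> (p n \<cdot> Diff K n) = Diff X n \<cdot> q n"
proof -
  note [simp] = pc_simps d(1-3)
  obtain m where m: "n = Suc m" using n_pos by (cases n) auto
  have 1: "p n \<cdot> Diff K n = \<phi> n \<cdot> q n \<boxplus> Diff Y m \<cdot> p m"
    using p_dK[of m] m by simp
  have 2: "d \<cdot> (\<phi> n \<cdot> q n \<boxplus> Diff Y m \<cdot> p m) = d \<cdot> (\<phi> n \<cdot> q n) \<boxplus> d \<cdot> (Diff Y m \<cdot> p m)"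
    using m by (intro comp_plus) (simp_all add: arr)
  have 3: "d \<cdot> (\<phi> n \<cdot> q n) = Diff X n \<cdot> q n"
    by (rule reassoc[OF d(4)]) simp_all
  have "d \<cdot> (Diff Y m \<cdot> p m) = Zero C (Ob Y (n - 1)) (Ob X (Suc n)) \<cdot> p m"
    by (rule reassoc) (use m d(5) in simp_all)
  also have "\<dots> = Zero C (Ob K n) (Ob X (Suc n))"
    using m by (simp add: arr)
  finally have 4: "d \<cdot> (Diff Y m \<cdot> p m) = Zero C (Ob K n) (Ob X (Suc n))" .
  show ?thesis unfolding 1 2 3 4 by (rule plus_zero) (simp_all add: arr)
qed

text \<open>Chain maps \<open>Y \<rightarrow> T\<close> are read off from solutions \<open>b k : K (k + 1) \<rightarrow> T k\<close> of the recursion;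
  their restriction to the summand of \<open>X\<close> is a homotopy from the composite with \<open>\<phi>\<close> to \<open>\<psi>\<close>.\<close>

lemma universal:
  assumes T: "is_complex C (n + 1) T" and \<psi>: "chain_map C (n + 1) X T \<psi>" and "\<psi> 0 = \<phi> 0"
  obtains \<chi> where "chain_map C n Y T \<chi>" "\<chi> 0 = Idn C (Ob Y 0)" "\<psi> (Suc n) \<cdot> d = Diff T n \<cdot> \<chi> n"
proof -
  note [simp] = pc_simps is_complexD[OF T] chain_mapD[OF \<psi>] d(1-3)
  have T': "is_complex C n T" by (rule is_complex_le[OF T]) simp
  have T0: "Ob T 0 = Ob Y 0"
    using \<open>\<psi> 0 = \<phi> 0\<close> chain_mapD(3)[OF \<psi>, of 0] chain_mapD(3)[OF \<phi>, of 0] by simp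
  have pq: "Diff T (Suc k) \<cdot> (\<psi> (Suc k) \<cdot> x) = \<psi> (Suc (Suc k)) \<cdot> (Diff X (Suc k) \<cdot> x)"
    if "Suc k \<le> n" "x \<in> Arr C" "Cod C x = Ob X (Suc k)" for k x
    using that by (simp flip: comp_assoc)
  obtain b where b0: "b 0 = p 0" and b: "\<And>k. k \<le> n \<Longrightarrow> b k \<in> Arr C"
    "\<And>k. k \<le> n \<Longrightarrow> Dom C (b k) = Ob K (Suc k)" "\<And>k. k \<le> n \<Longrightarrow> Cod C (b k) = Ob T k"
    and bd: "\<And>k. k < n \<Longrightarrow> b (Suc k) \<cdot> Diff K (Suc k) = \<psi> (Suc k) \<cdot> q (Suc k) \<boxplus> Diff T k \<cdot> b k"
  \<comment> \<open>Starting with \<open>p 0\<close> makes component 0 of the resulting map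
    \<open>p 0 \<cdot> e 0\<close>, an identity. The anti-commutation needed for \<open>a\<close> is
    the sign in \<open>q_dK\<close>.\<close>
  proof (rule n_cokernel_recursion[OF K T', of "\<lambda>k. \<psi> k \<cdot> q k" "p 0"])
    fix k assume k: "Suc k < n"
    show "(\<psi> (Suc (Suc k)) \<cdot> q (Suc (Suc k))) \<cdot> Diff K (Suc k) \<boxplus> Diff T (Suc k) \<cdot> (\<psi> (Suc k) \<cdot> q (Suc k)) =
      Zero C (Ob K (Suc k)) (Ob T (Suc (Suc k)))"
      using k by (simp add: arr q_dK pq)
  next
    have "(\<psi> 1 \<cdot> q 1 \<boxplus> Diff T 0 \<cdot> p 0) \<cdot> Diff K 0 =
        neg C (\<psi> (Suc 0) \<cdot> (Diff X 0 \<cdot> q 0)) \<boxplus> Diff T 0 \<cdot> (\<psi> 0 \<cdot> q 0)"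
      using n_pos T0 q_dK[of 0] p_dK0 \<open>\<psi> 0 = \<phi> 0\<close> by (simp add: arr)
    also have "\<psi> (Suc 0) \<cdot> (Diff X 0 \<cdot> q 0) = Diff T 0 \<cdot> (\<psi> 0 \<cdot> q 0)"
      using n_pos by (simp flip: comp_assoc)
    finally show "(\<psi> 1 \<cdot> q 1 \<boxplus> Diff T 0 \<cdot> p 0) \<cdot> Diff K 0 = Zero C (Ob K 0) (Ob T 1)"
      using n_pos by (simp add: arr)
  qed (use n_pos T0 in \<open>simp_all add: arr\<close>)
  have "chain_map C n Y T (\<lambda>k. b k \<cdot> e k)"
  proof (rule chain_mapI)
    fix i assume i: "i < n"
    have "(b (Suc i) \<cdot> e (Suc i)) \<cdot> Diff Y i = b (Suc i) \<cdot> (Diff K (Suc i) \<cdot> e i)"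
      using i b by (simp add: arr dK_e)
    also have "\<dots> = Diff T i \<cdot> (b i \<cdot> e i)"
      using i b by (subst reassoc[OF bd]) (simp_all add: arr q_e)
    finally show "(b (Suc i) \<cdot> e (Suc i)) \<cdot> Diff Y i = Diff T i \<cdot> (b i \<cdot> e i)" .
  qed (use b in \<open>simp_all add: arr\<close>)
  moreover have "\<psi> (Suc n) \<cdot> d = Diff T n \<cdot> (b n \<cdot> e n)"
  proof -
    obtain m where m: "n = Suc m" using n_pos by (cases n) auto
    \<comment> \<open>The last square is compared on \<open>K (Suc n)\<close> after cancelling
      \<open>Diff K n\<close>, then restricted along \<open>e n\<close>, which is inverse to
      \<open>p n\<close>.\<close>
    have "(\<psi> (Suc n) \<cdot> (d \<cdot> p n)) \<cdot> Diff K n = \<psi> (Suc n) \<cdot> (d \<cdot> (p n \<cdot> Diff K n))"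
      by (simp add: arr)
    also have "d \<cdot> (p n \<cdot> Diff K n) = Diff X n \<cdot> q n" by (rule d_p_dK)
    also have "\<psi> (Suc n) \<cdot> \<dots> = Diff T n \<cdot> (\<psi> n \<cdot> q n)"
      using pq[of m "q n"] m by simp
    also have "\<dots> = Diff T n \<cdot> (\<psi> n \<cdot> q n \<boxplus> Diff T m \<cdot> b m)"
      using m b(1-3)[of m] by (simp add: arr reassoc[OF is_complexD(5)[OF T]])
    also have "\<psi> n \<cdot> q n \<boxplus> Diff T m \<cdot> b m = b n \<cdot> Diff K n"
      using bd[of m] m by simp
    also have "Diff T n \<cdot> \<dots> = (Diff T n \<cdot> b n) \<cdot> Diff K n"
      using b(1-3)[of n] by (simp add: arr)
    finally have eq: "(\<psi> (Suc n) \<cdot> (d \<cdot> p n)) \<cdot> Diff K n = (Diff T n \<cdot> b n) \<cdot> Diff K n" .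
    have "\<psi> (Suc n) \<cdot> (d \<cdot> p n) = Diff T n \<cdot> b n"
      by (rule n_cokernel_epi[OF K _ _ _ _ _ eq]) (use b in \<open>simp_all add: arr\<close>)
    hence "(\<psi> (Suc n) \<cdot> (d \<cdot> p n)) \<cdot> e n = (Diff T n \<cdot> b n) \<cdot> e n" by simp
    thus ?thesis using b by (simp add: arr)
  qed
  ultimately show ?thesis
    using that[of "\<lambda>k. b k \<cdot> e k"] b0 by simp
qed

text \<open>A morphism \<open>u\<close> killing a differential of \<open>Y\<close> becomes, after
  \<open>\<phi>\<close>, one killing the differential of \<open>X\<close>, and extends there to
  \<open>w\<close>. In the top case \<open>w\<close> already extends \<open>u\<close> along
  \<open>d\<close>. Below it, \<open>w\<close> and \<open>u\<close> are glued on the cone, and the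
  extension is read off by restricting along \<open>e\<close>.\<close>

lemma n_cokernel_ext_Y: "n_cokernel C n (ext_Y d)"
proof (rule n_cokernelI)
  note [simp] = pc_simps d(1-3)
  show cx: "is_complex C (n + 1) (ext_Y d)"
  proof (rule is_complexI)
    fix i assume "Suc i < n + 1"
    thus "Diff (ext_Y d) (Suc i) \<cdot> Diff (ext_Y d) i = Zero C (Ob (ext_Y d) i) (Ob (ext_Y d) (Suc (Suc i)))"
      using d(5) by (cases "Suc i = n") (auto simp: ext_Y_sel)
  qed (auto simp: le_Suc_eq less_Suc_eq ext_Y_sel)
  show "u = Zero C (Ob (ext_Y d) (n + 1)) (Cod C u)"
    if u: "u \<in> Arr C" "Dom C u = Ob (ext_Y d) (n + 1)"
      "u \<cdot> Diff (ext_Y d) n = Zero C (Ob (ext_Y d) n) (Cod C u)" for u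
  proof -
    have u': "Dom C u = Ob X (Suc n)" "u \<cdot> d = Zero C (Ob Y n) (Cod C u)"
      using u by (simp_all add: ext_Y_sel)
    have "u \<cdot> Diff X n = (u \<cdot> d) \<cdot> \<phi> n" using u(1) u'(1) d(4) by (simp add: arr)
    also have "\<dots> = Zero C (Ob X n) (Cod C u)" using u by (subst u'(2)) (simp add: arr)
    finally show ?thesis using n_cokernelD(2)[OF X u(1)] u' by (simp add: ext_Y_sel)
  qed
  show "\<exists>v\<in>Arr C. Dom C v = Ob (ext_Y d) (Suc (Suc i)) \<and> Cod C v = Cod C u \<and> v \<cdot> Diff (ext_Y d) (Suc i) = u"
    if i: "i < n" and u: "u \<in> Arr C" "Dom C u = Ob (ext_Y d) (Suc i)"
      "u \<cdot> Diff (ext_Y d) i = Zero C (Ob (ext_Y d) i) (Cod C u)" for i u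
  proof -
    have u': "Dom C u = Ob Y (Suc i)" "u \<cdot> Diff Y i = Zero C (Ob Y i) (Cod C u)"
      using i u by (simp_all add: ext_Y_sel)
    have "(u \<cdot> \<phi> (Suc i)) \<cdot> Diff X i = Zero C (Ob X i) (Cod C (u \<cdot> \<phi> (Suc i)))"
      using i u u' by (simp add: arr reassoc[OF u'(2)])
    from n_cokernelD(3)[OF X i _ _ this] i u u'
    obtain w where w: "w \<in> Arr C" "Dom C w = Ob X (Suc (Suc i))" "Cod C w = Cod C u"
      "w \<cdot> Diff X (Suc i) = u \<cdot> \<phi> (Suc i)"
      by (auto simp: arr)
    show ?thesis
    proof (cases "Suc i = n")
      case True
      note t = True[symmetric]
      \<comment> \<open>Both \<open>u \<cdot> p n\<close> and
        \<open>w \<cdot> (d \<cdot> p n)\<close> are evaluated on \<open>Diff K n\<close>; they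
        agree since \<open>w\<close> extends \<open>u \<cdot> \<phi> n\<close>.\<close>
      have 1: "u \<cdot> (p n \<cdot> Diff K n) = (u \<cdot> \<phi> n) \<cdot> q n"
        using u u' p_dK[OF i] by (simp add: t arr reassoc[OF u'(2)])
      have 2: "w \<cdot> (d \<cdot> (p n \<cdot> Diff K n)) = (w \<cdot> Diff X n) \<cdot> q n"
        unfolding d_p_dK using w(1-3) t by (simp add: arr)
      have "(u \<cdot> p n) \<cdot> Diff K n = (w \<cdot> (d \<cdot> p n)) \<cdot> Diff K n"
        using 1 2 u u' w t by (simp add: arr)
      hence "u \<cdot> p n = w \<cdot> (d \<cdot> p n)"
        by (rule n_cokernel_epi[OF K, rotated -1]) (use u u' w t in \<open>simp_all add: arr\<close>)
      hence "(u \<cdot> p n) \<cdot> e n = (w \<cdot> (d \<cdot> p n)) \<cdot> e n" by simp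
      moreover have "Dom C u = Ob Y n" "Dom C w = Ob X (Suc n)" using u'(1) w(2) True by simp_all
      ultimately have "w \<cdot> d = u" using u(1) w(1,3) by (simp add: arr)
      thus ?thesis using w(1-3) True by (intro bexI[of _ w]) (simp_all add: ext_Y_sel)
    next
      case False
      hence i': "Suc i < n" using i by simp
      \<comment> \<open>The sign in \<open>q_dK\<close> makes the contributions of \<open>w\<close>
        and \<open>u\<close> cancel on \<open>Diff K (Suc i)\<close>, so \<open>?t\<close> extends
        one step further.\<close>
      let ?t = "w \<cdot> q (Suc (Suc i)) \<boxplus> u \<cdot> p (Suc i)"
      have t: "?t \<in> Arr C" "Dom C ?t = Ob K (Suc (Suc i))" "Cod C ?t = Cod C u"
        using u u' w i' by (simp_all add: arr)
      have "?t \<cdot> Diff K (Suc i) = neg C ((w \<cdot> Diff X (Suc i)) \<cdot> q (Suc i)) \<boxplus> (u \<cdot> \<phi> (Suc i)) \<cdot> q (Suc i)"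
        using u u' w(1-3) i' p_dK[OF i] q_dK[OF i'] by (simp add: arr reassoc[OF u'(2)])
      hence "?t \<cdot> Diff K (Suc i) = Zero C (Ob K (Suc i)) (Cod C ?t)"
        using u u' w i' by (simp add: arr)
      from n_cokernelD(3)[OF K i' t(1,2) this] obtain s where s: "s \<in> Arr C"
        "Dom C s = Ob K (Suc (Suc (Suc i)))" "Cod C s = Cod C u" "s \<cdot> Diff K (Suc (Suc i)) = ?t"
        using t by auto
      have "(s \<cdot> e (Suc (Suc i))) \<cdot> Diff Y (Suc i) = s \<cdot> (Diff K (Suc (Suc i)) \<cdot> e (Suc i))"
        using s i' dK_e[OF i'] by (simp add: arr)
      also have "\<dots> = ?t \<cdot> e (Suc i)" using s i' t by (simp add: reassoc[OF s(4)])
      also have "\<dots> = u" using u(1) u'(1) w(1-3) i' q_e[OF i'] by (simp add: arr)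
      finally show ?thesis using s i' by (intro bexI[of _ "s \<cdot> e (Suc (Suc i))"]) (simp_all add: arr ext_Y_sel)
    qed
  qed
qed

end

text \<open>Both \<open>ext_Y d\<close> and \<open>W\<close> are \<open>n\<close>-cokernels of the same morphism, hence homotopy equivalent; this
  transfers the \<open>n\<close>-kernel property from \<open>W\<close>.\<close>

theorem pushout_sequence:
  assumes W: "n_exact_sequence C n W" and W0: "Diff W 0 = Diff Y 0"
  obtains E \<epsilon> \<omega> where "weak_iso C n W E \<omega>" "\<And>i. i \<le> n \<Longrightarrow> Ob E i = Ob Y i" "Ob E (Suc n) = Ob X (Suc n)"
    "\<And>i. i < n \<Longrightarrow> Diff E i = Diff Y i" "chain_map C (n + 1) X E \<epsilon>"
    "\<And>i. i \<le> n \<Longrightarrow> \<epsilon> i = \<phi> i" "\<epsilon> (n + 1) = Idn C (Ob X (n + 1))"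
    "\<And>T \<psi>. \<lbrakk>is_complex C (n + 1) T; chain_map C (n + 1) X T \<psi>; \<psi> 0 = \<phi> 0\<rbrakk> \<Longrightarrow>
      \<exists>\<chi>. chain_map C (n + 1) E T \<chi> \<and> \<chi> 0 = Idn C (Ob E 0) \<and> \<chi> (n + 1) = \<psi> (n + 1)"
proof -
  note [simp] = pc_simps
  obtain d where d: "d \<in> Arr C" "Dom C d = Ob Y n" "Cod C d = Ob X (Suc n)" "d \<cdot> \<phi> n = Diff X n"
    "d \<cdot> Diff Y (n - 1) = Zero C (Ob Y (n - 1)) (Ob X (Suc n))"
    using extension by blast
  let ?E = "ext_Y d"
  have co: "n_cokernel C n ?E" by (rule n_cokernel_ext_Y[OF d])
  note cx = n_cokernelD(1)[OF co]
  have Wk: "n_kernel C n W" and Wc: "n_cokernel C n W" using W by (auto simp: n_exact_sequence_def)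
  note Wx = n_kernelD(1)[OF Wk]
  have W01: "Ob W 0 = Ob Y 0" "Ob W 1 = Ob Y 1"
    using W0 n_pos is_complexD(3,4)[OF Wx, of 0] is_complexD(3,4)[OF Y, of 0] by auto
  obtain f where f: "chain_map C (n + 1) W ?E f" "f 0 = Idn C (Ob Y 0)" "f 1 = Idn C (Ob Y 1)"
    by (rule comparison[OF Wc cx, of "Idn C (Ob Y 0)" "Idn C (Ob Y 1)"])
      (use n_pos W0 W01 in \<open>simp_all add: arr ext_Y_sel\<close>)
  obtain g where g: "chain_map C (n + 1) ?E W g" "g 0 = Idn C (Ob Y 0)" "g 1 = Idn C (Ob Y 1)"
    by (rule comparison[OF co Wx, of "Idn C (Ob Y 0)" "Idn C (Ob Y 1)"])
      (use n_pos W0 W01 in \<open>simp_all add: arr ext_Y_sel\<close>)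
  have "homotopic C (n + 1) ?E ?E (\<lambda>i. f i \<cdot> g i) (\<lambda>i. Idn C (Ob ?E i))"
    by (rule homotopic_if_eq_0[OF co cx chain_map_comp[OF g(1) f(1) cx Wx cx] chain_map_Idn[OF cx]])
      (use f g n_pos in \<open>simp_all add: arr ext_Y_sel\<close>)
  hence "n_kernel C n ?E" by (rule n_kernel_retract[OF Wk cx g(1) f(1)])
  hence ex: "n_exact_sequence C n ?E" using co cx by (simp add: n_exact_sequence_def)
  \<comment> \<open>Components 0 and 1 of the comparison map are identities, an adjacent pair of
    isomorphisms.\<close>
  have iso: "weak_iso C n W ?E f"
    unfolding weak_iso_def using W ex f n_pos
    by (auto intro!: exI[of _ 0] is_iso_Idn)
  have X_E: "chain_map C (n + 1) X ?E (\<phi>(Suc n := Idn C (Ob X (Suc n))))"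
  proof (rule chain_mapI)
    fix i assume i: "i < n + 1"
    show "(\<phi>(Suc n := Idn C (Ob X (Suc n)))) (Suc i) \<cdot> Diff X i = Diff ?E i \<cdot> (\<phi>(Suc n := Idn C (Ob X (Suc n)))) i"
      using i d by (cases "i = n") (simp_all add: arr ext_Y_sel)
  qed (auto simp: le_Suc_eq ext_Y_sel arr)
  have uni: "\<exists>\<chi>. chain_map C (n + 1) ?E T \<chi> \<and> \<chi> 0 = Idn C (Ob ?E 0) \<and> \<chi> (n + 1) = \<psi> (n + 1)"
    if T: "is_complex C (n + 1) T" "chain_map C (n + 1) X T \<psi>" "\<psi> 0 = \<phi> 0" for T \<psi>
  proof -
    obtain \<chi> where \<chi>: "chain_map C n Y T \<chi>" "\<chi> 0 = Idn C (Ob Y 0)" "\<psi> (Suc n) \<cdot> d = Diff T n \<cdot> \<chi> n"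
      using universal[OF d T] by blast
    have "chain_map C (n + 1) ?E T (\<chi>(Suc n := \<psi> (Suc n)))"
    proof (rule chain_mapI)
      fix i assume i: "i < n + 1"
      show "(\<chi>(Suc n := \<psi> (Suc n))) (Suc i) \<cdot> Diff ?E i = Diff T i \<cdot> (\<chi>(Suc n := \<psi> (Suc n))) i"
        using i \<chi> chain_mapD[OF \<chi>(1)] by (cases "i = n") (simp_all add: arr ext_Y_sel)
    qed (auto simp: le_Suc_eq ext_Y_sel chain_mapD[OF \<chi>(1)] chain_mapD[OF T(2)])
    thus ?thesis using \<chi> by (intro exI[of _ "\<chi>(Suc n := \<psi> (Suc n))"]) (simp add: ext_Y_sel)
  qed
  show ?thesis
    by (rule that[OF iso _ _ _ X_E]) (use uni in \<open>simp_all add: ext_Y_sel\<close>)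
qed

end

section \<open>Mapping cones as abstract cones\<close>

context additive_category
begin

lemma row_in [arr]:
  assumes "f \<in> Arr C" "g \<in> Arr C" "Cod C f = Cod C g" "Dom C f = A" "Dom C g = B"
  shows "row C f g \<cdot> in1 (biprod C A B) = f" "row C f g \<cdot> in2 (biprod C A B) = g"
  using assms by (auto simp: row_def arr)

lemma pr_col [arr]:
  assumes "f \<in> Arr C" "g \<in> Arr C" "Dom C f = Dom C g" "Cod C f = A" "Cod C g = B"
  shows "pr1 (biprod C A B) \<cdot> col C f g = f" "pr2 (biprod C A B) \<cdot> col C f g = g"
  using assms by (auto simp: col_def arr)

lemma row_in_comp [arr]:
  assumes "f \<in> Arr C" "g \<in> Arr C" "Cod C f = Cod C g" "Dom C f = A" "Dom C g = B" "h \<in> Arr C"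
  shows "Cod C h = A \<Longrightarrow> row C f g \<cdot> (in1 (biprod C A B) \<cdot> h) = f \<cdot> h"
    "Cod C h = B \<Longrightarrow> row C f g \<cdot> (in2 (biprod C A B) \<cdot> h) = g \<cdot> h"
  using assms by (auto simp: arr simp flip: comp_assoc)

lemma biprod_eqI:
  assumes "f \<in> Arr C" "g \<in> Arr C" "A \<in> Obj C" "B \<in> Obj C"
    "Dom C f = bobj (biprod C A B)" "Dom C g = bobj (biprod C A B)" "Cod C f = Cod C g"
    "f \<cdot> in1 (biprod C A B) = g \<cdot> in1 (biprod C A B)" "f \<cdot> in2 (biprod C A B) = g \<cdot> in2 (biprod C A B)"
  shows "f = g"
proof -
  have *: "h = (h \<cdot> in1 (biprod C A B)) \<cdot> pr1 (biprod C A B) \<boxplus> (h \<cdot> in2 (biprod C A B)) \<cdot> pr2 (biprod C A B)"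
    if "h \<in> Arr C" "Dom C h = bobj (biprod C A B)" for h
  proof -
    have "h = h \<cdot> (in1 (biprod C A B) \<cdot> pr1 (biprod C A B) \<boxplus> in2 (biprod C A B) \<cdot> pr2 (biprod C A B))"
      using assms(3,4) that biprod_arr(18) by (simp add: arr)
    also have "\<dots> = (h \<cdot> in1 (biprod C A B)) \<cdot> pr1 (biprod C A B) \<boxplus> (h \<cdot> in2 (biprod C A B)) \<cdot> pr2 (biprod C A B)"
      using assms(3,4) that by (subst comp_plus) (simp_all add: arr del: biprod_arr(18))
    finally show ?thesis .
  qed
  show ?thesis using *[of f] *[of g] assms by simp
qed

lemma mat22_arr [arr]:
  assumes "a \<in> Arr C" "b \<in> Arr C" "c \<in> Arr C" "d \<in> Arr C"
    "Dom C a = Dom C c" "Dom C b = Dom C d" "Cod C a = Cod C b" "Cod C c = Cod C d"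
  shows "mat22 C a b c d \<in> Arr C" "Dom C (mat22 C a b c d) = bobj (biprod C (Dom C c) (Dom C d))"
    "Cod C (mat22 C a b c d) = bobj (biprod C (Cod C b) (Cod C d))"
  using assms by (simp_all add: mat22_def arr)

lemma mat22_in [arr]:
  assumes "a \<in> Arr C" "b \<in> Arr C" "c \<in> Arr C" "d \<in> Arr C"
    "Dom C a = Dom C c" "Dom C b = Dom C d" "Cod C a = Cod C b" "Cod C c = Cod C d"
    "Dom C c = A" "Dom C d = B"
  shows "mat22 C a b c d \<cdot> in1 (biprod C A B) = in1 (biprod C (Cod C b) (Cod C d)) \<cdot> a \<boxplus> in2 (biprod C (Cod C b) (Cod C d)) \<cdot> c"
    "mat22 C a b c d \<cdot> in2 (biprod C A B) = in1 (biprod C (Cod C b) (Cod C d)) \<cdot> b \<boxplus> in2 (biprod C (Cod C b) (Cod C d)) \<cdot> d"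
proof -
  have "A \<in> Obj C" "B \<in> Obj C" using assms Dom_Obj by auto
  thus "mat22 C a b c d \<cdot> in1 (biprod C A B) = in1 (biprod C (Cod C b) (Cod C d)) \<cdot> a \<boxplus> in2 (biprod C (Cod C b) (Cod C d)) \<cdot> c"
    "mat22 C a b c d \<cdot> in2 (biprod C A B) = in1 (biprod C (Cod C b) (Cod C d)) \<cdot> b \<boxplus> in2 (biprod C (Cod C b) (Cod C d)) \<cdot> d"
    using assms by (simp_all add: mat22_def col_def[of _ "row C a b"] arr)
qed

lemma pr_mat22 [arr]:
  assumes "a \<in> Arr C" "b \<in> Arr C" "c \<in> Arr C" "d \<in> Arr C"
    "Dom C a = Dom C c" "Dom C b = Dom C d" "Cod C a = Cod C b" "Cod C c = Cod C d"
    "Cod C b = A" "Cod C d = B"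
  shows "pr1 (biprod C A B) \<cdot> mat22 C a b c d = a \<cdot> pr1 (biprod C (Dom C c) (Dom C d)) \<boxplus> b \<cdot> pr2 (biprod C (Dom C c) (Dom C d))"
    "pr2 (biprod C A B) \<cdot> mat22 C a b c d = c \<cdot> pr1 (biprod C (Dom C c) (Dom C d)) \<boxplus> d \<cdot> pr2 (biprod C (Dom C c) (Dom C d))"
  using assms by (simp_all add: mat22_def arr) (simp_all add: row_def)

lemma mapping_cone_sel:
  "Ob (mapping_cone C n X Y f) 0 = Ob X 0"
  "k < n \<Longrightarrow> Ob (mapping_cone C n X Y f) (Suc k) = bobj (biprod C (Ob X (Suc k)) (Ob Y k))"
  "Ob (mapping_cone C n X Y f) (Suc n) = Ob Y n"
  "Diff (mapping_cone C n X Y f) 0 = col C (neg C (Diff X 0)) (f 0)"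
  "Suc k < n \<Longrightarrow> Diff (mapping_cone C n X Y f) (Suc k) =
     mat22 C (neg C (Diff X (Suc k))) (Zero C (Ob Y k) (Ob X (Suc (Suc k)))) (f (Suc k)) (Diff Y k)"
  "0 < n \<Longrightarrow> Diff (mapping_cone C n X Y f) n = row C (f n) (Diff Y (n - 1))"
  by (simp_all add: mapping_cone_def)

text \<open>An equality of records holds because the cone reads its arguments only in degrees 0 to
  n, even at indices beyond its own range. It identifies the cone of a truncated pushout with that
  of its completion.\<close>

lemma mapping_cone_cong:
  assumes "0 < n" "\<And>i. i \<le> n \<Longrightarrow> Ob X i = Ob X' i" "\<And>i. i < n \<Longrightarrow> Diff X i = Diff X' i"
    "\<And>i. i \<le> n \<Longrightarrow> Ob Y i = Ob Y' i" "\<And>i. i < n \<Longrightarrow> Diff Y i = Diff Y' i"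
    "\<And>i. i \<le> n \<Longrightarrow> f i = f' i"
  shows "mapping_cone C n X Y f = mapping_cone C n X' Y' f'"
  using assms unfolding mapping_cone_def by (auto simp: fun_eq_iff)

text \<open>At its ends the cone has a single summand: \<open>Ob X 0\<close> in degree 0 and
  \<open>Ob Y n\<close> in degree n + 1. There the projections and sections are identities instead
  of biproduct morphisms.\<close>

lemma pushout_cone_mapping_cone:
  assumes n: "0 < n" and X: "n_cokernel C n X" and po: "n_pushout C n X f0 Y \<phi>"
  shows "pushout_cone C n X Y (mapping_cone C n X Y \<phi>) \<phi>
    (\<lambda>k. if k = 0 then Idn C (Ob X 0) else pr1 (biprod C (Ob X k) (Ob Y (k - 1))))
    (\<lambda>k. if k < n then pr2 (biprod C (Ob X (Suc k)) (Ob Y k)) else Idn C (Ob Y n))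
    (\<lambda>k. if k < n then in2 (biprod C (Ob X (Suc k)) (Ob Y k)) else Idn C (Ob Y n))
    (in1 (biprod C (Ob X n) (Ob Y (n - 1))))"
proof -
  have Y: "is_complex C n Y" and \<phi>: "chain_map C n X Y \<phi>" and K: "n_cokernel C n (mapping_cone C n X Y \<phi>)"
    using po by (auto simp: n_pushout_def)
  note [simp] = is_complexD[OF n_cokernelD(1)[OF X]] is_complexD[OF Y] chain_mapD[OF \<phi>] mapping_cone_sel
  obtain m where m: "Suc m = n" using n by (cases n) auto
  have m': "m < n" "n - 1 = m" "n - Suc 0 = m" using m by auto
  have last: "Suc k = n \<Longrightarrow> k = m" for k using m by simp
  have Obn: "Ob (mapping_cone C n X Y \<phi>) n = bobj (biprod C (Ob X n) (Ob Y m))"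
    using m m' mapping_cone_sel(2)[of m n] by simp
  note [simp] = Obn
  show ?thesis
  proof (intro pushout_cone.intro additive_category_axioms pushout_cone_axioms.intro n X Y K \<phi>, goal_cases)
    case (1 k) thus ?case by (cases k) (auto simp: arr)
  next
    case (2 k) thus ?case by (cases k) (auto simp: arr)
  next
    case (3 k) thus ?case by (cases k) (auto simp: arr)
  next
    case (4 k) thus ?case by (auto simp: arr)
  next
    case (5 k) thus ?case by (cases "k = n") (auto simp: arr)
  next
    case (6 k) thus ?case by (cases "k = n") (auto simp: arr)
  next
    case (7 k) thus ?case by (auto simp: arr)
  next
    case (8 k) thus ?case by (cases "k = n") (auto simp: arr)
  next
    case (9 k) thus ?case by (cases "k = n") (auto simp: arr)
  next
    case 10 thus ?case using m' by (simp add: arr)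
  next
    case 11 thus ?case using m' by (simp add: arr)
  next
    case 12 thus ?case using m' by (simp add: arr)
  next
    case (13 k)
    show ?case
    proof (cases k)
      case 0
      thus ?thesis using n by (simp add: arr)
    next
      case (Suc i)
      thus ?thesis using 13 by (simp add: arr)
    qed
  next
    case 14 thus ?case using n by (simp add: arr)
  next
    case (15 k)
    show ?case
    proof (cases "Suc k = n")
      case True
      thus ?thesis using m' by (auto simp: arr row_def m)
    next
      case False
      thus ?thesis using 15 by (simp add: arr)
    qed
  next
    case (16 k)
    show ?case
    proof (cases "Suc k = n")
      case True
      thus ?thesis using m' by (auto simp: arr m)
    next
      case False
      thus ?thesis using 16 by (simp add: arr)
    qed
  next
    case (17 k) thus ?case by (simp add: arr)
  next
    case (18 k) thus ?case by (cases "k = n") (auto simp: arr)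
  next
    case 19 thus ?case by (simp add: arr)
  next
    case 20 thus ?case using m' n by (simp add: arr)
  next
    case 21 thus ?case using m' m n by (simp add: arr)
  qed
qed

lemma n_kernel_cneg:
  assumes K: "n_kernel C n K"
  shows "n_kernel C n (cneg C K)"
proof (rule n_kernelI)
  note [simp] = is_complexD[OF n_kernelD(1)[OF K]]
  have *: "Diff K i \<cdot> u = Zero C (Dom C u) (Ob K (Suc i))"
    if "i \<le> n" "u \<in> Arr C" "Cod C u = Ob K i" "neg C (Diff K i) \<cdot> u = Zero C (Dom C u) (Ob K (Suc i))" for i u
  proof -
    have "Diff K i \<cdot> u = neg C (neg C (Diff K i) \<cdot> u)" using that(1-3) by (simp add: arr)
    thus ?thesis using that by (simp add: arr)
  qed
  show "is_complex C (n + 1) (cneg C K)" by (rule is_complex_cneg[OF n_kernelD(1)[OF K]])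
  show "u = Zero C (Dom C u) (Ob (cneg C K) 0)"
    if "u \<in> Arr C" "Cod C u = Ob (cneg C K) 0" "Diff (cneg C K) 0 \<cdot> u = Zero C (Dom C u) (Ob (cneg C K) 1)" for u
    using n_kernelD(2)[OF K, of u] *[of 0 u] that by simp
  show "\<exists>v\<in>Arr C. Dom C v = Dom C u \<and> Cod C v = Ob (cneg C K) i \<and> Diff (cneg C K) i \<cdot> v = u"
    if i: "i < n" and u: "u \<in> Arr C" "Cod C u = Ob (cneg C K) (Suc i)"
      "Diff (cneg C K) (Suc i) \<cdot> u = Zero C (Dom C u) (Ob (cneg C K) (Suc (Suc i)))" for i u
  proof -
    obtain v where v: "v \<in> Arr C" "Dom C v = Dom C u" "Cod C v = Ob K i" "Diff K i \<cdot> v = u"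
      using n_kernelD(3)[OF K i u(1)] *[of "Suc i" u] i u by auto
    thus ?thesis using i u(1) by (intro bexI[of _ "neg C v"]) (simp_all add: arr)
  qed
qed

text \<open>In the cone of \<open>g\<close> the differential of \<open>Z\<close> carries the sign,
  whereas the abstract cone wants it on the part of \<open>X\<close>. Negating the whole cone moves
  it, but also turns \<open>g\<close> into its negative; the minus signs on \<open>in2\<close> and
  \<open>pr2\<close> compensate for this. Dualising exchanges inclusions and projections.\<close>

lemma pushout_cone_op_mapping_cone:
  assumes n: "0 < n" and X: "n_kernel C n X" and pb: "n_pullback C n (cshift X) g0 Z g"
  shows "pushout_cone (op_cat C) n (crev (n + 1) X) (crev n Z)
    (crev (n + 1) (cneg C (mapping_cone C n Z (cshift X) g))) (\<lambda>k. g (n - k))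
    (\<lambda>k. if k = 0 then neg C (Idn C (Ob X (Suc n))) else neg C (in2 (biprod C (Ob Z (Suc n - k)) (Ob X (Suc n - k)))))
    (\<lambda>k. if k < n then in1 (biprod C (Ob Z (n - k)) (Ob X (n - k))) else Idn C (Ob Z 0))
    (\<lambda>k. if k < n then pr1 (biprod C (Ob Z (n - k)) (Ob X (n - k))) else Idn C (Ob Z 0))
    (neg C (pr2 (biprod C (Ob Z 1) (Ob X 1))))"
proof -
  let ?M = "mapping_cone C n Z (cshift X) g"
  have Z: "is_complex C n Z" and g: "chain_map C n Z (cshift X) g" and M: "n_kernel C n ?M"
    using pb by (auto simp: n_pullback_def)
  have g': "\<And>i. i < n \<Longrightarrow> g (Suc i) \<cdot> Diff Z i = Diff X (Suc i) \<cdot> g i"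
    "\<And>i. i \<le> n \<Longrightarrow> g i \<in> Arr C" "\<And>i. i \<le> n \<Longrightarrow> Dom C (g i) = Ob Z i" "\<And>i. i \<le> n \<Longrightarrow> Cod C (g i) = Ob X (Suc i)"
    using chain_mapD[OF g] by simp_all
  note Mx = n_kernelD(1)[OF M]
  note [simp] = is_complexD[OF n_kernelD(1)[OF X]] is_complexD[OF Z] is_complexD[OF Mx] g'(2-4)
  have MOb: "\<And>k. k < n \<Longrightarrow> Ob ?M (Suc k) = bobj (biprod C (Ob Z (Suc k)) (Ob X (Suc k)))"
    "Ob ?M 0 = Ob Z 0" "Ob ?M (Suc n) = Ob X (Suc n)"
    by (simp_all add: mapping_cone_sel)
  have MObn: "Ob ?M n = bobj (biprod C (Ob Z n) (Ob X n))"
    using MOb(1)[of "n - 1"] n by simp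
  have Mn: "Diff ?M n \<cdot> in1 (biprod C (Ob Z n) (Ob X n)) = g n"
    "Diff ?M n \<cdot> in2 (biprod C (Ob Z n) (Ob X n)) = Diff X n"
    using n by (simp_all add: mapping_cone_sel arr)
  have M0: "pr1 (biprod C (Ob Z 1) (Ob X 1)) \<cdot> Diff ?M 0 = neg C (Diff Z 0)"
    "pr2 (biprod C (Ob Z 1) (Ob X 1)) \<cdot> Diff ?M 0 = g 0"
    using n by (simp_all add: mapping_cone_sel arr)
  have M0': "Diff ?M 0 = neg C (in1 (biprod C (Ob Z 1) (Ob X 1)) \<cdot> Diff Z 0) \<boxplus> in2 (biprod C (Ob Z 1) (Ob X 1)) \<cdot> g 0"
    using n by (simp add: mapping_cone_sel col_def arr)
  let ?P = "\<lambda>i. biprod C (Ob Z i) (Ob X i)"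
  have Mi: "Diff ?M (Suc i) \<cdot> in1 (?P (Suc i)) =
      neg C (in1 (?P (Suc (Suc i))) \<cdot> Diff Z (Suc i)) \<boxplus> in2 (?P (Suc (Suc i))) \<cdot> g (Suc i)"
    "Diff ?M (Suc i) \<cdot> in2 (?P (Suc i)) = in2 (?P (Suc (Suc i))) \<cdot> Diff X (Suc i)"
    "pr1 (?P (Suc (Suc i))) \<cdot> Diff ?M (Suc i) = neg C (Diff Z (Suc i) \<cdot> pr1 (?P (Suc i)))"
    if "Suc i < n" for i
    using that by (simp_all add: mapping_cone_sel arr)
  \<comment> \<open>\<open>m k\<close> is the reversed index; the equations below let it replace all
    truncated subtractions.\<close>
  define m where "m k = n - Suc k" for k
  have m: "n - k = Suc (m k)" "Suc n - k = Suc (Suc (m k))" "n - Suc k = m k" "Suc n - Suc k = Suc (m k)" "m k < n"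
    "Suc n - Suc (Suc k) = m k"
    if "k < n" for k using that by (auto simp: m_def)
  have mm: "m k = Suc (m (Suc k))" if "Suc k < n" for k using that by (auto simp: m_def)
  show ?thesis
  proof (intro pushout_cone.intro additive_category_op pushout_cone_axioms.intro n, goal_cases)
    case 1 show ?case using n_kernel_iff_op X by simp
  next
    case 2 show ?case by (rule is_complex_crev[OF Z])
  next
    case 3 show ?case using n_kernel_iff_op n_kernel_cneg[OF M] by simp
  next
    case 4
    show ?case
    proof (rule chain_mapI)
      fix i assume i: "i < n"
      show "g (n - Suc i) \<cdot>\<^bsub>op_cat C\<^esub> Diff (crev (n + 1) X) i = Diff (crev n Z) i \<cdot>\<^bsub>op_cat C\<^esub> g (n - i)"
        using i g'(1)[of "m i"] by (simp add: m)
    qed (auto simp: Suc_diff_le)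
  next
    case (5 k) thus ?case by (auto simp: arr)
  next
    case (6 k)
    show ?case
    proof (cases k)
      case (Suc i) thus ?thesis using 6 m[of i] by (simp add: arr MOb)
    qed (simp add: arr MOb)
  next
    case (7 k)
    thus ?case by (auto simp: arr)
  next
    case (8 k) thus ?case by (auto simp: arr)
  next
    case (9 k) thus ?case using m[of k] by (cases "k = n") (auto simp: arr MOb)
  next
    case (10 k) thus ?case by (auto simp: arr MOb)
  next
    case (11 k) thus ?case by (auto simp: arr MOb)
  next
    case (12 k) thus ?case by (auto simp: arr MOb)
  next
    case (13 k) thus ?case using m[of k] by (cases "k = n") (auto simp: arr MOb)
  next
    case 14 thus ?case using n by (simp add: arr MOb)
  next
    case 15 thus ?case using n by (simp add: arr MOb)
  next
    case 16 thus ?case using n MOb(1)[of 0] by (simp add: arr)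
  next
    case (17 k)
    show ?case
    proof (cases k)
      case 0
      thus ?thesis using n Mn by (simp add: arr MOb MObn)
    next
      case (Suc i)
      thus ?thesis using 17 m[of k] m[of i] mm[of i] Mi[of "m k"] by (simp add: arr MOb)
    qed
  next
    case 18 thus ?case using n Mn by (simp add: arr MOb MObn)
  next
    case (19 k)
    show ?case
    proof (cases "Suc k = n")
      case True
      hence "m k = 0" by (simp add: m_def)
      thus ?thesis using 19 True m[of k] M0' n by (simp add: arr plus_comm)
    next
      case False
      thus ?thesis using 19 m[of k] mm[of k] m(5)[of "Suc k"] Mi[of "m (Suc k)"] by (simp add: arr MOb plus_comm)
    qed
  next
    case (20 k)
    show ?case
    proof (cases "Suc k = n")
      case True
      hence "m k = 0" by (simp add: m_def)
      thus ?thesis using 20 True m[of k] M0 n by (simp add: arr MOb)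
    next
      case False
      thus ?thesis using 20 m[of k] mm[of k] m(5)[of "Suc k"] Mi[of "m (Suc k)"] by (simp add: arr MOb)
    qed
  next
    case (21 k) thus ?case using m[of k] by (simp add: arr)
  next
    case (22 k) thus ?case  by (auto simp: arr)
  next
    case 23 thus ?case by (simp add: arr MOb)
  next
    case 24 thus ?case using n by (simp add: arr)
  next
    case 25 thus ?case using n M0 MOb(1)[of 0] by (simp add: arr)
  qed
qed

end

section \<open>Pushouts, pullbacks and homotopy classes of admissible sequences\<close>

lemma crev_crev:
  "i \<le> N \<Longrightarrow> Ob (crev N (crev N X)) i = Ob X i" "i < N \<Longrightarrow> Diff (crev N (crev N X)) i = Diff X i"
  by auto

lemma chain_map_crev_crev:
  "chain_map C N (crev N (crev N X)) Y f \<longleftrightarrow> chain_map C N X Y f"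
  "chain_map C N X (crev N (crev N Y)) f \<longleftrightarrow> chain_map C N X Y f"
  unfolding chain_map_def by (auto simp: crev_crev simp del: crev_sel)

lemma chain_map_op:
  assumes "chain_map (op_cat C) N X Y f"
  shows "chain_map C N (crev N Y) (crev N X) (\<lambda>i. f (N - i))"
  using chain_map_crev[OF assms] by simp

lemma (in additive_category) n_exact_sequence_crev:
  assumes "n_exact_sequence C n X"
  shows "n_exact_sequence (op_cat C) n (crev (n + 1) X)"
  using assms n_kernel_iff_op n_cokernel_iff_op is_complex_crev unfolding n_exact_sequence_def by blast

lemma (in additive_category) n_exact_sequence_op:
  assumes "n_exact_sequence (op_cat C) n X"
  shows "n_exact_sequence C n (crev (n + 1) X)"
  using additive_category.n_exact_sequence_crev[OF additive_category_op assms] by simp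

lemma (in additive_category) chain_map_Idn_ends:
  assumes "chain_map C N X Y f" "i \<le> N" "f i = Idn C A" "A \<in> Obj C"
  shows "Ob X i = A" "Ob Y i = A"
  using chain_mapD(2,3)[OF assms(1,2)] Idn_arr[OF assms(4)] assms(3) by auto

lemma (in additive_category) fixed_end_map_ends:
  assumes "fixed_end_map C n X Y f" "is_complex C (n + 1) X"
  shows "Ob Y 0 = Ob X 0" "Ob Y (Suc n) = Ob X (Suc n)"
  using chain_map_Idn_ends(2)[of "n + 1" X Y f 0] chain_map_Idn_ends(2)[of "n + 1" X Y f "n + 1"]
    is_complexD(1)[OF assms(2)] assms(1)
  by (auto simp: fixed_end_map_def)

section \<open>Completed pushouts and pullbacks of admissible sequences, and homotopy
  classes\<close>

locale pos_n_exact_category = n_exact_category +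
  assumes n_pos: "0 < n"
begin

lemma X_complex: "X \<in> \<X> \<Longrightarrow> is_complex C (n + 1) X"
  and X_kernel: "X \<in> \<X> \<Longrightarrow> n_kernel C n X"
  and X_cokernel: "X \<in> \<X> \<Longrightarrow> n_cokernel C n X"
  using \<X>_n_exact by (auto simp: n_exact_sequence_def)

text \<open>The axiom gives degrees 0 to n and an admissible sequence \<open>W\<close> with the same
  first differential. The completion is weakly isomorphic to \<open>W\<close>, hence admissible. The
  last clause is the universal property used from here on; it leaves the last component of \<psi>
  arbitrary.\<close>

lemma push_exists:
  assumes X: "X \<in> \<X>" and f0: "f0 \<in> Arr C" "Dom C f0 = Ob X 0"
  obtains E \<epsilon> where "E \<in> \<X>" "chain_map C (n + 1) X E \<epsilon>" "\<epsilon> 0 = f0"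
    "\<epsilon> (n + 1) = Idn C (Ob X (n + 1))" "n_pushout C n X f0 E \<epsilon>"
    "\<And>T \<psi>. \<lbrakk>is_complex C (n + 1) T; chain_map C (n + 1) X T \<psi>; \<psi> 0 = f0\<rbrakk> \<Longrightarrow>
      \<exists>\<chi>. chain_map C (n + 1) E T \<chi> \<and> \<chi> 0 = Idn C (Ob E 0) \<and> \<chi> (n + 1) = \<psi> (n + 1)"
proof -
  obtain Y \<phi> where po: "n_pushout C n X f0 Y \<phi>" and "adm_mono \<X> (Diff Y 0)"
    using E2[OF X, of "Cod C f0" f0] f0 Cod_Obj by auto
  then obtain W where W: "W \<in> \<X>" "Diff W 0 = Diff Y 0" by (auto simp: adm_mono_def)
  note pc = pushout_cone_mapping_cone[OF n_pos X_cokernel[OF X] po]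
  have \<phi>: "\<phi> 0 = f0" using po by (simp add: n_pushout_def)
  show ?thesis
  proof (rule pushout_cone.pushout_sequence[OF pc \<X>_n_exact[OF W(1)] W(2)], goal_cases)
    case (1 E \<epsilon> \<omega>)
    have E: "E \<in> \<X>"
      using weak_iso_closed[OF W(1)] 1(1) by (auto simp: weakly_isomorphic_def)
    \<comment> \<open>Completing a pushout does not change its cone, so \<open>E\<close> is still a
      pushout in the sense of the definition.\<close>
    have "mapping_cone C n X E \<epsilon> = mapping_cone C n X Y \<phi>"
      by (rule mapping_cone_cong[OF n_pos]) (use 1 in auto)
    moreover have "chain_map C n X E \<epsilon>" by (rule chain_map_le[OF 1(5)]) simp
    moreover have "is_complex C n E" by (rule is_complex_le[OF X_complex[OF E]]) simp
    moreover have "\<epsilon> 0 = f0" using 1(6)[of 0] \<phi> by simp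
    ultimately have "n_pushout C n X f0 E \<epsilon>" using po by (simp add: n_pushout_def)
    with E 1(5,7,8) \<phi> \<open>\<epsilon> 0 = f0\<close> show ?case by (intro that[of E \<epsilon>]) auto
  qed
qed

text \<open>The completion is performed in the opposite category, with degrees reversed; what
  follows is the translation back.\<close>

lemma pull_exists:
  assumes X: "X \<in> \<X>" and g0: "g0 \<in> Arr C" "Cod C g0 = Ob X (n + 1)"
  obtains E \<epsilon> where "E \<in> \<X>" "chain_map C (n + 1) E X \<epsilon>" "\<epsilon> 0 = Idn C (Ob X 0)"
    "\<epsilon> (n + 1) = g0" "n_pullback C n (cshift X) g0 (cshift E) (\<lambda>i. \<epsilon> (Suc i))"
    "\<And>T \<psi>. \<lbrakk>is_complex C (n + 1) T; chain_map C (n + 1) T X \<psi>; \<psi> (n + 1) = g0\<rbrakk> \<Longrightarrow>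
      \<exists>\<chi>. chain_map C (n + 1) T E \<chi> \<and> \<chi> (n + 1) = Idn C (Ob E (n + 1)) \<and> \<chi> 0 = \<psi> 0"
proof -
  obtain Z g where pb: "n_pullback C n (cshift X) g0 Z g" and "adm_epi n \<X> (Diff Z (n - 1))"
    using E2_op[OF X, of "Dom C g0" g0] g0 Dom_Obj by auto
  then obtain W where W: "W \<in> \<X>" "Diff W n = Diff Z (n - 1)" by (auto simp: adm_epi_def)
  have W': "Diff (crev (n + 1) W) 0 = Diff (crev n Z) 0" using W(2) by simp
  note pc = pushout_cone_op_mapping_cone[OF n_pos X_kernel[OF X] pb]
  have g: "g n = g0" using pb by (simp add: n_pullback_def)
  show ?thesis
  proof (rule pushout_cone.pushout_sequence[OF pc n_exact_sequence_crev[OF \<X>_n_exact[OF W(1)]] W'], goal_cases)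
    case (1 E' \<epsilon>' \<omega>)
    define E where "E = crev (n + 1) E'"
    define \<epsilon> where "\<epsilon> i = \<epsilon>' (n + 1 - i)" for i
    have wi: "n_exact_sequence (op_cat C) n E'" "chain_map (op_cat C) (n + 1) (crev (n + 1) W) E' \<omega>"
      "\<exists>i\<le>n + 1. is_iso C (\<omega> i) \<and> is_iso C (if i = n + 1 then \<omega> 0 else \<omega> (i + 1))"
      using 1(1) by (auto simp: weak_iso_def)
    have "chain_map C (n + 1) E (crev (n + 1) (crev (n + 1) W)) (\<lambda>i. \<omega> (n + 1 - i))"
      unfolding E_def by (rule chain_map_op[OF wi(2)])
    hence "chain_map C (n + 1) E W (\<lambda>i. \<omega> (n + 1 - i))" by (simp only: chain_map_crev_crev)
    moreover have "\<exists>i\<le>n + 1. is_iso C (\<omega> (n + 1 - i)) \<and>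
        is_iso C (if i = n + 1 then \<omega> (n + 1 - 0) else \<omega> (n + 1 - (i + 1)))"
    proof -
      obtain i where i: "i \<le> n + 1" "is_iso C (\<omega> i)" "is_iso C (if i = n + 1 then \<omega> 0 else \<omega> (i + 1))"
        using wi(3) by blast
      \<comment> \<open>Reversal turns the pair of degrees i, i + 1 into n - i, n + 1 - i and keeps
        the cyclic pair n + 1, 0.\<close>
      show ?thesis
        using i by (cases "i = n + 1") (auto intro!: exI[of _ "if i = n + 1 then n + 1 else n - i"] simp: Suc_diff_le)
    qed
    ultimately have "weak_iso C n E W (\<lambda>i. \<omega> (n + 1 - i))"
      using n_exact_sequence_op[OF wi(1)] \<X>_n_exact[OF W(1)] unfolding weak_iso_def E_def by blast
    hence E: "E \<in> \<X>" using weak_iso_closed[OF W(1)] by (auto simp: weakly_isomorphic_def)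
    have "chain_map C (n + 1) E (crev (n + 1) (crev (n + 1) X)) \<epsilon>"
      unfolding E_def \<epsilon>_def by (rule chain_map_op[OF 1(5)])
    hence \<epsilon>: "chain_map C (n + 1) E X \<epsilon>" by (simp only: chain_map_crev_crev)
    have \<epsilon>0: "\<epsilon> 0 = Idn C (Ob X 0)" using 1(7) by (simp add: \<epsilon>_def)
    have \<epsilon>S: "\<epsilon> (Suc i) = g i" if "i \<le> n" for i using 1(6)[of "n - i"] that by (simp add: \<epsilon>_def)
    have EOb: "Ob E (Suc i) = Ob Z i" if "i \<le> n" for i
      using 1(2)[of "n - i"] that by (simp add: E_def)
    have EDiff: "Diff E (Suc i) = Diff Z i" if "i < n" for i
    proof -
      have "n + 1 - Suc (Suc i) = n - Suc i" "n - Suc (n - Suc i) = i" "n - Suc i < n" using that by auto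
      thus ?thesis using 1(4)[of "n - Suc i"] by (simp add: E_def)
    qed
    have "mapping_cone C n (cshift E) (cshift X) (\<lambda>i. \<epsilon> (Suc i)) = mapping_cone C n Z (cshift X) g"
      by (rule mapping_cone_cong[OF n_pos]) (simp_all add: EOb EDiff \<epsilon>S)
    moreover have "chain_map C n (cshift E) (cshift X) (\<lambda>i. \<epsilon> (Suc i))"
      by (rule chain_mapI) (use chain_mapD[OF \<epsilon>] in simp_all)
    moreover have "is_complex C n (cshift E)" using is_complex_cshift X_complex[OF E] by simp
    ultimately have pb': "n_pullback C n (cshift X) g0 (cshift E) (\<lambda>i. \<epsilon> (Suc i))"
      using pb \<epsilon>S g by (simp add: n_pullback_def)
    have uni: "\<exists>\<chi>. chain_map C (n + 1) T E \<chi> \<and> \<chi> (n + 1) = Idn C (Ob E (n + 1)) \<and> \<chi> 0 = \<psi> 0"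
      if T: "is_complex C (n + 1) T" "chain_map C (n + 1) T X \<psi>" "\<psi> (n + 1) = g0" for T \<psi>
    proof -
      have "\<exists>\<chi>. chain_map (op_cat C) (n + 1) E' (crev (n + 1) T) \<chi> \<and>
          \<chi> 0 = Idn (op_cat C) (Ob E' 0) \<and> \<chi> (n + 1) = \<psi> (n + 1 - (n + 1))"
        by (rule 1(8)[OF is_complex_crev[OF T(1)] chain_map_crev[OF T(2)]]) (use T g in simp)
      then obtain \<chi> where \<chi>: "chain_map (op_cat C) (n + 1) E' (crev (n + 1) T) \<chi>"
        "\<chi> 0 = Idn C (Ob E' 0)" "\<chi> (n + 1) = \<psi> 0" by auto
      have "chain_map C (n + 1) (crev (n + 1) (crev (n + 1) T)) E (\<lambda>i. \<chi> (n + 1 - i))"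
        unfolding E_def by (rule chain_map_op[OF \<chi>(1)])
      hence "chain_map C (n + 1) T E (\<lambda>i. \<chi> (n + 1 - i))" by (simp only: chain_map_crev_crev)
      thus ?thesis using \<chi> by (intro exI[of _ "\<lambda>i. \<chi> (n + 1 - i)"]) (simp add: E_def)
    qed
    show ?case
      using E \<epsilon> \<epsilon>0 \<epsilon>S[of n] g pb' uni by (intro that[of E \<epsilon>]) auto
  qed
qed

text \<open>In the opposite category the section \<open>s\<close> factors component 0 of the
  identity chain map through the first differential, so the identity is null homotopic; the homotopy
  in the last degree is a retraction of \<open>Diff P 0\<close>.\<close>

lemma split_epi_imp_split_mono:
  assumes P: "P \<in> \<X>" and s: "s \<in> Arr C" "Dom C s = Ob P (n + 1)" "Cod C s = Ob P n"
    "Diff P n \<cdot> s = Idn C (Ob P (n + 1))"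
  obtains r where "r \<in> Arr C" "Dom C r = Ob P 1" "Cod C r = Ob P 0" "r \<cdot> Diff P 0 = Idn C (Ob P 0)"
proof -
  note [simp] = is_complexD[OF X_complex[OF P]]
  let ?P = "crev (n + 1) P"
  have cx: "is_complex (op_cat C) (n + 1) ?P" by (rule is_complex_crev[OF X_complex[OF P]])
  have co: "n_cokernel (op_cat C) n ?P" using X_kernel[OF P] by (simp add: n_kernel_iff_op)
  obtain h where h: "\<And>k. k \<le> n \<Longrightarrow> h k \<in> Arr (op_cat C)"
     "\<And>k. k \<le> n \<Longrightarrow> Dom (op_cat C) (h k) = Ob ?P (Suc k)" "\<And>k. k \<le> n \<Longrightarrow> Cod (op_cat C) (h k) = Ob ?P k"
    "Idn (op_cat C) (Ob ?P (Suc n)) = Diff ?P n \<cdot>\<^bsub>op_cat C\<^esub> h n"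
    using additive_category.null_homotopy[OF additive_category_op co cx
        additive_category.chain_map_Idn[OF additive_category_op cx], of s] s by auto
  show ?thesis using h(1,2,3)[of n] h(4) by (intro that[of "h n"]) auto
qed

text \<open>Push \<open>Y\<close> out along \<open>Diff X 0\<close> to get \<open>P\<close>. The composite \<open>X \<rightarrow> Y \<rightarrow> P\<close> factors through
  \<open>Diff X 0\<close> in degree \<open>0\<close>, so it is null homotopic in the last degree, where it is the identity;
  thus \<open>P\<close> splits and \<open>Diff X 0\<close> factors through \<open>Diff Y 0\<close>. This starts a chain map \<open>Y \<rightarrow> X\<close>,
  whose last component is corrected by a homotopy.\<close>

theorem fixed_end_map_inverse:
  assumes X: "X \<in> \<X>" and Y: "Y \<in> \<X>" and f: "fixed_end_map C n X Y f"
  obtains g where "fixed_end_map C n Y X g"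
proof -
  note Xc = X_complex[OF X] and Yc = X_complex[OF Y]
  have f': "chain_map C (n + 1) X Y f" "f 0 = Idn C (Ob X 0)" "f (n + 1) = Idn C (Ob X (n + 1))"
    using f by (auto simp: fixed_end_map_def)
  note [simp] = is_complexD[OF Xc] is_complexD[OF Yc] chain_mapD[OF f'(1)]
  have ends: "Ob Y 0 = Ob X 0" "Ob Y (Suc n) = Ob X (Suc n)"
    using fixed_end_map_ends[OF f Xc] by simp_all
  obtain P \<pi> where P: "P \<in> \<X>" and \<pi>: "chain_map C (n + 1) Y P \<pi>" "\<pi> 0 = Diff X 0"
      "\<pi> (n + 1) = Idn C (Ob Y (n + 1))"
    by (rule push_exists[OF Y, of "Diff X 0"]) (use ends in auto)
  note [simp] = is_complexD[OF X_complex[OF P]] chain_mapD[OF \<pi>(1)]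
  have P_ends: "Ob P 0 = Ob X 1" "Ob P (Suc n) = Ob X (Suc n)"
    using chain_mapD(3)[OF \<pi>(1), of 0] chain_map_Idn_ends(2)[OF \<pi>(1) _ \<pi>(3)] \<pi>(2) ends by auto
  \<comment> \<open>In degree 0 the composite is \<open>Diff X 0\<close>, so the homotopy starts
    with the identity of \<open>Ob X 1\<close>.\<close>
  obtain h where h: "h n \<in> Arr C" "Dom C (h n) = Ob X (Suc n)" "Cod C (h n) = Ob P n"
    "\<pi> (Suc n) \<cdot> f (Suc n) = Diff P n \<cdot> h n"
    by (rule null_homotopy[OF X_cokernel[OF X] X_complex[OF P]
          chain_map_comp[OF f'(1) \<pi>(1) Xc Yc X_complex[OF P]], of "Idn C (Ob X 1)"])
      (use \<pi> f' ends P_ends in \<open>auto simp: arr\<close>)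
  have "Diff P n \<cdot> h n = Idn C (Ob P (n + 1))"
    using h(4) \<pi>(3) f'(3) ends P_ends by (simp add: arr)
  then obtain r where r: "r \<in> Arr C" "Dom C r = Ob P 1" "Cod C r = Ob P 0" "r \<cdot> Diff P 0 = Idn C (Ob P 0)"
    using split_epi_imp_split_mono[OF P h(1)] h(2,3) P_ends by auto
  \<comment> \<open>\<open>\<pi> 1\<close> carries \<open>Diff Y 0\<close> to
    \<open>Diff P 0 \<cdot> Diff X 0\<close>, from which \<open>r\<close> removes
    \<open>Diff P 0\<close>: hence component 1 of the map back.\<close>
  have t: "(r \<cdot> \<pi> 1) \<cdot> Diff Y 0 = Diff X 0 \<cdot> Idn C (Ob Y 0)"
  proof -
    have "(r \<cdot> \<pi> 1) \<cdot> Diff Y 0 = r \<cdot> (Diff P 0 \<cdot> Diff X 0)"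
      using r(1,2) \<pi>(2) ends chain_mapD(4)[OF \<pi>(1), of 0] by (simp add: arr)
    also have "\<dots> = Diff X 0" using r P_ends by (simp add: arr reassoc[OF r(4)])
    finally show ?thesis using ends by (simp add: arr)
  qed
  obtain g where g: "chain_map C (n + 1) Y X g" "g 0 = Idn C (Ob Y 0)"
    by (rule comparison[OF X_cokernel[OF Y] Xc, of "Idn C (Ob Y 0)" "r \<cdot> \<pi> 1"])
      (use ends r t P_ends n_pos in \<open>auto simp: arr\<close>)
  note [simp] = chain_mapD[OF g(1)]
  \<comment> \<open>The identity of \<open>X\<close> and the composite of \<open>g\<close> after
    \<open>f\<close> agree in degree 0. As \<open>f\<close> is an identity in degree n + 1, the
    homotopy expresses how far \<open>g (Suc n)\<close> is from the identity.\<close>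
  obtain k where k: "k n \<in> Arr C" "Dom C (k n) = Ob X (Suc n)" "Cod C (k n) = Ob X n"
    "Idn C (Ob X (Suc n)) = g (Suc n) \<cdot> f (Suc n) \<boxplus> Diff X n \<cdot> k n"
    by (rule homotopic_if_eq_0[OF X_cokernel[OF X] Xc chain_map_Idn[OF Xc]
          chain_map_comp[OF f'(1) g(1) Xc Yc Xc]])
      (use f'(2) g(2) ends in \<open>auto simp: arr\<close>)
  have k': "g (Suc n) \<boxplus> Diff X n \<cdot> k n = Idn C (Ob X (Suc n))"
  proof -
    have "g (Suc n) \<cdot> f (Suc n) = g (Suc n)" using f'(3) ends by (simp add: arr)
    thus ?thesis using k(4) by simp
  qed
  \<comment> \<open>The homotopy term is added in the two top degrees. Degree 0 is unaffected as n
    is positive, and the square below degree n survives because consecutive differentials of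
    \<open>Y\<close> compose to zero.\<close>
  let ?g = "\<lambda>i. if i = Suc n then Idn C (Ob X (Suc n)) else if i = n then g n \<boxplus> k n \<cdot> Diff Y n else g i"
  have "chain_map C (n + 1) Y X ?g"
  proof (rule chain_mapI)
    fix i assume i: "i < n + 1"
    consider "Suc i < n" | "Suc i = n" | "i = n" using i by linarith
    thus "?g (Suc i) \<cdot> Diff Y i = Diff X i \<cdot> ?g i"
    proof cases
      case 1
      thus ?thesis by simp
    next
      case 2
      have "Diff Y n \<cdot> Diff Y i = Zero C (Ob Y i) (Ob Y (Suc n))"
        using 2 is_complexD(5)[OF Yc, of i] by auto
      moreover have "g n \<cdot> Diff Y i = Diff X i \<cdot> g i" using 2 chain_mapD(4)[OF g(1), of i] by auto
      moreover have "Cod C (Diff Y i) = Ob Y n" using 2 is_complexD(4)[OF Yc, of i] by auto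
      moreover have "Cod C (Diff Y n) = Ob Y (Suc n)" "Ob Y i \<in> Obj C" using i by simp_all
      moreover have "Diff Y i \<in> Arr C" "Dom C (Diff Y i) = Ob Y i" "Diff X i \<cdot> g i \<in> Arr C"
        "Dom C (Diff X i \<cdot> g i) = Ob Y i" "Cod C (Diff X i \<cdot> g i) = Ob X n"
        using i 2 by (auto simp: arr)
      ultimately have "(g n \<boxplus> k n \<cdot> Diff Y n) \<cdot> Diff Y i = Diff X i \<cdot> g i"
        using k(1-3) ends by (simp add: arr del: is_complexD(4)[OF Yc])
      thus ?thesis using 2 by auto
    next
      case 3
      have "Diff X n \<cdot> (g n \<boxplus> k n \<cdot> Diff Y n) = (g (Suc n) \<boxplus> Diff X n \<cdot> k n) \<cdot> Diff Y n"
        using k(1-3) ends by (simp add: arr)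
      thus ?thesis using 3 k' by simp
    qed
  qed (use k ends in \<open>auto simp: arr le_Suc_eq\<close>)
  hence "fixed_end_map C n Y X ?g"
    unfolding fixed_end_map_def using n_pos g(2) ends by simp
  thus ?thesis by (rule that)
qed

text \<open>From left to right, n-exactness passes along the homotopy equivalence, and identities at
  both ends give a weak isomorphism. From right to left, \<open>fixed_end_map_inverse\<close> yields
  a map back; both composites agree with the identity in degree 0 and so are homotopic to
  it.\<close>

lemma hclass_eq:
  assumes X: "X \<in> \<X>"
  shows "hclass C n X = {Y \<in> \<X>. \<exists>f. fixed_end_map C n X Y f}"
proof (intro equalityI subsetI)
  fix Y assume "Y \<in> hclass C n X"
  then obtain f g where Y: "is_complex C (n + 1) Y" and ends: "Ob Y 0 = Ob X 0" "Ob Y (n + 1) = Ob X (n + 1)"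
    and f: "fixed_end_map C n X Y f" and g: "fixed_end_map C n Y X g"
    and fg: "homotopic C (n + 1) Y Y (\<lambda>i. f i \<cdot> g i) (\<lambda>i. Idn C (Ob Y i))"
    by (auto simp: hclass_def complexes_between_def homotopy_equivalent_def)
  have "n_kernel C n Y" "n_cokernel C n Y"
    using n_kernel_retract[OF X_kernel[OF X] Y _ _ fg] n_cokernel_retract[OF X_cokernel[OF X] Y _ _ fg] f g
    by (auto simp: fixed_end_map_def)
  hence "n_exact_sequence C n Y" using Y by (simp add: n_exact_sequence_def)
  \<comment> \<open>The index n + 1 selects \<open>f (n + 1)\<close> and \<open>f 0\<close>, which
    are cyclically adjacent.\<close>
  hence "weak_iso C n X Y f"
    using f \<X>_n_exact[OF X] is_complexD(1)[OF X_complex[OF X]] unfolding weak_iso_def fixed_end_map_def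
    by (auto intro!: exI[of _ "n + 1"] is_iso_Idn)
  hence "Y \<in> \<X>" using weak_iso_closed[OF X] by (auto simp: weakly_isomorphic_def)
  thus "Y \<in> {Y \<in> \<X>. \<exists>f. fixed_end_map C n X Y f}" using f by auto
next
  fix Y assume "Y \<in> {Y \<in> \<X>. \<exists>f. fixed_end_map C n X Y f}"
  then obtain f where Y: "Y \<in> \<X>" and f: "fixed_end_map C n X Y f" by auto
  obtain g where g: "fixed_end_map C n Y X g" using fixed_end_map_inverse[OF X Y f] .
  note Xc = X_complex[OF X] and Yc = X_complex[OF Y]
  have f': "chain_map C (n + 1) X Y f" "f 0 = Idn C (Ob X 0)" "f (n + 1) = Idn C (Ob X (n + 1))"
    and g': "chain_map C (n + 1) Y X g" "g 0 = Idn C (Ob Y 0)"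
    using f g by (auto simp: fixed_end_map_def)
  note [simp] = is_complexD[OF Xc] is_complexD[OF Yc]
  have ends: "Ob Y 0 = Ob X 0" "Ob Y (Suc n) = Ob X (Suc n)"
    using fixed_end_map_ends[OF f Xc] by simp_all
  have "homotopic C (n + 1) X X (\<lambda>i. g i \<cdot> f i) (\<lambda>i. Idn C (Ob X i))"
    by (rule homotopic_if_eq_0[OF X_cokernel[OF X] Xc chain_map_comp[OF f'(1) g'(1) Xc Yc Xc] chain_map_Idn[OF Xc]])
      (use f'(2) g'(2) ends in \<open>auto simp: arr\<close>)
  moreover have "homotopic C (n + 1) Y Y (\<lambda>i. f i \<cdot> g i) (\<lambda>i. Idn C (Ob Y i))"
    by (rule homotopic_if_eq_0[OF X_cokernel[OF Y] Yc chain_map_comp[OF g'(1) f'(1) Yc Xc Yc] chain_map_Idn[OF Yc]])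
      (use f'(2) g'(2) ends in \<open>auto simp: arr\<close>)
  ultimately have "homotopy_equivalent C n X Y"
    unfolding homotopy_equivalent_def using f g by blast
  thus "Y \<in> hclass C n X" using Yc ends by (simp add: hclass_def complexes_between_def)
qed

lemma fixed_end_map_comp:
  assumes "X \<in> \<X>" "Y \<in> \<X>" "Z \<in> \<X>" "fixed_end_map C n X Y f" "fixed_end_map C n Y Z g"
  shows "fixed_end_map C n X Z (\<lambda>i. g i \<cdot> f i)"
proof -
  have f: "chain_map C (n + 1) X Y f" "f 0 = Idn C (Ob X 0)" "f (n + 1) = Idn C (Ob X (n + 1))"
    and g: "chain_map C (n + 1) Y Z g" "g 0 = Idn C (Ob Y 0)" "g (n + 1) = Idn C (Ob Y (n + 1))"
    using assms by (auto simp: fixed_end_map_def)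
  note [simp] = is_complexD[OF X_complex[OF assms(1)]] is_complexD[OF X_complex[OF assms(2)]]
  have ends: "Ob Y 0 = Ob X 0" "Ob Y (Suc n) = Ob X (Suc n)"
    using fixed_end_map_ends[OF assms(4) X_complex[OF assms(1)]] by simp_all
  show ?thesis
    unfolding fixed_end_map_def
    using chain_map_comp[OF f(1) g(1)] X_complex assms(1-3) f(2,3) g(2,3) ends by (simp add: arr)
qed

text \<open>Composition and \<open>fixed_end_map_inverse\<close> make existence of a fixed-end map
  an equivalence relation on admissible sequences.\<close>

lemma hclass_eq_iff:
  assumes X: "X \<in> \<X>" and Y: "Y \<in> \<X>"
  shows "hclass C n X = hclass C n Y \<longleftrightarrow> (\<exists>f. fixed_end_map C n X Y f)"
proof
  assume "hclass C n X = hclass C n Y"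
  moreover have "fixed_end_map C n Y Y (\<lambda>i. Idn C (Ob Y i))"
    using chain_map_Idn[OF X_complex[OF Y]] by (simp add: fixed_end_map_def)
  ultimately show "\<exists>f. fixed_end_map C n X Y f"
    using Y by (auto simp: hclass_eq X Y)
next
  assume "\<exists>f. fixed_end_map C n X Y f"
  then obtain f where f: "fixed_end_map C n X Y f" by blast
  obtain g where g: "fixed_end_map C n Y X g" using fixed_end_map_inverse[OF X Y f] .
  show "hclass C n X = hclass C n Y"
    unfolding hclass_eq[OF X] hclass_eq[OF Y]
    using fixed_end_map_comp[OF X Y _ f] fixed_end_map_comp[OF Y X _ g] X Y f g
    by (blast intro: fixed_end_map_comp)
qed

end

section \<open>Direct sums and the functor of extensions\<close>

definition dsum :: "('o, 'm) precat \<Rightarrow> 'm \<Rightarrow> 'm \<Rightarrow> 'm" where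
  "dsum C a d = mat22 C a (Zero C (Dom C d) (Cod C a)) (Zero C (Dom C a) (Cod C d)) d"

text \<open>With \<open>Z\<close> a zero object, the contractible sequence B = B followed by zeros.
  Adding it to \<open>X\<close> changes the first differential to its direct sum with the identity
  of \<open>B\<close>.\<close>

definition id_complex :: "('o, 'm) precat \<Rightarrow> 'o \<Rightarrow> 'o \<Rightarrow> ('o, 'm) cochain" where
  "id_complex C B Z = \<lparr>Ob = (\<lambda>i. if i \<le> 1 then B else Z),
     Diff = (\<lambda>i. if i = 0 then Idn C B else Zero C (if i = 1 then B else Z) Z)\<rparr>"

lemma id_complex_sel [simp]:
  "Ob (id_complex C B Z) 0 = B" "Ob (id_complex C B Z) (Suc 0) = B"
  "Ob (id_complex C B Z) (Suc (Suc i)) = Z"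
  "Diff (id_complex C B Z) 0 = Idn C B" "Diff (id_complex C B Z) (Suc 0) = Zero C B Z"
  "Diff (id_complex C B Z) (Suc (Suc i)) = Zero C Z Z"
  by (simp_all add: id_complex_def)

context additive_category
begin

lemma dsum_arr [arr]:
  assumes "a \<in> Arr C" "d \<in> Arr C"
  shows "dsum C a d \<in> Arr C" "Dom C (dsum C a d) = bobj (biprod C (Dom C a) (Dom C d))"
    "Cod C (dsum C a d) = bobj (biprod C (Cod C a) (Cod C d))"
  using assms by (simp_all add: dsum_def arr)

lemma dsum_in [arr]:
  assumes "a \<in> Arr C" "d \<in> Arr C" "Dom C a = A" "Dom C d = B"
  shows "dsum C a d \<cdot> in1 (biprod C A B) = in1 (biprod C (Cod C a) (Cod C d)) \<cdot> a"
    "dsum C a d \<cdot> in2 (biprod C A B) = in2 (biprod C (Cod C a) (Cod C d)) \<cdot> d"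
  using assms by (auto simp: dsum_def arr)

lemma pr_dsum [arr]:
  assumes "a \<in> Arr C" "d \<in> Arr C" "Cod C a = A" "Cod C d = B"
  shows "pr1 (biprod C A B) \<cdot> dsum C a d = a \<cdot> pr1 (biprod C (Dom C a) (Dom C d))"
    "pr2 (biprod C A B) \<cdot> dsum C a d = d \<cdot> pr2 (biprod C (Dom C a) (Dom C d))"
  using assms by (auto simp: dsum_def arr)

lemma dsum_comp:
  assumes "a \<in> Arr C" "d \<in> Arr C" "a' \<in> Arr C" "d' \<in> Arr C" "Cod C a = Dom C a'" "Cod C d = Dom C d'"
  shows "dsum C a' d' \<cdot> dsum C a d = dsum C (a' \<cdot> a) (d' \<cdot> d)"
proof (rule biprod_eqI[of _ _ "Dom C a" "Dom C d"])
  have "dsum C a' d' \<cdot> (in1 (biprod C (Cod C a) (Cod C d)) \<cdot> a) =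
      (in1 (biprod C (Cod C a') (Cod C d')) \<cdot> a') \<cdot> a"
    "dsum C a' d' \<cdot> (in2 (biprod C (Cod C a) (Cod C d)) \<cdot> d) =
      (in2 (biprod C (Cod C a') (Cod C d')) \<cdot> d') \<cdot> d"
    by (rule reassoc; use assms in \<open>simp add: arr\<close>)+
  thus "(dsum C a' d' \<cdot> dsum C a d) \<cdot> in1 (biprod C (Dom C a) (Dom C d)) =
      dsum C (a' \<cdot> a) (d' \<cdot> d) \<cdot> in1 (biprod C (Dom C a) (Dom C d))"
    "(dsum C a' d' \<cdot> dsum C a d) \<cdot> in2 (biprod C (Dom C a) (Dom C d)) =
      dsum C (a' \<cdot> a) (d' \<cdot> d) \<cdot> in2 (biprod C (Dom C a) (Dom C d))"
    using assms by (simp_all add: arr)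
qed (use assms in \<open>simp_all add: arr\<close>)

lemma dsum_Idn:
  assumes "A \<in> Obj C" "B \<in> Obj C"
  shows "dsum C (Idn C A) (Idn C B) = Idn C (bobj (biprod C A B))"
  by (rule biprod_eqI[of _ _ A B]) (use assms in \<open>simp_all add: arr\<close>)

lemma dsum_zero:
  assumes "A \<in> Obj C" "B \<in> Obj C" "A' \<in> Obj C" "B' \<in> Obj C"
  shows "dsum C (Zero C A A') (Zero C B B') = Zero C (bobj (biprod C A B)) (bobj (biprod C A' B'))"
  by (rule biprod_eqI[of _ _ A B]) (use assms in \<open>simp_all add: arr\<close>)

lemma complex_sum_Ob [simp]: "Ob (complex_sum C X Y) i = bobj (biprod C (Ob X i) (Ob Y i))"
  by (simp add: complex_sum_def)

lemma complex_sum_Diff: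
  "is_complex C N X \<Longrightarrow> is_complex C N Y \<Longrightarrow> i < N \<Longrightarrow> Diff (complex_sum C X Y) i = dsum C (Diff X i) (Diff Y i)"
  by (simp add: complex_sum_def dsum_def is_complexD)

lemma complex_sum_props:
  assumes X: "is_complex C N X" and Y: "is_complex C N Y"
  shows is_complex_sum: "is_complex C N (complex_sum C X Y)"
    and chain_map_in1: "chain_map C N X (complex_sum C X Y) (\<lambda>i. in1 (biprod C (Ob X i) (Ob Y i)))"
    and chain_map_in2: "chain_map C N Y (complex_sum C X Y) (\<lambda>i. in2 (biprod C (Ob X i) (Ob Y i)))"
    and chain_map_pr1: "chain_map C N (complex_sum C X Y) X (\<lambda>i. pr1 (biprod C (Ob X i) (Ob Y i)))"
    and chain_map_pr2: "chain_map C N (complex_sum C X Y) Y (\<lambda>i. pr2 (biprod C (Ob X i) (Ob Y i)))"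
proof -
  note [simp] = is_complexD[OF X] is_complexD[OF Y] complex_sum_Diff[OF X Y]
  show "is_complex C N (complex_sum C X Y)"
    by (rule is_complexI) (simp_all add: arr dsum_comp dsum_zero)
qed (rule chain_mapI; simp add: is_complexD[OF X] is_complexD[OF Y] complex_sum_Diff[OF X Y] arr)+

lemma chain_map_sum:
  assumes X: "is_complex C N X" and Y: "is_complex C N Y" and X': "is_complex C N X'" and Y': "is_complex C N Y'"
    and f: "chain_map C N X X' f" and g: "chain_map C N Y Y' g"
  shows "chain_map C N (complex_sum C X Y) (complex_sum C X' Y') (\<lambda>i. dsum C (f i) (g i))"
proof -
  note [simp] = is_complexD[OF X] is_complexD[OF Y] is_complexD[OF X'] is_complexD[OF Y'] chain_mapD[OF f] chain_mapD[OF g]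
    complex_sum_Diff[OF X Y] complex_sum_Diff[OF X' Y']
  show ?thesis
    by (rule chain_mapI) (simp_all add: arr dsum_comp)
qed

text \<open>Stated for arbitrary inclusion and projection chain maps, so that it also applies in the
  opposite category with the two kinds exchanged. Lifts are found on each summand and added.\<close>

lemma n_kernel_of_sum:
  assumes X: "n_kernel C n X" and Y: "n_kernel C n Y" and S: "is_complex C (n + 1) S"
    and i1: "chain_map C (n + 1) X S i1" and i2: "chain_map C (n + 1) Y S i2"
    and p1: "chain_map C (n + 1) S X p1" and p2: "chain_map C (n + 1) S Y p2"
    and sum: "\<And>i. i \<le> n + 1 \<Longrightarrow> i1 i \<cdot> p1 i \<boxplus> i2 i \<cdot> p2 i = Idn C (Ob S i)"
  shows "n_kernel C n S"
proof (rule n_kernelI[OF S])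
  note [simp] = is_complexD[OF n_kernelD(1)[OF X]] is_complexD[OF n_kernelD(1)[OF Y]] is_complexD[OF S]
    chain_mapD(1-3)[OF i1] chain_mapD(1-3)[OF i2] chain_mapD(1-3)[OF p1] chain_mapD(1-3)[OF p2]
  have split: "u = i1 i \<cdot> (p1 i \<cdot> u) \<boxplus> i2 i \<cdot> (p2 i \<cdot> u)" if "i \<le> n + 1" "u \<in> Arr C" "Cod C u = Ob S i" for i u
  proof -
    have "(i1 i \<cdot> p1 i \<boxplus> i2 i \<cdot> p2 i) \<cdot> u = u" using that sum[of i] by (simp add: arr)
    thus ?thesis using that by (simp add: arr)
  qed
  have du: "Diff Q i \<cdot> (p i \<cdot> u) = Zero C (Dom C u) (Ob Q (Suc i))"
    if "i \<le> n" "u \<in> Arr C" "Cod C u = Ob S i" "Diff S i \<cdot> u = Zero C (Dom C u) (Ob S (Suc i))"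
      "chain_map C (n + 1) S Q p" "is_complex C (n + 1) Q" for Q p i u
  proof -
    have "Diff Q i \<cdot> (p i \<cdot> u) = (p (Suc i) \<cdot> Diff S i) \<cdot> u"
      using that(1-3) chain_mapD[OF that(5)] is_complexD[OF that(6)] by (simp flip: comp_assoc)
    thus ?thesis using that chain_mapD(1-3)[OF that(5)] is_complexD[OF that(6)] by (simp add: arr)
  qed
  note du1 = du[OF _ _ _ _ p1 n_kernelD(1)[OF X]] and du2 = du[OF _ _ _ _ p2 n_kernelD(1)[OF Y]]
  {
    fix u assume u: "u \<in> Arr C" "Cod C u = Ob S 0" "Diff S 0 \<cdot> u = Zero C (Dom C u) (Ob S 1)"
    have 1: "p1 0 \<cdot> u = Zero C (Dom C (p1 0 \<cdot> u)) (Ob X 0)"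
      by (rule n_kernelD(2)[OF X]) (use u du1[of 0 u] in \<open>simp_all add: arr\<close>)
    have 2: "p2 0 \<cdot> u = Zero C (Dom C (p2 0 \<cdot> u)) (Ob Y 0)"
      by (rule n_kernelD(2)[OF Y]) (use u du2[of 0 u] in \<open>simp_all add: arr\<close>)
    have "u = i1 0 \<cdot> (p1 0 \<cdot> u) \<boxplus> i2 0 \<cdot> (p2 0 \<cdot> u)" by (rule split) (use u in simp_all)
    also have "\<dots> = Zero C (Dom C u) (Ob S 0)"
      using u(1,2) by (subst 1, subst 2) (simp add: arr)
    finally show "u = Zero C (Dom C u) (Ob S 0)" .
  next
    fix i u assume i: "i < n" and u: "u \<in> Arr C" "Cod C u = Ob S (Suc i)"
      "Diff S (Suc i) \<cdot> u = Zero C (Dom C u) (Ob S (Suc (Suc i)))"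
    have "\<exists>v\<in>Arr C. Dom C v = Dom C (p1 (Suc i) \<cdot> u) \<and> Cod C v = Ob X i \<and> Diff X i \<cdot> v = p1 (Suc i) \<cdot> u"
      by (rule n_kernelD(3)[OF X i]) (use i u du1[of "Suc i" u] in \<open>simp_all add: arr\<close>)
    then obtain v1 where v1: "v1 \<in> Arr C" "Dom C v1 = Dom C u" "Cod C v1 = Ob X i" "Diff X i \<cdot> v1 = p1 (Suc i) \<cdot> u"
      using i u by (auto simp: arr)
    have "\<exists>v\<in>Arr C. Dom C v = Dom C (p2 (Suc i) \<cdot> u) \<and> Cod C v = Ob Y i \<and> Diff Y i \<cdot> v = p2 (Suc i) \<cdot> u"
      by (rule n_kernelD(3)[OF Y i]) (use i u du2[of "Suc i" u] in \<open>simp_all add: arr\<close>)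
    then obtain v2 where v2: "v2 \<in> Arr C" "Dom C v2 = Dom C u" "Cod C v2 = Ob Y i" "Diff Y i \<cdot> v2 = p2 (Suc i) \<cdot> u"
      using i u by (auto simp: arr)
    have "Diff S i \<cdot> (i1 i \<cdot> v1 \<boxplus> i2 i \<cdot> v2) = i1 (Suc i) \<cdot> (Diff X i \<cdot> v1) \<boxplus> i2 (Suc i) \<cdot> (Diff Y i \<cdot> v2)"
      using i v1(1-3) v2(1-3) reassoc[OF chain_mapD(4)[OF i1, of i], of v1] reassoc[OF chain_mapD(4)[OF i2, of i], of v2]
      by (simp add: arr)
    also have "\<dots> = u" unfolding v1(4) v2(4) by (rule split[symmetric]) (use i u in simp_all)
    finally show "\<exists>v\<in>Arr C. Dom C v = Dom C u \<and> Cod C v = Ob S i \<and> Diff S i \<cdot> v = u"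
      using i v1(1-3) v2(1-3) by (intro bexI[of _ "i1 i \<cdot> v1 \<boxplus> i2 i \<cdot> v2"]) (simp_all add: arr)
  }
qed

lemma n_exact_complex_sum:
  assumes X: "n_exact_sequence C n X" and Y: "n_exact_sequence C n Y"
  shows "n_exact_sequence C n (complex_sum C X Y)"
proof -
  have X': "is_complex C (n + 1) X" "n_kernel C n X" "n_cokernel C n X"
    and Y': "is_complex C (n + 1) Y" "n_kernel C n Y" "n_cokernel C n Y"
    using X Y by (auto simp: n_exact_sequence_def)
  note cs = complex_sum_props[OF X'(1) Y'(1)]
  have s: "in1 (biprod C (Ob X i) (Ob Y i)) \<cdot> pr1 (biprod C (Ob X i) (Ob Y i)) \<boxplus>
      in2 (biprod C (Ob X i) (Ob Y i)) \<cdot> pr2 (biprod C (Ob X i) (Ob Y i)) = Idn C (Ob (complex_sum C X Y) i)"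
    if "i \<le> n + 1" for i using that by (simp add: is_complexD[OF X'(1)] is_complexD[OF Y'(1)] arr)
  have "n_kernel C n (complex_sum C X Y)"
    by (rule n_kernel_of_sum[OF X'(2) Y'(2) cs s])
  moreover have "n_cokernel C n (complex_sum C X Y)"
    unfolding n_cokernel_iff_op
    by (rule additive_category.n_kernel_of_sum[OF additive_category_op
          X'(3)[unfolded n_cokernel_iff_op] Y'(3)[unfolded n_cokernel_iff_op] is_complex_crev[OF cs(1)]
          chain_map_crev[OF cs(4)] chain_map_crev[OF cs(5)] chain_map_crev[OF cs(2)] chain_map_crev[OF cs(3)]])
      (use s in simp)
  ultimately show ?thesis using cs(1) by (simp add: n_exact_sequence_def)
qed

text \<open>Around the identity differential the factorizations are immediate, and all other
  morphisms in question have zero source or target.\<close>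

lemma n_exact_id_complex:
  assumes n: "0 < n" and B: "B \<in> Obj C" and Z: "is_zero_object C Z"
  shows "n_exact_sequence C n (id_complex C B Z)"
proof -
  let ?I = "id_complex C B Z"
  have ZO: "Z \<in> Obj C" using Z by (simp add: is_zero_object_def)
  have Ob: "Ob ?I i \<in> Obj C" for i using B ZO by (simp add: id_complex_def)
  have D: "Diff ?I i \<in> Arr C" "Dom C (Diff ?I i) = Ob ?I i" "Cod C (Diff ?I i) = Ob ?I (Suc i)" for i
    using B ZO by (auto simp: id_complex_def arr)
  have DS: "Diff ?I (Suc i) = Zero C (Ob ?I (Suc i)) Z" for i by (cases i) simp_all
  have Obm: "0 < i \<Longrightarrow> Ob ?I (Suc i) = Z" for i by (cases i) simp_all
  have z: "u = Zero C (Dom C u) (Cod C u)" if "u \<in> Arr C" "Dom C u = Z \<or> Cod C u = Z" for u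
    by (rule zero_object_arr[OF Z that])
  have cx: "is_complex C (n + 1) ?I"
    by (rule is_complexI) (use B ZO Ob D in \<open>simp_all add: DS arr\<close>)
  have "n_kernel C n ?I"
  proof (rule n_kernelI[OF cx])
    fix i u assume i: "i < n" and u: "u \<in> Arr C" "Cod C u = Ob ?I (Suc i)"
    show "\<exists>v\<in>Arr C. Dom C v = Dom C u \<and> Cod C v = Ob ?I i \<and> Diff ?I i \<cdot> v = u"
    proof (cases i)
      case 0
      thus ?thesis using u by (intro bexI[of _ u]) (simp_all add: arr)
    next
      case (Suc j)
      hence "u = Zero C (Dom C u) Z" using z[of u] u by simp
      thus ?thesis using Suc u Ob[of "Suc j"] ZO
        by (intro bexI[of _ "Zero C (Dom C u) (Ob ?I i)"]) (simp_all add: arr DS)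
    qed
  qed (use B in \<open>simp add: arr\<close>)
  moreover have "n_cokernel C n ?I"
  proof (rule n_cokernelI[OF cx])
    fix u assume "u \<in> Arr C" "Dom C u = Ob ?I (n + 1)"
    thus "u = Zero C (Ob ?I (n + 1)) (Cod C u)" using z[of u] n Obm[of n] by auto
  next
    fix i u assume i: "i < n" and u: "u \<in> Arr C" "Dom C u = Ob ?I (Suc i)" "u \<cdot> Diff ?I i = Zero C (Ob ?I i) (Cod C u)"
    have "u = Zero C (Ob ?I (Suc i)) (Cod C u)"
    proof (cases i)
      case 0 thus ?thesis using u by (simp add: arr)
    next
      case (Suc j) thus ?thesis using z[of u] u by simp
    qed
    thus "\<exists>v\<in>Arr C. Dom C v = Ob ?I (Suc (Suc i)) \<and> Cod C v = Cod C u \<and> v \<cdot> Diff ?I (Suc i) = u"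
      using u(1) ZO Ob[of "Suc i"] by (intro bexI[of _ "Zero C Z (Cod C u)"]) (simp_all add: arr DS)
  qed
  ultimately show ?thesis using cx by (simp add: n_exact_sequence_def)
qed

lemma is_iso_in1:
  assumes Z: "is_zero_object C Z" and A: "A \<in> Obj C"
  shows "is_iso C (in1 (biprod C A Z))"
proof -
  have ZO: "Z \<in> Obj C" using Z by (simp add: is_zero_object_def)
  have "pr2 (biprod C A Z) = Zero C (bobj (biprod C A Z)) Z"
    using zero_object_arr[OF Z, of "pr2 (biprod C A Z)"] A ZO by (simp add: arr)
  hence "in1 (biprod C A Z) \<cdot> pr1 (biprod C A Z) = Idn C (bobj (biprod C A Z))"
    using biprod_arr(18)[OF A ZO] A ZO by (simp add: arr del: biprod_arr(18))
  thus ?thesis by (intro is_isoI[of _ "pr1 (biprod C A Z)"]) (use A ZO in \<open>simp_all add: arr\<close>)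
qed

lemma is_iso_in2:
  assumes Z: "is_zero_object C Z" and A: "A \<in> Obj C"
  shows "is_iso C (in2 (biprod C Z A))"
proof -
  have ZO: "Z \<in> Obj C" using Z by (simp add: is_zero_object_def)
  have "pr1 (biprod C Z A) = Zero C (bobj (biprod C Z A)) Z"
    using zero_object_arr[OF Z, of "pr1 (biprod C Z A)"] A ZO by (simp add: arr)
  hence "in2 (biprod C Z A) \<cdot> pr2 (biprod C Z A) = Idn C (bobj (biprod C Z A))"
    using biprod_arr(18)[OF ZO A] A ZO by (simp add: arr del: biprod_arr(18))
  thus ?thesis by (intro is_isoI[of _ "pr2 (biprod C Z A)"]) (use A ZO in \<open>simp_all add: arr\<close>)
qed

lemma fixed_end_mapI:
  assumes "chain_map C (n + 1) X Y f" "f 0 = Idn C A" "f (n + 1) = Idn C B" "A \<in> Obj C" "B \<in> Obj C"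
  shows "fixed_end_map C n X Y f"
  using chain_map_Idn_ends(1)[OF assms(1) _ assms(2)] chain_map_Idn_ends(1)[OF assms(1) _ assms(3)] assms
  by (simp add: fixed_end_map_def)

end

section \<open>Evaluation of the extension maps; admissibility of direct sums\<close>

context pos_n_exact_category
begin

text \<open>The completed pushout of \<open>X\<close> along the common component 0 maps to
  \<open>Y\<close> and to \<open>Z\<close> with identities at both ends.\<close>

lemma push_unique:
  assumes "X \<in> \<X>" "Y \<in> \<X>" "Z \<in> \<X>"
    and f: "chain_map C (n + 1) X Y f" "f (n + 1) = Idn C (Ob X (n + 1))"
    and g: "chain_map C (n + 1) X Z g" "g (n + 1) = Idn C (Ob X (n + 1))" and eq: "f 0 = g 0"
  shows "hclass C n Y = hclass C n Z"
proof -
  have f0: "f 0 \<in> Arr C" "Dom C (f 0) = Ob X 0" using chain_mapD[OF f(1), of 0] by auto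
  obtain E where E: "E \<in> \<X>" and uni: "\<And>T \<psi>. \<lbrakk>is_complex C (n + 1) T; chain_map C (n + 1) X T \<psi>; \<psi> 0 = f 0\<rbrakk> \<Longrightarrow>
      \<exists>\<chi>. chain_map C (n + 1) E T \<chi> \<and> \<chi> 0 = Idn C (Ob E 0) \<and> \<chi> (n + 1) = \<psi> (n + 1)"
    using push_exists[OF assms(1) f0] by metis
  have *: "hclass C n E = hclass C n T"
    if T: "T \<in> \<X>" "chain_map C (n + 1) X T \<psi>" "\<psi> 0 = f 0" "\<psi> (n + 1) = Idn C (Ob X (n + 1))" for T \<psi>
  proof -
    obtain \<chi> where "chain_map C (n + 1) E T \<chi>" "\<chi> 0 = Idn C (Ob E 0)" "\<chi> (n + 1) = Idn C (Ob X (n + 1))"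
      using uni[OF X_complex[OF T(1)] T(2,3)] T(4) by auto
    hence "fixed_end_map C n E T \<chi>"
      by (rule fixed_end_mapI) (simp_all add: is_complexD(1)[OF X_complex] E assms(1))
    thus ?thesis using hclass_eq_iff[OF E T(1)] by blast
  qed
  show ?thesis using *[OF assms(2) f(1) _ f(2)] *[OF assms(3) g(1) _ g(2)] eq by simp
qed

lemma pull_unique:
  assumes "X \<in> \<X>" "Y \<in> \<X>" "Z \<in> \<X>"
    and f: "chain_map C (n + 1) Y X f" "f 0 = Idn C (Ob X 0)"
    and g: "chain_map C (n + 1) Z X g" "g 0 = Idn C (Ob X 0)" and eq: "f (n + 1) = g (n + 1)"
  shows "hclass C n Y = hclass C n Z"
proof -
  have f0: "f (n + 1) \<in> Arr C" "Cod C (f (n + 1)) = Ob X (n + 1)" using chain_mapD[OF f(1), of "n + 1"] by auto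
  obtain E where E: "E \<in> \<X>" and uni: "\<And>T \<psi>. \<lbrakk>is_complex C (n + 1) T; chain_map C (n + 1) T X \<psi>; \<psi> (n + 1) = f (n + 1)\<rbrakk> \<Longrightarrow>
      \<exists>\<chi>. chain_map C (n + 1) T E \<chi> \<and> \<chi> (n + 1) = Idn C (Ob E (n + 1)) \<and> \<chi> 0 = \<psi> 0"
    using pull_exists[OF assms(1) f0] by metis
  have *: "hclass C n T = hclass C n E"
    if T: "T \<in> \<X>" "chain_map C (n + 1) T X \<psi>" "\<psi> (n + 1) = f (n + 1)" "\<psi> 0 = Idn C (Ob X 0)" for T \<psi>
  proof -
    obtain \<chi> where "chain_map C (n + 1) T E \<chi>" "\<chi> 0 = Idn C (Ob X 0)" "\<chi> (n + 1) = Idn C (Ob E (n + 1))"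
      using uni[OF X_complex[OF T(1)] T(2,3)] T(4) by auto
    hence "fixed_end_map C n T E \<chi>"
      by (rule fixed_end_mapI) (simp_all add: is_complexD(1)[OF X_complex] E assms(1))
    thus ?thesis using hclass_eq_iff[OF T(1) E] by blast
  qed
  show ?thesis using *[OF assms(2) f(1) _ f(2)] *[OF assms(3) g(1) _ g(2)] eq by simp
qed

text \<open>A genuine pushout exists and has the class of \<open>Y\<close> by
  \<open>push_unique\<close>, so \<open>f\<close> need not be one itself. Another representative of
  the class of \<open>X\<close> is reached by composing with a fixed-end map out of
  \<open>X\<close>.\<close>

lemma ext_push_eq:
  assumes X: "X \<in> \<X>" and Y: "Y \<in> \<X>"
    and f: "chain_map C (n + 1) X Y f" "f (n + 1) = Idn C (Ob X (n + 1))"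
  shows "ext_push C n \<X> (f 0) (hclass C n X) = hclass C n Y"
  unfolding ext_push_def
proof (rule the_equality)
  have f0: "f 0 \<in> Arr C" "Dom C (f 0) = Ob X 0" using chain_mapD[OF f(1), of 0] by auto
  obtain E \<epsilon> where E: "E \<in> \<X>" and \<epsilon>: "chain_map C (n + 1) X E \<epsilon>" "\<epsilon> 0 = f 0" "\<epsilon> (n + 1) = Idn C (Ob X (n + 1))"
    "n_pushout C n X (f 0) E \<epsilon>"
    by (rule push_exists[OF X f0])
  have "hclass C n Y = hclass C n E" by (rule push_unique[OF X Y E f \<epsilon>(1,3)]) (use \<epsilon>(2) in simp)
  thus "\<exists>X'\<in>\<X>. \<exists>Y'\<in>\<X>. \<exists>\<phi>. hclass C n X = hclass C n X' \<and> hclass C n Y = hclass C n Y' \<and>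
     chain_map C (n + 1) X' Y' \<phi> \<and> n_pushout C n X' (f 0) Y' \<phi> \<and> \<phi> (n + 1) = Idn C (Ob X' (n + 1))"
    using X E \<epsilon> by blast
next
  fix \<delta> assume "\<exists>X'\<in>\<X>. \<exists>Y'\<in>\<X>. \<exists>\<phi>. hclass C n X = hclass C n X' \<and> \<delta> = hclass C n Y' \<and>
     chain_map C (n + 1) X' Y' \<phi> \<and> n_pushout C n X' (f 0) Y' \<phi> \<and> \<phi> (n + 1) = Idn C (Ob X' (n + 1))"
  then obtain X' Y' \<phi> where X': "X' \<in> \<X>" and Y': "Y' \<in> \<X>" and eq: "hclass C n X = hclass C n X'"
    and \<delta>: "\<delta> = hclass C n Y'" and \<phi>: "chain_map C (n + 1) X' Y' \<phi>" "\<phi> 0 = f 0" "\<phi> (n + 1) = Idn C (Ob X' (n + 1))"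
    by (auto simp: n_pushout_def)
  obtain u where u: "fixed_end_map C n X X' u" using eq hclass_eq_iff[OF X X'] by blast
  hence u': "chain_map C (n + 1) X X' u" "u 0 = Idn C (Ob X 0)" "u (n + 1) = Idn C (Ob X (n + 1))"
    by (auto simp: fixed_end_map_def)
  note ends = fixed_end_map_ends[OF u X_complex[OF X]]
  note [simp] = is_complexD[OF X_complex[OF X]] chain_mapD[OF f(1)]
  have "hclass C n Y = hclass C n Y'"
    by (rule push_unique[OF X Y Y' f chain_map_comp[OF u'(1) \<phi>(1)]])
      (use X_complex X X' Y' u' \<phi> ends in \<open>simp_all add: arr\<close>)
  thus "\<delta> = hclass C n Y" using \<delta> by simp
qed

text \<open>Dual to \<open>ext_push_eq\<close>. Chain maps now end in \<open>X\<close>, so the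
  fixed-end map between representatives must run towards \<open>X\<close>.\<close>

lemma ext_pull_eq:
  assumes X: "X \<in> \<X>" and Y: "Y \<in> \<X>"
    and f: "chain_map C (n + 1) Y X f" "f 0 = Idn C (Ob X 0)"
  shows "ext_pull C n \<X> (f (n + 1)) (hclass C n X) = hclass C n Y"
  unfolding ext_pull_def
proof (rule the_equality)
  have f0: "f (n + 1) \<in> Arr C" "Cod C (f (n + 1)) = Ob X (n + 1)" using chain_mapD[OF f(1), of "n + 1"] by auto
  obtain E \<epsilon> where E: "E \<in> \<X>" and \<epsilon>: "chain_map C (n + 1) E X \<epsilon>" "\<epsilon> 0 = Idn C (Ob X 0)" "\<epsilon> (n + 1) = f (n + 1)"
    "n_pullback C n (cshift X) (f (n + 1)) (cshift E) (\<lambda>i. \<epsilon> (Suc i))"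
    by (rule pull_exists[OF X f0])
  have "hclass C n Y = hclass C n E" by (rule pull_unique[OF X Y E f \<epsilon>(1,2)]) (use \<epsilon>(3) in simp)
  thus "\<exists>X'\<in>\<X>. \<exists>Y'\<in>\<X>. \<exists>\<phi>. hclass C n X = hclass C n X' \<and> hclass C n Y = hclass C n Y' \<and>
     chain_map C (n + 1) Y' X' \<phi> \<and> \<phi> 0 = Idn C (Ob X' 0) \<and>
     n_pullback C n (cshift X') (f (n + 1)) (cshift Y') (\<lambda>i. \<phi> (Suc i))"
    using X E \<epsilon> by blast
next
  fix \<delta> assume "\<exists>X'\<in>\<X>. \<exists>Y'\<in>\<X>. \<exists>\<phi>. hclass C n X = hclass C n X' \<and> \<delta> = hclass C n Y' \<and>
     chain_map C (n + 1) Y' X' \<phi> \<and> \<phi> 0 = Idn C (Ob X' 0) \<and>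
     n_pullback C n (cshift X') (f (n + 1)) (cshift Y') (\<lambda>i. \<phi> (Suc i))"
  then obtain X' Y' \<phi> where X': "X' \<in> \<X>" and Y': "Y' \<in> \<X>" and eq: "hclass C n X = hclass C n X'"
    and \<delta>: "\<delta> = hclass C n Y'" and \<phi>: "chain_map C (n + 1) Y' X' \<phi>" "\<phi> 0 = Idn C (Ob X' 0)" "\<phi> (n + 1) = f (n + 1)"
    by (auto simp: n_pullback_def)
  obtain u where u: "fixed_end_map C n X' X u" using eq hclass_eq_iff[OF X' X] by metis
  hence u': "chain_map C (n + 1) X' X u" "u 0 = Idn C (Ob X' 0)" "u (n + 1) = Idn C (Ob X' (n + 1))"
    by (auto simp: fixed_end_map_def)
  note ends = fixed_end_map_ends[OF u X_complex[OF X']]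
  note [simp] = is_complexD[OF X_complex[OF X]] is_complexD[OF X_complex[OF X']] chain_mapD[OF f(1)]
  have "hclass C n Y = hclass C n Y'"
    by (rule pull_unique[OF X Y Y' f chain_map_comp[OF \<phi>(1) u'(1)]])
      (use X_complex X X' Y' u' \<phi> ends in \<open>simp_all add: arr\<close>)
  thus "\<delta> = hclass C n Y" using \<delta> by simp
qed

text \<open>The pushout of \<open>S\<close> along \<open>\<phi> 0\<close> maps to \<open>P\<close>
  with last component \<open>\<phi> (n + 1)\<close>. Its pullback along \<open>g\<close> then maps
  to \<open>P\<close> with the same end components as \<open>Q\<close>, so
  \<open>pull_unique\<close> applies. Leaving \<open>\<phi> (n + 1)\<close> general is what
  accommodates the comparison of direct sums.\<close>

lemma ext_map_eq:
  assumes S: "S \<in> \<X>" and P: "P \<in> \<X>" and Q: "Q \<in> \<X>"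
    and \<phi>: "chain_map C (n + 1) S P \<phi>"
    and \<psi>: "chain_map C (n + 1) Q P \<psi>" "\<psi> 0 = Idn C (Ob P 0)"
    and g: "g \<in> Arr C" "Cod C g = Ob S (n + 1)" "\<phi> (n + 1) \<cdot> g = \<psi> (n + 1)"
  shows "ext_map C n \<X> g (\<phi> 0) (hclass C n S) = hclass C n Q"
proof -
  have f0: "\<phi> 0 \<in> Arr C" "Dom C (\<phi> 0) = Ob S 0" using chain_mapD[OF \<phi>, of 0] by auto
  obtain E \<epsilon> where E: "E \<in> \<X>" and \<epsilon>: "chain_map C (n + 1) S E \<epsilon>" "\<epsilon> 0 = \<phi> 0" "\<epsilon> (n + 1) = Idn C (Ob S (n + 1))"
    and uni: "\<And>T \<psi>. \<lbrakk>is_complex C (n + 1) T; chain_map C (n + 1) S T \<psi>; \<psi> 0 = \<phi> 0\<rbrakk> \<Longrightarrow>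
      \<exists>\<chi>. chain_map C (n + 1) E T \<chi> \<and> \<chi> 0 = Idn C (Ob E 0) \<and> \<chi> (n + 1) = \<psi> (n + 1)"
    using push_exists[OF S f0] by metis
  obtain \<chi> where \<chi>: "chain_map C (n + 1) E P \<chi>" "\<chi> 0 = Idn C (Ob E 0)" "\<chi> (n + 1) = \<phi> (n + 1)"
    using uni[OF X_complex[OF P] \<phi>] by blast
  note [simp] = is_complexD[OF X_complex[OF S]] is_complexD[OF X_complex[OF E]]
  have ends: "Ob P 0 = Ob E 0" "Ob E (n + 1) = Ob S (n + 1)"
    using chain_map_Idn_ends(2)[OF \<chi>(1) _ \<chi>(2)] chain_map_Idn_ends(2)[OF \<epsilon>(1) _ \<epsilon>(3)] by simp_all
  obtain R \<rho> where R: "R \<in> \<X>" and \<rho>: "chain_map C (n + 1) R E \<rho>" "\<rho> 0 = Idn C (Ob E 0)" "\<rho> (n + 1) = g"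
    by (rule pull_exists[OF E, of g]) (use g ends in auto)
  have "ext_push C n \<X> (\<phi> 0) (hclass C n S) = hclass C n E"
    using ext_push_eq[OF S E \<epsilon>(1,3)] \<epsilon>(2) by simp
  moreover have "ext_pull C n \<X> g (hclass C n E) = hclass C n R"
    using ext_pull_eq[OF E R \<rho>(1,2)] \<rho>(3) by simp
  moreover have "hclass C n R = hclass C n Q"
    by (rule pull_unique[OF P R Q chain_map_comp[OF \<rho>(1) \<chi>(1)] _ \<psi>])
      (use X_complex R E P \<rho> \<chi> \<psi> g ends in \<open>simp_all add: arr\<close>)
  ultimately show ?thesis by (simp add: ext_map_def)
qed

text \<open>As n is positive, the added sequence ends in zero, so the inclusion of \<open>X\<close>
  is an isomorphism in the last degree. The pushout of \<open>X\<close> along component 0 of this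
  inclusion maps to the sum with an identity in degree 0 and that isomorphism in degree n + 1, hence
  weakly isomorphically.\<close>

lemma complex_sum_id_complex:
  assumes X: "X \<in> \<X>" and B: "B \<in> Obj C" and Z: "is_zero_object C Z"
  shows "complex_sum C X (id_complex C B Z) \<in> \<X>" "complex_sum C (id_complex C B Z) X \<in> \<X>"
proof -
  note ex = n_exact_id_complex[OF n_pos B Z]
  have cx: "is_complex C (n + 1) (id_complex C B Z)" using ex by (simp add: n_exact_sequence_def)
  have last: "Ob (id_complex C B Z) (Suc n) = Z" using n_pos by (cases n) simp_all
  note [simp] = is_complexD[OF X_complex[OF X]]
  have *: "T \<in> \<X>" if T: "n_exact_sequence C n T" and i: "chain_map C (n + 1) X T i" and iso: "is_iso C (i (n + 1))" for T i
  proof -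
    have f0: "i 0 \<in> Arr C" "Dom C (i 0) = Ob X 0" using chain_mapD[OF i, of 0] by auto
    have Tx: "is_complex C (n + 1) T" using T by (simp add: n_exact_sequence_def)
    obtain E where E: "E \<in> \<X>" and uni: "\<And>T \<psi>. \<lbrakk>is_complex C (n + 1) T; chain_map C (n + 1) X T \<psi>; \<psi> 0 = i 0\<rbrakk> \<Longrightarrow>
      \<exists>\<chi>. chain_map C (n + 1) E T \<chi> \<and> \<chi> 0 = Idn C (Ob E 0) \<and> \<chi> (n + 1) = \<psi> (n + 1)"
      using push_exists[OF X f0] by metis
    obtain \<chi> where \<chi>: "chain_map C (n + 1) E T \<chi>" "\<chi> 0 = Idn C (Ob E 0)" "\<chi> (n + 1) = i (n + 1)"
      using uni[OF Tx i] by blast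
    have "weak_iso C n E T \<chi>"
      using T \<X>_n_exact[OF E] \<chi> iso is_complexD(1)[OF X_complex[OF E]] unfolding weak_iso_def
      by (auto intro!: exI[of _ "n + 1"] is_iso_Idn)
    thus "T \<in> \<X>" using weak_iso_closed[OF E] by (auto simp: weakly_isomorphic_def)
  qed
  show "complex_sum C X (id_complex C B Z) \<in> \<X>"
    by (rule *[OF n_exact_complex_sum[OF \<X>_n_exact[OF X] ex] chain_map_in1[OF X_complex[OF X] cx]])
      (simp add: last is_iso_in1[OF Z])
  show "complex_sum C (id_complex C B Z) X \<in> \<X>"
    by (rule *[OF n_exact_complex_sum[OF ex \<X>_n_exact[OF X]] chain_map_in2[OF cx X_complex[OF X]]])
      (simp add: last is_iso_in2[OF Z])
qed

text \<open>The first differential of \<open>X \<oplus> Y\<close> is the composite of \<open>Diff X 0 \<oplus> 1\<close> and \<open>1 \<oplus> Diff Y 0\<close>, both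
  admissible by the previous lemma; an admissible and an \<open>n\<close>-exact sequence with the same first
  differential are weakly isomorphic.\<close>

theorem complex_sum_closed:
  assumes X: "X \<in> \<X>" and Y: "Y \<in> \<X>"
  shows "complex_sum C X Y \<in> \<X>"
proof -
  note Xc = X_complex[OF X] and Yc = X_complex[OF Y]
  note [simp] = is_complexD[OF Xc] is_complexD[OF Yc]
  obtain Z where Z: "is_zero_object C Z" using ex_zero_object by blast
  let ?T = "complex_sum C X (id_complex C (Ob Y 0) Z)" and ?U = "complex_sum C (id_complex C (Ob X (Suc 0)) Z) Y"
  let ?S = "complex_sum C X Y"
  have T: "?T \<in> \<X>" and U: "?U \<in> \<X>" using complex_sum_id_complex X Y Z by simp_all
  have ids: "is_complex C (n + 1) (id_complex C B Z)" if "B \<in> Obj C" for B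
    using n_exact_id_complex[OF n_pos that Z] by (simp add: n_exact_sequence_def)
  have T0: "Diff ?T 0 = dsum C (Diff X 0) (Idn C (Ob Y 0))"
    using complex_sum_Diff[OF Xc ids, of "Ob Y 0" 0] by simp
  have U0: "Diff ?U 0 = dsum C (Idn C (Ob X (Suc 0))) (Diff Y 0)"
    using complex_sum_Diff[OF ids Yc, of "Ob X (Suc 0)" 0] by simp
  have S0: "Diff ?S 0 = dsum C (Diff X 0) (Diff Y 0)"
    using complex_sum_Diff[OF Xc Yc, of 0] by simp
  have "adm_mono \<X> (Diff ?U 0 \<cdot> Diff ?T 0)"
  proof (rule E1)
    show "adm_mono \<X> (Diff ?T 0)" "adm_mono \<X> (Diff ?U 0)" using T U unfolding adm_mono_def by blast+
    show "Cod C (Diff ?T 0) = Dom C (Diff ?U 0)" unfolding T0 U0 by (simp add: arr)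
  qed
  moreover have "Diff ?U 0 \<cdot> Diff ?T 0 = Diff ?S 0"
    by (simp add: T0 U0 S0 dsum_comp arr)
  ultimately obtain W where W: "W \<in> \<X>" "Diff W 0 = Diff ?S 0" by (auto simp: adm_mono_def)
  have Sx: "n_exact_sequence C n ?S" by (rule n_exact_complex_sum[OF \<X>_n_exact[OF X] \<X>_n_exact[OF Y]])
  have Sc: "is_complex C (n + 1) ?S" using Sx by (simp add: n_exact_sequence_def)
  have W01: "Ob W 0 = Ob ?S 0" "Ob W 1 = Ob ?S 1"
    using W(2) is_complexD(3,4)[OF X_complex[OF W(1)], of 0] is_complexD(3,4)[OF Sc, of 0] by auto
  have ObS: "Ob ?S 0 \<in> Obj C" "Ob ?S 1 \<in> Obj C" using is_complexD(1)[OF Sc] n_pos by auto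
  obtain f where f: "chain_map C (n + 1) W ?S f" "f 0 = Idn C (Ob ?S 0)" "f 1 = Idn C (Ob ?S 1)"
    by (rule comparison[OF X_cokernel[OF W(1)] Sc, of "Idn C (Ob ?S 0)" "Idn C (Ob ?S 1)"])
      (use W W01 ObS is_complexD[OF Sc] in \<open>simp_all add: arr del: complex_sum_Ob\<close>)
  have "weak_iso C n W ?S f"
    unfolding weak_iso_def using \<X>_n_exact[OF W(1)] Sx f ObS
    by (auto intro!: exI[of _ 0] is_iso_Idn simp del: complex_sum_Ob)
  thus ?thesis using weak_iso_closed[OF W(1)] by (auto simp: weakly_isomorphic_def)
qed

lemma hclass_complex_sum_cong:
  assumes "X \<in> \<X>" "X' \<in> \<X>" "Y \<in> \<X>" "Y' \<in> \<X>" "hclass C n X = hclass C n X'" "hclass C n Y = hclass C n Y'"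
  shows "hclass C n (complex_sum C X Y) = hclass C n (complex_sum C X' Y')"
proof -
  obtain f where f: "fixed_end_map C n X X' f" using hclass_eq_iff assms by metis
  obtain g where g: "fixed_end_map C n Y Y' g" using hclass_eq_iff assms by metis
  have ch: "chain_map C (n + 1) (complex_sum C X Y) (complex_sum C X' Y') (\<lambda>i. dsum C (f i) (g i))"
    using chain_map_sum X_complex assms(1-4) f g by (simp add: fixed_end_map_def)
  have "fixed_end_map C n (complex_sum C X Y) (complex_sum C X' Y') (\<lambda>i. dsum C (f i) (g i))"
    unfolding fixed_end_map_def
    using ch f g is_complexD(1)[OF X_complex[OF assms(1)]] is_complexD(1)[OF X_complex[OF assms(3)]]
    by (auto simp: fixed_end_map_def dsum_Idn)
  thus ?thesis using hclass_eq_iff complex_sum_closed assms(1-4) by metis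
qed

lemma baer_sum_eq:
  assumes X: "X \<in> \<X>" and Y: "Y \<in> \<X>"
  shows "baer_sum C n \<X> B A (hclass C n X) (hclass C n Y) =
    ext_map C n \<X> (diagonal C B) (codiagonal C A) (hclass C n (complex_sum C X Y))"
  unfolding baer_sum_def
proof (rule the_equality, goal_cases)
  case 1
  show ?case using X Y by blast
next
  case (2 \<zeta>)
  then obtain X' Y' where "X' \<in> \<X>" "Y' \<in> \<X>" "hclass C n X = hclass C n X'" "hclass C n Y = hclass C n Y'"
    and \<zeta>: "\<zeta> = ext_map C n \<X> (diagonal C B) (codiagonal C A) (hclass C n (complex_sum C X' Y'))"
    by blast
  hence "hclass C n (complex_sum C X Y) = hclass C n (complex_sum C X' Y')"
    by (intro hclass_complex_sum_cong X Y)
  thus ?case using \<zeta> by simp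
qed

end

section \<open>Additive functors\<close>

lemma map_complex_sel [simp]:
  "Ob (map_complex F X) i = FOb F (Ob X i)" "Diff (map_complex F X) i = FArr F (Diff X i)"
  by (simp_all add: map_complex_def)

locale additive_functor_between = C: additive_category C + D: additive_category C'
  for C :: "('o, 'm) precat" and C' :: "('p, 'q) precat" +
  fixes F :: "('o, 'm, 'p, 'q) func_data"
  assumes F: "additive_functor C C' F"
begin

lemma FOb_Obj: "A \<in> Obj C \<Longrightarrow> FOb F A \<in> Obj C'"
  using F by (simp add: additive_functor_def)

lemma FArr_hom:
  assumes "f \<in> Arr C"
  shows "FArr F f \<in> Arr C'" "Dom C' (FArr F f) = FOb F (Dom C f)" "Cod C' (FArr F f) = FOb F (Cod C f)"
proof -
  have "FArr F \<in> hom (HomGrp C (Dom C f) (Cod C f)) (HomGrp C' (FOb F (Dom C f)) (FOb F (Cod C f)))"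
    using F assms C.Dom_Obj C.Cod_Obj by (simp add: additive_functor_def)
  hence "FArr F f \<in> Hom C' (FOb F (Dom C f)) (FOb F (Cod C f))"
    using assms by (auto simp: hom_def HomGrp_def)
  thus "FArr F f \<in> Arr C'" "Dom C' (FArr F f) = FOb F (Dom C f)" "Cod C' (FArr F f) = FOb F (Cod C f)"
    by auto
qed

lemma FArr_Idn: "A \<in> Obj C \<Longrightarrow> FArr F (Idn C A) = Idn C' (FOb F A)"
  using F by (simp add: additive_functor_def)

lemma FArr_comp:
  "f \<in> Arr C \<Longrightarrow> g \<in> Arr C \<Longrightarrow> Cod C f = Dom C g \<Longrightarrow> FArr F (Comp C g f) = Comp C' (FArr F g) (FArr F f)"
  using F by (simp add: additive_functor_def)

lemma FArr_plus:
  assumes "f \<in> Arr C" "g \<in> Arr C" "Dom C f = Dom C g" "Cod C f = Cod C g"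
  shows "FArr F (Plus C f g) = Plus C' (FArr F f) (FArr F g)"
proof -
  have "FArr F \<in> hom (HomGrp C (Dom C g) (Cod C g)) (HomGrp C' (FOb F (Dom C g)) (FOb F (Cod C g)))"
    using F assms C.Dom_Obj C.Cod_Obj by (simp add: additive_functor_def)
  thus ?thesis using assms by (auto simp: hom_def HomGrp_def)
qed

lemma FArr_Zero:
  assumes "A \<in> Obj C" "B \<in> Obj C"
  shows "FArr F (Zero C A B) = Zero C' (FOb F A) (FOb F B)"
proof -
  let ?Z = "Zero C A B"
  have Z: "?Z \<in> Arr C" "Dom C ?Z = A" "Cod C ?Z = B" "Plus C ?Z ?Z = ?Z"
    using assms by (simp_all add: C.zero_arr C.plus_zero)
  have "Plus C' (FArr F ?Z) (FArr F ?Z) = FArr F ?Z"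
    using FArr_plus[of ?Z ?Z] Z by simp
  thus ?thesis using D.idem_zero[of "FArr F ?Z"] FArr_hom[of ?Z] Z by simp
qed

lemmas F_simps = FOb_Obj FArr_hom FArr_Idn FArr_comp FArr_plus FArr_Zero

lemma is_complex_map:
  assumes "is_complex C N X"
  shows "is_complex C' N (map_complex F X)"
  by (rule is_complexI) (simp_all add: is_complexD[OF assms] F_simps flip: FArr_comp)

lemma chain_map_map:
  assumes f: "chain_map C N X Y f" and X: "is_complex C N X" and Y: "is_complex C N Y"
  shows "chain_map C' N (map_complex F X) (map_complex F Y) (\<lambda>i. FArr F (f i))"
  by (rule chain_mapI)
    (simp_all add: is_complexD[OF X] is_complexD[OF Y] chain_mapD[OF f] F_simps flip: FArr_comp)

lemma fixed_end_map_map: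
  assumes f: "fixed_end_map C n X Y f" and X: "is_complex C (n + 1) X" and Y: "is_complex C (n + 1) Y"
  shows "fixed_end_map C' n (map_complex F X) (map_complex F Y) (\<lambda>i. FArr F (f i))"
  using chain_map_map[OF _ X Y] f is_complexD(1)[OF X] by (simp add: fixed_end_map_def FArr_Idn)

text \<open>Canonical morphism from the chosen sum of the images to the image of the chosen sum; F
  commutes with the chosen direct sums only up to it.\<close>

definition sum_comparison :: "'o \<Rightarrow> 'o \<Rightarrow> 'q" where
  "sum_comparison A B = row C' (FArr F (in1 (biprod C A B))) (FArr F (in2 (biprod C A B)))"

lemma sum_comparison_arr:
  assumes "A \<in> Obj C" "B \<in> Obj C"
  shows "sum_comparison A B \<in> Arr C'" "Dom C' (sum_comparison A B) = bobj (biprod C' (FOb F A) (FOb F B))"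
    "Cod C' (sum_comparison A B) = FOb F (bobj (biprod C A B))"
  using assms by (simp_all add: sum_comparison_def F_simps arr)

lemma chain_map_sum_comparison:
  assumes X: "is_complex C N X" and Y: "is_complex C N Y"
  shows "chain_map C' N (complex_sum C' (map_complex F X) (map_complex F Y)) (map_complex F (complex_sum C X Y))
    (\<lambda>i. sum_comparison (Ob X i) (Ob Y i))"
proof (rule chain_mapI)
  note [simp] = is_complexD[OF X] is_complexD[OF Y] C.complex_sum_Diff[OF X Y]
    D.complex_sum_Diff[OF is_complex_map[OF X] is_complex_map[OF Y]]
  fix i assume i: "i < N"
  let ?A = "Ob X i" and ?B = "Ob Y i" and ?A' = "Ob X (Suc i)" and ?B' = "Ob Y (Suc i)"
  show "Comp C' (sum_comparison ?A' ?B') (Diff (complex_sum C' (map_complex F X) (map_complex F Y)) i) =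
    Comp C' (Diff (map_complex F (complex_sum C X Y)) i) (sum_comparison ?A ?B)"
  proof (rule D.biprod_eqI[of _ _ "FOb F ?A" "FOb F ?B"])
    show "Comp C' (Comp C' (sum_comparison ?A' ?B') (Diff (complex_sum C' (map_complex F X) (map_complex F Y)) i))
        (in1 (biprod C' (FOb F ?A) (FOb F ?B))) =
      Comp C' (Comp C' (Diff (map_complex F (complex_sum C X Y)) i) (sum_comparison ?A ?B))
        (in1 (biprod C' (FOb F ?A) (FOb F ?B)))"
      using i by (simp add: sum_comparison_def F_simps arr flip: FArr_comp)
    show "Comp C' (Comp C' (sum_comparison ?A' ?B') (Diff (complex_sum C' (map_complex F X) (map_complex F Y)) i))
        (in2 (biprod C' (FOb F ?A) (FOb F ?B))) =
      Comp C' (Comp C' (Diff (map_complex F (complex_sum C X Y)) i) (sum_comparison ?A ?B))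
        (in2 (biprod C' (FOb F ?A) (FOb F ?B)))"
      using i by (simp add: sum_comparison_def F_simps arr flip: FArr_comp)
  qed (use i in \<open>simp_all add: sum_comparison_arr F_simps arr\<close>)
qed (simp_all add: sum_comparison_arr is_complexD[OF X] is_complexD[OF Y])

text \<open>Together with the identity for codiagonals, this supplies the end conditions under which
  one pair of chain maps computes the Baer sum on both sides.\<close>

lemma sum_comparison_diagonal:
  assumes "A \<in> Obj C"
  shows "Comp C' (sum_comparison A A) (diagonal C' (FOb F A)) = FArr F (diagonal C A)"
  using assms by (simp add: sum_comparison_def diagonal_def col_def F_simps arr)

lemma sum_comparison_codiagonal:
  assumes "A \<in> Obj C"
  shows "Comp C' (FArr F (codiagonal C A)) (sum_comparison A A) = codiagonal C' (FOb F A)"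
proof (rule D.biprod_eqI[of _ _ "FOb F A" "FOb F A"])
  show "Comp C' (Comp C' (FArr F (codiagonal C A)) (sum_comparison A A)) (in1 (biprod C' (FOb F A) (FOb F A))) =
    Comp C' (codiagonal C' (FOb F A)) (in1 (biprod C' (FOb F A) (FOb F A)))"
    "Comp C' (Comp C' (FArr F (codiagonal C A)) (sum_comparison A A)) (in2 (biprod C' (FOb F A) (FOb F A))) =
    Comp C' (codiagonal C' (FOb F A)) (in2 (biprod C' (FOb F A) (FOb F A)))"
    using assms by (simp_all add: sum_comparison_def codiagonal_def F_simps arr flip: FArr_comp)
qed (use assms in \<open>simp_all add: sum_comparison_arr codiagonal_def F_simps arr\<close>)

end

section \<open>The natural transformation on extensions\<close>

context pos_n_exact_category
begin

lemma ext_classesE: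
  assumes "\<delta> \<in> ext_classes C n \<X> B A"
  obtains X where "X \<in> \<X>" "Ob X 0 = A" "Ob X (n + 1) = B" "\<delta> = hclass C n X"
  using assms by (auto simp: ext_classes_def)

lemma hclass_in_ext_classes: "X \<in> \<X> \<Longrightarrow> hclass C n X \<in> ext_classes C n \<X> (Ob X (n + 1)) (Ob X 0)"
  by (auto simp: ext_classes_def)

text \<open>A complex lies in its own class, and the class of an admissible sequence has only
  admissible members.\<close>

lemma hclass_in_\<X>:
  assumes "X \<in> \<X>" "is_complex C (n + 1) Y" "hclass C n Y = hclass C n X"
  shows "Y \<in> \<X>"
proof -
  have "Y \<in> hclass C n Y"
    using assms(2) homotopy_equivalent_refl[OF assms(2)] by (simp add: hclass_def complexes_between_def)
  thus ?thesis using assms hclass_eq by simp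
qed

text \<open>Presents a value of \<open>ext_map\<close> by one pushout and one pullback, kept as
  chain maps so that F can be applied to them.\<close>

lemma ext_map_realization:
  assumes S: "S \<in> \<X>" and f: "f \<in> Arr C" "Dom C f = Ob S 0" and g: "g \<in> Arr C" "Cod C g = Ob S (n + 1)"
  obtains P Q \<phi> \<psi> where "P \<in> \<X>" "Q \<in> \<X>"
    "chain_map C (n + 1) S P \<phi>" "\<phi> 0 = f" "\<phi> (n + 1) = Idn C (Ob S (n + 1))"
    "chain_map C (n + 1) Q P \<psi>" "\<psi> 0 = Idn C (Ob P 0)" "\<psi> (n + 1) = g"
    "ext_map C n \<X> g f (hclass C n S) = hclass C n Q"
proof -
  obtain P \<phi> where P: "P \<in> \<X>" and \<phi>: "chain_map C (n + 1) S P \<phi>" "\<phi> 0 = f" "\<phi> (n + 1) = Idn C (Ob S (n + 1))"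
    by (rule push_exists[OF S f])
  have "Ob P (n + 1) = Ob S (n + 1)"
    using chain_map_Idn_ends(2)[OF \<phi>(1) _ \<phi>(3)] is_complexD(1)[OF X_complex[OF S]] by simp
  with g(2) obtain Q \<psi> where Q: "Q \<in> \<X>" and \<psi>: "chain_map C (n + 1) Q P \<psi>" "\<psi> 0 = Idn C (Ob P 0)" "\<psi> (n + 1) = g"
    using pull_exists[OF P g(1)] by metis
  have "ext_map C n \<X> g (\<phi> 0) (hclass C n S) = hclass C n Q"
    by (rule ext_map_eq[OF S P Q \<phi>(1) \<psi>(1,2) g]) (use \<phi>(3) \<psi>(3) g in \<open>simp add: arr\<close>)
  thus ?thesis using that[OF P Q \<phi> \<psi>] \<phi>(2) by simp
qed

end

locale n_exact_functor_between = additive_functor_between C C' F +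
    X: pos_n_exact_category C n \<X> + X': pos_n_exact_category C' n \<X>'
  for C :: "('o, 'm) precat" and C' :: "('p, 'q) precat" and F n \<X> \<X>' +
  assumes map_complex_closed: "X \<in> \<X> \<Longrightarrow> map_complex F X \<in> \<X>'"
begin

text \<open>The composite of \<sigma> with the image of \<phi> is fed into \<open>ext_map_eq\<close>
  over \<open>C'\<close>. For naturality \<sigma> is an identity; for Baer sums it is the comparison
  of direct sums.\<close>

lemma ext_map_map:
  assumes S: "S \<in> \<X>" and P: "P \<in> \<X>" and Q: "Q \<in> \<X>" and S': "S' \<in> \<X>'"
    and \<phi>: "chain_map C (n + 1) S P \<phi>" "\<phi> (n + 1) = Idn C (Ob S (n + 1))"
    and \<psi>: "chain_map C (n + 1) Q P \<psi>" "\<psi> 0 = Idn C (Ob P 0)"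
    and \<sigma>: "chain_map C' (n + 1) S' (map_complex F S) \<sigma>"
    and g: "g \<in> Arr C'" "Cod C' g = Ob S' (n + 1)" "Comp C' (\<sigma> (n + 1)) g = FArr F (\<psi> (n + 1))"
  shows "ext_map C' n \<X>' g (Comp C' (FArr F (\<phi> 0)) (\<sigma> 0)) (hclass C' n S') = hclass C' n (map_complex F Q)"
proof -
  note Sc = X.X_complex[OF S] and Pc = X.X_complex[OF P] and Qc = X.X_complex[OF Q]
  note [simp] = is_complexD[OF Sc] is_complexD[OF Pc] is_complexD[OF Qc] chain_mapD[OF \<sigma>]
  have c: "chain_map C' (n + 1) S' (map_complex F P) (\<lambda>i. Comp C' (FArr F (\<phi> i)) (\<sigma> i))"
    by (rule D.chain_map_comp[OF \<sigma> chain_map_map[OF \<phi>(1) Sc Pc] X'.X_complex[OF S'] is_complex_map[OF Sc] is_complex_map[OF Pc]])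
  show ?thesis
  proof (rule X'.ext_map_eq[OF S' map_complex_closed[OF P] map_complex_closed[OF Q] c chain_map_map[OF \<psi>(1) Qc Pc] _ g(1,2)])
    show "FArr F (\<psi> 0) = Idn C' (Ob (map_complex F P) 0)" using \<psi>(2) by (simp add: FArr_Idn)
    have "Comp C' (FArr F (\<phi> (n + 1))) (\<sigma> (n + 1)) = \<sigma> (n + 1)"
      using \<phi>(2) by (simp add: FArr_Idn arr)
    thus "Comp C' (Comp C' (FArr F (\<phi> (n + 1))) (\<sigma> (n + 1))) g = FArr F (\<psi> (n + 1))"
      using g(3) by simp
  qed
qed

definition \<Gamma> :: "'o \<Rightarrow> 'o \<Rightarrow> ('o, 'm) cochain set \<Rightarrow> ('p, 'q) cochain set" where
  "\<Gamma> B A \<delta> = hclass C' n (map_complex F (SOME X. X \<in> \<X> \<and> \<delta> = hclass C n X))"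

text \<open>Independence of the representative: F carries a fixed-end map to a fixed-end map between
  admissible sequences.\<close>

lemma \<Gamma>_eq:
  assumes X: "X \<in> \<X>"
  shows "\<Gamma> B A (hclass C n X) = hclass C' n (map_complex F X)"
proof -
  define Y where "Y = (SOME Y. Y \<in> \<X> \<and> hclass C n X = hclass C n Y)"
  have Y: "Y \<in> \<X>" "hclass C n X = hclass C n Y"
    using someI[of "\<lambda>Y. Y \<in> \<X> \<and> hclass C n X = hclass C n Y" X] X unfolding Y_def by auto
  obtain f where "fixed_end_map C n X Y f" using X.hclass_eq_iff[OF X Y(1)] Y(2) by blast
  from fixed_end_map_map[OF this X.X_complex[OF X] X.X_complex[OF Y(1)]]
  have "hclass C' n (map_complex F X) = hclass C' n (map_complex F Y)"
    using X'.hclass_eq_iff[OF map_complex_closed[OF X] map_complex_closed[OF Y(1)]] by blast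
  thus ?thesis by (simp add: \<Gamma>_def Y_def)
qed

lemma \<Gamma>_closed: "\<delta> \<in> ext_classes C n \<X> B A \<Longrightarrow> \<Gamma> B A \<delta> \<in> ext_classes C' n \<X>' (FOb F B) (FOb F A)"
  by (erule X.ext_classesE)
    (use X'.hclass_in_ext_classes[OF map_complex_closed] in \<open>auto simp: \<Gamma>_eq\<close>)

lemma \<Gamma>_natural:
  assumes f: "f \<in> Arr C" and g: "g \<in> Arr C" and \<delta>: "\<delta> \<in> ext_classes C n \<X> (Cod C g) (Dom C f)"
  shows "\<Gamma> (Dom C g) (Cod C f) (ext_map C n \<X> g f \<delta>) =
    ext_map C' n \<X>' (FArr F g) (FArr F f) (\<Gamma> (Cod C g) (Dom C f) \<delta>)"
proof -
  obtain S where S: "S \<in> \<X>" and ends: "Ob S 0 = Dom C f" "Ob S (n + 1) = Cod C g" and \<delta>S: "\<delta> = hclass C n S"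
    using \<delta> by (rule X.ext_classesE)
  obtain P Q \<phi> \<psi> where PQ: "P \<in> \<X>" "Q \<in> \<X>" and \<phi>: "chain_map C (n + 1) S P \<phi>" "\<phi> 0 = f" "\<phi> (n + 1) = Idn C (Ob S (n + 1))"
    and \<psi>: "chain_map C (n + 1) Q P \<psi>" "\<psi> 0 = Idn C (Ob P 0)" "\<psi> (n + 1) = g"
    and ext: "ext_map C n \<X> g f (hclass C n S) = hclass C n Q"
    using X.ext_map_realization[OF S f _ g] ends by metis
  note Sc = X.X_complex[OF S]
  note Fs = D.chain_map_Idn[OF is_complex_map[OF Sc]]
  have "ext_map C' n \<X>' (FArr F g) (Comp C' (FArr F (\<phi> 0)) (Idn C' (Ob (map_complex F S) 0)))
      (hclass C' n (map_complex F S)) = hclass C' n (map_complex F Q)"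
    by (rule ext_map_map[OF S PQ map_complex_closed[OF S] \<phi>(1,3) \<psi>(1,2) Fs])
      (use f g ends \<psi>(3) in \<open>simp_all add: FArr_hom arr\<close>)
  moreover have "Comp C' (FArr F (\<phi> 0)) (Idn C' (Ob (map_complex F S) 0)) = FArr F f"
    using f \<phi>(2) ends by (simp add: FArr_hom arr)
  ultimately show ?thesis
    using S PQ by (simp add: \<delta>S ext \<Gamma>_eq)
qed

lemma \<Gamma>_baer_sum:
  assumes "\<delta> \<in> ext_classes C n \<X> B A" "\<epsilon> \<in> ext_classes C n \<X> B A"
  shows "\<Gamma> B A (baer_sum C n \<X> B A \<delta> \<epsilon>) = baer_sum C' n \<X>' (FOb F B) (FOb F A) (\<Gamma> B A \<delta>) (\<Gamma> B A \<epsilon>)"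
proof -
  obtain X where X: "X \<in> \<X>" "Ob X 0 = A" "Ob X (n + 1) = B" "\<delta> = hclass C n X"
    using assms(1) by (rule X.ext_classesE)
  obtain Y where Y: "Y \<in> \<X>" "Ob Y 0 = A" "Ob Y (n + 1) = B" "\<epsilon> = hclass C n Y"
    using assms(2) by (rule X.ext_classesE)
  note Xc = X.X_complex[OF X(1)] and Yc = X.X_complex[OF Y(1)]
  have AB: "A \<in> Obj C" "B \<in> Obj C" using is_complexD(1)[OF Xc] X(2,3) by auto
  let ?S = "complex_sum C X Y" and ?S' = "complex_sum C' (map_complex F X) (map_complex F Y)"
  have S: "?S \<in> \<X>" by (rule X.complex_sum_closed[OF X(1) Y(1)])
  have S': "?S' \<in> \<X>'" by (rule X'.complex_sum_closed[OF map_complex_closed[OF X(1)] map_complex_closed[OF Y(1)]])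
  have cod: "codiagonal C A \<in> Arr C" "Dom C (codiagonal C A) = Ob ?S 0"
    using AB X(2) Y(2) by (simp_all add: codiagonal_def arr)
  have dia: "diagonal C B \<in> Arr C" "Cod C (diagonal C B) = Ob ?S (n + 1)"
    using AB X(3) Y(3) by (simp_all add: diagonal_def arr)
  obtain P Q \<phi> \<psi> where PQ: "P \<in> \<X>" "Q \<in> \<X>"
    and \<phi>: "chain_map C (n + 1) ?S P \<phi>" "\<phi> 0 = codiagonal C A" "\<phi> (n + 1) = Idn C (Ob ?S (n + 1))"
    and \<psi>: "chain_map C (n + 1) Q P \<psi>" "\<psi> 0 = Idn C (Ob P 0)" "\<psi> (n + 1) = diagonal C B"
    and ext: "ext_map C n \<X> (diagonal C B) (codiagonal C A) (hclass C n ?S) = hclass C n Q"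
    using X.ext_map_realization[OF S cod dia] by metis
  have dia': "diagonal C' (FOb F B) \<in> Arr C'" "Cod C' (diagonal C' (FOb F B)) = bobj (biprod C' (FOb F B) (FOb F B))"
    using AB by (simp_all add: diagonal_def FOb_Obj arr)
  \<comment> \<open>The sum of the images is taken as \<open>S'\<close>; the comparison morphism
    turns the image of the codiagonal of A into the codiagonal of F A, and the diagonal of F B into
    the image of the diagonal.\<close>
  have "ext_map C' n \<X>' (diagonal C' (FOb F B))
      (Comp C' (FArr F (\<phi> 0)) (sum_comparison (Ob X 0) (Ob Y 0))) (hclass C' n ?S') = hclass C' n (map_complex F Q)"
    by (rule ext_map_map[OF S PQ S' \<phi>(1,3) \<psi>(1,2) chain_map_sum_comparison[OF Xc Yc]])
      (use AB X(3) Y(3) \<psi>(3) in \<open>simp_all add: sum_comparison_diagonal dia'\<close>)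
  hence "ext_map C' n \<X>' (diagonal C' (FOb F B)) (codiagonal C' (FOb F A)) (hclass C' n ?S') = hclass C' n (map_complex F Q)"
    using \<phi>(2) X(2) Y(2) AB by (simp add: sum_comparison_codiagonal)
  thus ?thesis
    using PQ X(1,4) Y(1,4) ext map_complex_closed
    by (simp add: X.baer_sum_eq X'.baer_sum_eq \<Gamma>_eq)
qed

lemma n_exangulated: "n_exangulated_functor n (exang_of_exact C n \<X>) (exang_of_exact C' n \<X>') F"
proof -
  have "ext_nat_trans (exang_of_exact C n \<X>) (exang_of_exact C' n \<X>') F \<Gamma>"
    unfolding ext_nat_trans_def
    by (auto simp: exang_of_exact_def ext_group_def \<Gamma>_natural \<Gamma>_baer_sum \<Gamma>_closed intro!: homI)
  \<comment> \<open>The realization condition ranges over all complexes in the class;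
    \<open>hclass_in_\<X>\<close> shows that such a complex is admissible, so that
    \<open>\<Gamma>_eq\<close> applies.\<close>
  moreover have "\<Gamma> B A \<delta> = hclass C' n (map_complex F X)"
    if \<delta>: "\<delta> \<in> ext_classes C n \<X> B A" and X: "X \<in> complexes_between C n A B" "\<delta> = hclass C n X" for A B \<delta> X
  proof -
    obtain Y where "Y \<in> \<X>" "\<delta> = hclass C n Y" using \<delta> by (rule X.ext_classesE)
    hence "X \<in> \<X>" using X.hclass_in_\<X>[of Y X] X by (simp add: complexes_between_def)
    thus ?thesis using X(2) by (simp add: \<Gamma>_eq)
  qed
  ultimately show ?thesis
    unfolding n_exangulated_functor_def using F
    by (auto simp: exang_of_exact_def ext_group_def intro!: exI[of _ \<Gamma>])
qed

end

theorem theorem2p34: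
  fixes C :: "('o, 'm) precat" and \<X> :: "('o, 'm) cochain set"
    and C' :: "('p, 'q) precat" and \<X>' :: "('p, 'q) cochain set"
    and n :: nat and F :: "('o, 'm, 'p, 'q) func_data"
  assumes "n \<ge> 1"
    and "n_exact_category C n \<X>"
    and "n_exact_category C' n \<X>'"
    and "additive_functor C C' F"
  shows "n_exact_functor C \<X> C' \<X>' F \<longleftrightarrow>
    n_exangulated_functor n (exang_of_exact C n \<X>) (exang_of_exact C' n \<X>') F"
proof
  have X: "pos_n_exact_category C n \<X>" and X': "pos_n_exact_category C' n \<X>'"
    using assms(1-3) by (simp_all add: pos_n_exact_category_def pos_n_exact_category_axioms_def)
  interpret X: pos_n_exact_category C n \<X> by (rule X)
  interpret X': pos_n_exact_category C' n \<X>' by (rule X')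
  interpret additive_functor_between C C' F
    by unfold_locales (rule assms(4))
  show "n_exangulated_functor n (exang_of_exact C n \<X>) (exang_of_exact C' n \<X>') F"
    if "n_exact_functor C \<X> C' \<X>' F"
  proof -
    interpret n_exact_functor_between C C' F n \<X> \<X>'
      by unfold_locales (use that in \<open>auto simp: n_exact_functor_def\<close>)
    show ?thesis by (rule n_exangulated)
  qed
  assume "n_exangulated_functor n (exang_of_exact C n \<X>) (exang_of_exact C' n \<X>') F"
  then obtain \<Gamma> where
    nat: "ext_nat_trans (exang_of_exact C n \<X>) (exang_of_exact C' n \<X>') F \<Gamma>" and
    real: "\<And>A B \<delta> X. \<lbrakk>A \<in> Obj C; B \<in> Obj C; \<delta> \<in> ext_classes C n \<X> B A; X \<in> complexes_between C n A B;
      \<delta> = hclass C n X\<rbrakk> \<Longrightarrow> \<Gamma> B A \<delta> = hclass C' n (map_complex F X)"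
    by (auto simp: n_exangulated_functor_def exang_of_exact_def ext_group_def)
  have "map_complex F X \<in> \<X>'" if Xx: "X \<in> \<X>" for X
  proof -
    let ?A = "Ob X 0" and ?B = "Ob X (n + 1)"
    note Xc = X.X_complex[OF Xx]
    have AB: "?A \<in> Obj C" "?B \<in> Obj C" using is_complexD(1)[OF Xc] by auto
    have cl: "hclass C n X \<in> ext_classes C n \<X> ?B ?A" by (rule X.hclass_in_ext_classes[OF Xx])
    \<comment> \<open>The values of \<Gamma> are classes of admissible sequences by definition of
      the target group, which is how admissibility over \<open>C'\<close> enters.\<close>
    have "\<Gamma> ?B ?A (hclass C n X) \<in> ext_classes C' n \<X>' (FOb F ?B) (FOb F ?A)"
      using nat AB cl by (auto simp: ext_nat_trans_def exang_of_exact_def ext_group_def hom_def)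
    moreover have "\<Gamma> ?B ?A (hclass C n X) = hclass C' n (map_complex F X)"
      by (rule real) (use AB cl Xc in \<open>simp_all add: complexes_between_def\<close>)
    ultimately obtain Y where "Y \<in> \<X>'" "hclass C' n (map_complex F X) = hclass C' n Y"
      by (auto elim: X'.ext_classesE)
    thus ?thesis using X'.hclass_in_\<X> is_complex_map[OF Xc] by blast
  qed
  thus "n_exact_functor C \<X> C' \<X>' F" using assms(4) by (auto simp: n_exact_functor_def)
qed

end
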